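(* There exist an absolute constant $C>0$ and, for every $n\ge 2$, a deterministic online algorithm for stochastic online sorting with $n$ items and $n$ cells whose expected cost is at most $\log n\cdot 2^{C\log^* n}$. That is, the optimal expected cost of stochastic online sorting is $\log n\cdot 2^{O(\log^* n)}$ (achieved by a deterministic algorithm).
   Context: Stochastic online sorting: there is an array $A$ of $n$ initially empty cells. Items $x_1,\dots,x_n$ arrive one at a time, each drawn independently and uniformly at random from $[0,1]$. When item $x_t$ arrives, the algorithm must immediately and irrevocably place it into a currently empty cell; a deterministic algorithm chooses this cell as a function of $x_1,\dots,x_t$ only (and its own previous choices). After all $n$ items are placed, the cost is $\sum_{i=1}^{n-1}|A[i+1]-A[i]|$. The expected cost is taken over the random input. $\log^* n$ denotes the iterated logarithm (the number of times the logarithm must be applied to $n$ before the result is at most $1$). *)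

theory Defs
  imports "HOL-Probability.Probability"
begin

(* Items and cells are numbered from 0.  A deterministic online algorithm is a
   function A from the list of items seen so far, the current one being the last,
   to the cell for the current item.  Its previous choices are
   determined by the same list, so they are not passed as a separate argument. *)

definition placement :: "(real list \<Rightarrow> nat) \<Rightarrow> (nat \<Rightarrow> real) \<Rightarrow> nat \<Rightarrow> nat" where
  "placement A x t = A (map x [0..<Suc t])"

definition uniform_input :: "nat \<Rightarrow> (nat \<Rightarrow> real) measure" where
  "uniform_input n = (\<Pi>\<^sub>M t\<in>{..<n}. uniform_measure lborel {0..1})"

(* The measurability condition makes the expected cost meaningful: the integral of
   a non-measurable function is 0 by convention (see integrable_cost below). *)

definition online_algorithm :: "nat \<Rightarrow> (real list \<Rightarrow> nat) \<Rightarrow> bool" where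
  "online_algorithm n A \<longleftrightarrow>
     (\<forall>x. (\<forall>t<n. x t \<in> {0..1}) \<longrightarrow>
        (\<forall>t<n. placement A x t \<in> {..<n} - placement A x ` {..<t})) \<and>
     (\<forall>t<n. (\<lambda>x. placement A x t) \<in> uniform_input n \<rightarrow>\<^sub>M count_space UNIV)"

definition cell :: "nat \<Rightarrow> (real list \<Rightarrow> nat) \<Rightarrow> (nat \<Rightarrow> real) \<Rightarrow> nat \<Rightarrow> real" where
  "cell n A x i = x (the_inv_into {..<n} (placement A x) i)"

definition cost :: "nat \<Rightarrow> (real list \<Rightarrow> nat) \<Rightarrow> (nat \<Rightarrow> real) \<Rightarrow> real" where
  "cost n A x = (\<Sum>i<n - 1. \<bar>cell n A x (Suc i) - cell n A x i\<bar>)"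

definition expected_cost :: "nat \<Rightarrow> (real list \<Rightarrow> nat) \<Rightarrow> real" where
  "expected_cost n A = (\<integral>x. cost n A x \<partial>uniform_input n)"

definition log_star :: "real \<Rightarrow> nat" where
  "log_star r = (LEAST k. (log 2 ^^ k) r \<le> 1)"

lemma log_star_exists: "\<exists>k. (log 2 ^^ k) r \<le> 1"
proof -
  have aux: "\<exists>k. (log 2 ^^ k) r \<le> 1" if "r \<le> real m" for m r
    using that
  proof (induction m arbitrary: r)
    case 0
    then show ?case by (intro exI[of _ 0]) auto
  next
    case (Suc m)
    show ?case
    proof (cases "r \<le> 1")
      case True
      then show ?thesis by (intro exI[of _ 0]) auto
    next
      case False
      have "r \<le> 2 ^ m"
      proof -
        have "Suc m \<le> 2 ^ m" by (induction m) auto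
        then have "real (Suc m) \<le> 2 ^ m" by (metis of_nat_le_iff of_nat_numeral of_nat_power)
        with Suc.prems show ?thesis by linarith
      qed
      with False have "log 2 r \<le> real m"
        by (simp add: log_le_iff powr_realpow)
      from Suc.IH[OF this] obtain k where "(log 2 ^^ k) (log 2 r) \<le> 1" by blast
      then have "(log 2 ^^ Suc k) r \<le> 1" by (simp add: funpow_swap1)
      then show ?thesis by blast
    qed
  qed
  obtain m where "r \<le> real m" using real_arch_simple by blast
  then show ?thesis by (rule aux)
qed

lemma prob_space_uniform_input: "prob_space (uniform_input n)"
  unfolding uniform_input_def
  by (intro prob_space_PiM prob_space_uniform_measure) auto

lemma AE_uniform_input: "AE x in uniform_input n. \<forall>t<n. x t \<in> {0..1}"
proof -
  have "AE x in uniform_input n. x t \<in> {0..1}" if "t < n" for t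
    unfolding uniform_input_def
    using that
    by (intro AE_PiM_component prob_space_uniform_measure)
       (auto simp: AE_uniform_measure)
  then have "AE x in uniform_input n. \<forall>t\<in>{..<n}. x t \<in> {0..1}"
    by (intro AE_finite_allI) auto
  then show ?thesis by (simp add: Ball_def)
qed

lemma placement_bij_betw:
  assumes "online_algorithm n A" and "\<forall>t<n. x t \<in> {0..1}"
  shows "bij_betw (placement A x) {..<n} {..<n}"
proof -
  have *: "placement A x t \<in> {..<n} - placement A x ` {..<t}" if "t < n" for t
    using assms that unfolding online_algorithm_def by blast
  have "placement A x s \<noteq> placement A x t" if "s < t" "t < n" for s t
    using *[OF that(2)] that(1) by (metis DiffD2 imageI lessThan_iff)
  then have "inj_on (placement A x) {..<n}"
    unfolding inj_on_def by (metis lessThan_iff linorder_neqE_nat)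
  moreover have "placement A x ` {..<n} \<subseteq> {..<n}" using * by auto
  ultimately show ?thesis
    by (simp add: bij_betw_def endo_inj_surj)
qed

lemma borel_measurable_cell:
  assumes A: "online_algorithm n A"
  shows "(\<lambda>x. cell n A x i) \<in> borel_measurable (uniform_input n)"
proof -
  have meas: "(\<lambda>x. placement A x t) \<in> uniform_input n \<rightarrow>\<^sub>M count_space UNIV" if "t < n" for t
    using A that unfolding online_algorithm_def by blast
  define L where "L m x = map (placement A x) [0..<m]" for m x
  have L: "L m \<in> uniform_input n \<rightarrow>\<^sub>M count_space UNIV" if "m \<le> n" for m
    using that
  proof (induction m)
    case 0
    then show ?case by (simp add: L_def)
  next
    case (Suc m)
    have "(\<lambda>x. (\<lambda>l x. l @ [placement A x m]) (L m x) x) \<in> uniform_input n \<rightarrow>\<^sub>M count_space UNIV"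
    proof (rule measurable_compose_countable[where f = "\<lambda>l x. l @ [placement A x m]" and g = "L m"])
      show "L m \<in> uniform_input n \<rightarrow>\<^sub>M count_space UNIV" using Suc by simp
      fix l :: "nat list"
      show "(\<lambda>x. l @ [placement A x m]) \<in> uniform_input n \<rightarrow>\<^sub>M count_space UNIV"
        using meas[of m] Suc.prems by (auto intro: measurable_compose)
    qed
    then show ?case by (simp add: L_def)
  qed
  have coord: "(\<lambda>x. x k) \<in> borel_measurable (uniform_input n)" for k
  proof (cases "k < n")
    case True
    have "(\<lambda>x. x k) \<in> uniform_input n \<rightarrow>\<^sub>M uniform_measure lborel {0..1::real}"
      unfolding uniform_input_def using True by (intro measurable_component_singleton) auto
    then show ?thesis by (simp cong: measurable_cong_sets)
  next
    case False
    have "(\<lambda>x. undefined::real) \<in> borel_measurable (uniform_input n)" by simp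
    moreover have "x k = undefined" if "x \<in> space (uniform_input n)" for x
      using that False by (auto simp: uniform_input_def space_PiM PiE_def extensional_def)
    ultimately show ?thesis
      using measurable_cong[of "uniform_input n" "\<lambda>x. x k" "\<lambda>x. undefined" borel] by simp
  qed
  have eq: "the_inv_into {..<n} (placement A x) i = the_inv_into {..<n} ((!) (L n x)) i" for x
    unfolding the_inv_into_def L_def by (rule arg_cong[where f = The]) (auto simp: fun_eq_iff)
  have "(\<lambda>x. x (the_inv_into {..<n} ((!) (L n x)) i)) \<in> borel_measurable (uniform_input n)"
    by (rule measurable_compose_countable[where f = "\<lambda>l x. x (the_inv_into {..<n} ((!) l) i)"])
       (use L[of n] coord in auto)
  then show ?thesis by (simp add: cell_def eq)
qed

lemma integrable_cost:
  assumes A: "online_algorithm n A"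
  shows "integrable (uniform_input n) (cost n A)"
proof -
  interpret prob_space "uniform_input n" by (rule prob_space_uniform_input)
  have cell: "cell n A x i \<in> {0..1}" if x: "\<forall>t<n. x t \<in> {0..1}" and "i < n" for x i
  proof -
    have b: "bij_betw (placement A x) {..<n} {..<n}" by (rule placement_bij_betw[OF A x])
    have "the_inv_into {..<n} (placement A x) i \<in> {..<n}"
      using b \<open>i < n\<close> by (intro the_inv_into_into) (auto simp: bij_betw_def)
    then show ?thesis using x by (auto simp: cell_def)
  qed
  have "norm (cost n A x) \<le> real n" if x: "\<forall>t<n. x t \<in> {0..1}" for x
  proof -
    have "cost n A x \<le> (\<Sum>i<n - 1. 1)"
      unfolding cost_def
    proof (rule sum_mono)
      fix i assume "i \<in> {..<n - 1}"
      then have "cell n A x (Suc i) \<in> {0..1}" "cell n A x i \<in> {0..1}" using cell[OF x] by auto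
      then show "\<bar>cell n A x (Suc i) - cell n A x i\<bar> \<le> 1" by auto
    qed
    moreover have "0 \<le> cost n A x" unfolding cost_def by (intro sum_nonneg) auto
    ultimately show ?thesis by simp
  qed
  then have "AE x in uniform_input n. norm (cost n A x) \<le> real n"
    using AE_uniform_input[of n] by (auto elim: eventually_mono)
  moreover have "cost n A \<in> borel_measurable (uniform_input n)"
    unfolding cost_def[abs_def] using borel_measurable_cell[OF A] by measurable
  ultimately show ?thesis by (rule integrable_const_bound)
qed

end

theory Submission
  imports Defs
begin

text \<open>
  Idea. Split $[0,1]$ into $K$ equal intervals, each with a bin of cells, and keep a contiguous reserve. Route
  items to the bin of their interval until the bins are almost full; by concentration the remaining
  capacities then differ little, and the reserve supplies every bin with one further contiguous chunk that makes
  all of them equal again. Then groups of $p$ bins are merged into bins of larger intervals. Chunks are filled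
  recursively, and merging $p$ bins is an instance of the same problem, with $K = p$. If $p$ is polylogarithmic in
  the number of items, every merge costs $O(\log p)$ times the constant of the previous level of
  recursion, and there are about $\log n / \log p$ merges. Hence each level of recursion multiplies the cost by a constant and
  replaces $p$ by about $\log p$.

  Routing depends only on the interval of an item. Its relative position in the interval is what the
  algorithm inside the bin sees, and this is exactly uniform and independent of the routing, even for the few items
  that are sent to a wrong bin; these only pay for their displacement. With a finite resolution, all probabilities are
  averages over words.
\<close>

section \<open>Averages over words\<close>

text \<open>The capacities left after a routing phase are random, but their sum is not, since the
  number of routed items is fixed. So the chunks that equalise the bins have random sizes and a
  deterministic total, and the reserve spent on each stage is known in advance.

  If routing stops with \<open>d\<close> places left per bin on average, out of \<open>h\<close>,
  the loads deviate by about the square root of \<open>h * ln K\<close>, and \<open>d\<close> must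
  exceed this. For at most \<open>p ^ (6 * p)\<close> bins a \<open>d\<close> of the order of the
  square root of \<open>h * p ^ 3\<close> is enough. A capacity \<open>p ^ m\<close> can thus be
  lowered to \<open>p ^ (m div 2 + 2)\<close>. The exponent 4 is a fixed point of this map, and so
  merges start from \<open>p ^ 4\<close>.

  A level with cost \<open>B\<close> for \<open>p\<close> yields one with cost
  \<open>200 * p * B\<close> for \<open>p ^ p\<close>. As
  \<open>log 2 (p ^ p) = p * log 2 p\<close>, the ratio of the cost to \<open>log 2 p\<close> grows
  by the factor 200 only, and the number of levels below \<open>n\<close> is at most
  \<open>log_star n\<close>.\<close>

primrec avg :: "nat \<Rightarrow> nat \<Rightarrow> (nat list \<Rightarrow> real) \<Rightarrow> real" where
  "avg N 0 F = F []"
| "avg N (Suc n) F = avg N n (\<lambda>xs. (\<Sum>x<N. F (xs @ [x])) / real N)"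

definition words :: "nat \<Rightarrow> nat \<Rightarrow> nat list set" where
  "words N n = {xs. length xs = n \<and> set xs \<subseteq> {..<N}}"

lemma words_0 [simp]: "words N 0 = {[]}"
  by (auto simp: words_def)

lemma words_snoc: "xs @ [x] \<in> words N (Suc n) \<longleftrightarrow> xs \<in> words N n \<and> x < N"
  by (auto simp: words_def)

lemma words_SucE:
  assumes "xs \<in> words N (Suc n)"
  obtains ys y where "xs = ys @ [y]" "ys \<in> words N n" "y < N"
  using assms by (cases xs rule: rev_cases) (auto simp: words_def)

lemma words_splitE:
  assumes "xs \<in> words N (m + n)"
  obtains ys zs where "xs = ys @ zs" "ys \<in> words N m" "zs \<in> words N n"
proof -
  have "xs = take m xs @ drop m xs" by simp
  moreover have "take m xs \<in> words N m" "drop m xs \<in> words N n"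
    using assms set_take_subset[of m xs] set_drop_subset[of m xs] by (auto simp: words_def)
  ultimately show ?thesis using that by blast
qed

lemma words_extend:
  assumes "xs \<in> words N m" "m \<le> n" "0 < N"
  obtains ys where "xs @ ys \<in> words N n"
proof -
  have "xs @ replicate (n - m) 0 \<in> words N n" using assms by (auto simp: words_def)
  then show ?thesis using that by blast
qed

lemma avg_mono:
  "(\<And>xs. xs \<in> words N n \<Longrightarrow> F xs \<le> G xs) \<Longrightarrow> avg N n F \<le> avg N n G"
proof (induction n arbitrary: F G)
  case (Suc n)
  show ?case unfolding avg.simps
    by (rule Suc.IH) (auto intro!: divide_right_mono sum_mono Suc.prems simp: words_snoc)
qed simp

lemma avg_cong:
  "(\<And>xs. xs \<in> words N n \<Longrightarrow> F xs = G xs) \<Longrightarrow> avg N n F = avg N n G"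
  by (intro antisym avg_mono) auto

lemma avg_add: "avg N n (\<lambda>xs. F xs + G xs) = avg N n F + avg N n G"
  by (induction n arbitrary: F G) (simp_all add: sum.distrib add_divide_distrib)

lemma avg_cmult: "avg N n (\<lambda>xs. c * F xs) = c * avg N n F"
proof (induction n arbitrary: F)
  case (Suc n)
  have "(\<lambda>xs. (\<Sum>x<N. c * F (xs @ [x])) / real N) = (\<lambda>xs. c * ((\<Sum>x<N. F (xs @ [x])) / real N))"
    by (simp add: sum_distrib_left)
  then show ?case by (simp only: avg.simps Suc.IH)
qed simp

lemma avg_const: "0 < N \<Longrightarrow> avg N n (\<lambda>_. c) = c"
  by (induction n) simp_all

lemma avg_sum: "finite I \<Longrightarrow> 0 < N \<Longrightarrow> avg N n (\<lambda>xs. \<Sum>i\<in>I. F i xs) = (\<Sum>i\<in>I. avg N n (F i))"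
  by (induction I rule: finite_induct) (simp_all add: avg_add avg_const)

lemma avg_append: "avg N (m + n) F = avg N m (\<lambda>xs. avg N n (\<lambda>ys. F (xs @ ys)))"
proof (induction n arbitrary: F)
  case (Suc n)
  show ?case using Suc.IH[of "\<lambda>xs. (\<Sum>x<N. F (xs @ [x])) / real N"] by simp
qed simp

lemma avg_Cons: "avg N (Suc n) F = (\<Sum>x<N. avg N n (\<lambda>xs. F (x # xs))) / real N"
  using avg_append[of N 1 n F] by simp

lemma sum_lessThan_mult:
  fixes f :: "nat \<Rightarrow> 'a::comm_monoid_add"
  shows "(\<Sum>x<K * M. f x) = (\<Sum>s<K. \<Sum>v<M. f (s * M + v))"
proof -
  have "(\<Sum>x<K * M. f x) = (\<Sum>s<K. \<Sum>x\<in>{s * M..<s * M + M}. f x)"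
    by (rule sum.nat_group[symmetric])
  also have "\<dots> = (\<Sum>s<K. \<Sum>v<M. f (s * M + v))"
  proof (rule sum.cong[OF refl])
    fix s
    show "(\<Sum>x\<in>{s * M..<s * M + M}. f x) = (\<Sum>v<M. f (s * M + v))"
      by (rule sum.reindex_bij_witness[of _ "\<lambda>v. s * M + v" "\<lambda>x. x - s * M"]) auto
  qed
  finally show ?thesis .
qed

lemma avg_div:
  assumes "0 < M"
  shows "avg (K * M) n (\<lambda>xs. F (map (\<lambda>x. x div M) xs)) = avg K n F"
proof (induction n arbitrary: F)
  case (Suc n)
  have "(\<Sum>x<K * M. F (map (\<lambda>x. x div M) (xs @ [x]))) / real (K * M) =
        (\<Sum>s<K. F (map (\<lambda>x. x div M) xs @ [s])) / real K" for xs
  proof -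
    have "(\<Sum>x<K * M. F (map (\<lambda>x. x div M) (xs @ [x]))) =
          (\<Sum>s<K. \<Sum>v<M. F (map (\<lambda>x. x div M) xs @ [s]))"
      unfolding sum_lessThan_mult by (intro sum.cong) (auto simp: assms)
    then show ?thesis using assms by (simp add: sum_distrib_left[symmetric] del: map_append)
  qed
  then show ?case using Suc.IH[of "\<lambda>xs. (\<Sum>s<K. F (xs @ [s])) / real K"] by simp
qed simp

section \<open>Variation of a list\<close>

fun variation :: "real list \<Rightarrow> real" where
  "variation (x # y # zs) = \<bar>y - x\<bar> + variation (y # zs)"
| "variation [x] = 0"
| "variation [] = 0"

lemma variation_Cons: "xs \<noteq> [] \<Longrightarrow> variation (x # xs) = \<bar>hd xs - x\<bar> + variation xs"
  by (cases xs) auto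

lemma variation_snoc: "xs \<noteq> [] \<Longrightarrow> variation (xs @ [x]) = variation xs + \<bar>x - last xs\<bar>"
  by (induction xs rule: variation.induct) auto

lemma variation_ends:
  "xs \<noteq> [] \<Longrightarrow> variation (a # xs @ [b]) = \<bar>hd xs - a\<bar> + variation xs + \<bar>b - last xs\<bar>"
  by (simp add: variation_Cons variation_snoc)

lemma variation_split: "variation (xs @ a # ys) = variation (xs @ [a]) + variation (a # ys)"
  by (induction xs rule: variation.induct) auto

lemma variation_remove: "variation (xs @ ys) \<le> variation (xs @ a # ys)"
proof (induction xs rule: variation.induct)
  case (2 x)
  then show ?case by (cases ys) auto
next
  case 3
  then show ?case by (cases ys) auto
qed auto

lemma variation_insert: "variation (xs @ ys) \<le> variation (xs @ [a]) + variation (a # ys)"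
  using variation_remove variation_split by metis

lemma variation_perturb:
  "variation (map f is) \<le> variation (map g is) + 2 * (\<Sum>i\<leftarrow>is. \<bar>f i - g i\<bar>)"
proof -
  \<comment> \<open>An entry lies in two differences, the head in only one. The spare copy of the
    error at the head is the slack that the induction needs.\<close>
  have "variation (map f is) + (if is = [] then 0 else \<bar>f (hd is) - g (hd is)\<bar>)
      \<le> variation (map g is) + 2 * (\<Sum>i\<leftarrow>is. \<bar>f i - g i\<bar>)"
  proof (induction "is")
    case (Cons i "is")
    show ?case
    proof (cases "is")
      case (Cons j js)
      show ?thesis using Cons.IH unfolding Cons by simp (smt (verit))
    qed simp
  qed simp
  then show ?thesis by (smt (verit))
qed

lemma variation_scale: "0 \<le> k \<Longrightarrow> variation (map (\<lambda>i. c + k * f i) is) = k * variation (map f is)"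
proof (induction "is" rule: induct_list012)
  case (3 i j js)
  have "\<bar>c + k * f j - (c + k * f i)\<bar> = k * \<bar>f j - f i\<bar>"
    using \<open>0 \<le> k\<close> by (simp add: abs_mult flip: right_diff_distrib)
  then show ?case using 3 by (simp add: algebra_simps)
qed auto

text \<open>The block is closed off by both end points of its interval, so that blocks can be
  chained without knowledge of their first and last entries. Replacing \<open>c i\<close> by a value
  inside the interval costs two copies of the error, as an entry has two neighbours;
  \<open>2 * k\<close> pays for the ways from and to the end points.\<close>

lemma variation_block:
  assumes "0 \<le> k" and s: "\<And>i. i < r \<Longrightarrow> s i \<in> {0..1}"
    and d: "\<And>i. i < r \<Longrightarrow> \<bar>c i - (a + k * s i)\<bar> \<le> \<delta> i"
  shows "variation (a # map c [0..<r] @ [a + k]) \<le> k * variation (map s [0..<r]) + 2 * (\<Sum>i<r. \<delta> i) + 2 * k"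
proof (cases "r = 0")
  case True
  then show ?thesis using \<open>0 \<le> k\<close> by simp
next
  case False
  let ?p = "\<lambda>i. a + k * s i"
  have k: "0 \<le> k * s i \<and> k * s i \<le> k" if "i < r" for i
    using s[OF that] \<open>0 \<le> k\<close> by (auto simp: mult_left_le)
  have ne: "map g [0..<r] \<noteq> []" for g :: "nat \<Rightarrow> real" using False by simp
  have hl: "hd (map g [0..<r]) = g 0" "last (map g [0..<r]) = g (r - 1)" for g :: "nat \<Rightarrow> real"
    using False by (auto simp: hd_map last_map)
  have "variation (a # map c [0..<r] @ [a + k])
      = \<bar>c 0 - a\<bar> + variation (map c [0..<r]) + \<bar>a + k - c (r - 1)\<bar>"
    using variation_ends[OF ne[of c]] hl[of c] by simp
  \<comment> \<open>The pairs put true and perceived values on one index list, with the end points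
    as entries without error.\<close>
  have "variation (a # map c [0..<r] @ [a + k])
     \<le> variation (a # map ?p [0..<r] @ [a + k]) + 2 * (\<Sum>i\<leftarrow>[0..<r]. \<bar>c i - ?p i\<bar>)"
    using variation_perturb[of fst "(a, a) # map (\<lambda>i. (c i, ?p i)) [0..<r] @ [(a + k, a + k)]" snd]
    by (simp add: comp_def)
  also have "(\<Sum>i\<leftarrow>[0..<r]. \<bar>c i - ?p i\<bar>) = (\<Sum>i<r. \<bar>c i - ?p i\<bar>)"
    by (simp add: interv_sum_list_conv_sum_set_nat lessThan_atLeast0)
  also have "\<dots> \<le> (\<Sum>i<r. \<delta> i)" using d by (intro sum_mono) auto
  also have "variation (a # map ?p [0..<r] @ [a + k])
      = \<bar>?p 0 - a\<bar> + variation (map ?p [0..<r]) + \<bar>a + k - ?p (r - 1)\<bar>"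
    using variation_ends[OF ne[of ?p]] hl[of ?p] by simp
  also have "\<dots> \<le> k + k * variation (map s [0..<r]) + k"
    using k[of 0] k[of "r - 1"] False \<open>0 \<le> k\<close> by (simp add: variation_scale)
  finally show ?thesis by simp
qed

text \<open>The points \<open>Q / K\<close> are inserted between the blocks, which cannot lower the
  variation. They cost at most \<open>2 / K\<close> per block, and the step from 1 to
  \<open>L\<close> costs at most 1: this is the 3 of every composition.\<close>

lemma variation_blocks:
  assumes "0 < K" and s: "\<And>Q i. Q < K \<Longrightarrow> i < r Q \<Longrightarrow> s Q i \<in> {0..1}"
    and d: "\<And>Q i. Q < K \<Longrightarrow> i < r Q \<Longrightarrow> \<bar>c Q i - (real Q + s Q i) / real K\<bar> \<le> \<delta> Q i"
    and L: "set L \<subseteq> {0..1}"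
  shows "variation (concat (map (\<lambda>Q. map (c Q) [0..<r Q]) [0..<K]) @ L) \<le>
     (\<Sum>Q<K. variation (map (s Q) [0..<r Q]) / real K + 2 * (\<Sum>i<r Q. \<delta> Q i)) + variation L + 3"
proof -
  let ?B = "\<lambda>j. concat (map (\<lambda>Q. map (c Q) [0..<r Q]) [0..<j])"
  have "variation (?B j @ [real j / real K]) \<le>
     (\<Sum>Q<j. variation (map (s Q) [0..<r Q]) / real K + 2 * (\<Sum>i<r Q. \<delta> Q i)) + 2 * real j / real K"
    if "j \<le> K" for j
    using that
  proof (induction j)
    case (Suc j)
    have e: "real (Suc j) / real K = real j / real K + 1 / real K" by (simp add: add_divide_distrib)
    have "variation (?B (Suc j) @ [real (Suc j) / real K]) \<le> variation (?B j @ [real j / real K]) +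
        variation (real j / real K # map (c j) [0..<r j] @ [real j / real K + 1 / real K])"
      unfolding e using variation_insert[of "?B j"] by simp
    also have "variation (real j / real K # map (c j) [0..<r j] @ [real j / real K + 1 / real K])
       \<le> 1 / real K * variation (map (s j) [0..<r j]) + 2 * (\<Sum>i<r j. \<delta> j i) + 2 * (1 / real K)"
      using s[of j] d[of j] Suc.prems by (intro variation_block) (auto simp: add_divide_distrib)
    finally show ?case using Suc by (simp add: add_divide_distrib)
  qed simp
  from this[of K] have 1: "variation (?B K @ [1]) \<le>
     (\<Sum>Q<K. variation (map (s Q) [0..<r Q]) / real K + 2 * (\<Sum>i<r Q. \<delta> Q i)) + 2"
    using \<open>0 < K\<close> by simp
  have "variation (1 # L) \<le> 1 + variation L"
  proof (cases L)
    case (Cons x xs)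
    then show ?thesis using L by auto
  qed simp
  with 1 variation_insert[of "?B K" L 1] show ?thesis by linarith
qed

lemma variation_unit:
  assumes "set L \<subseteq> {0..1}"
  shows "variation L \<le> real (length L)"
  using assms
proof (induction L rule: variation.induct)
  case (1 x y zs)
  then have "\<bar>y - x\<bar> \<le> 1" by auto
  with 1 show ?case by simp
qed auto

lemma variation_map_upt: "variation (map f [0..<n]) = (\<Sum>i<n - 1. \<bar>f (Suc i) - f i\<bar>)"
proof (induction n)
  case (Suc n)
  show ?case
  proof (cases n)
    case (Suc m)
    have "variation (map f [0..<n] @ [f n]) = variation (map f [0..<n]) + \<bar>f n - last (map f [0..<n])\<bar>"
      using Suc by (intro variation_snoc) simp
    with Suc.IH Suc show ?thesis by simp
  qed simp
qed simp

section \<open>Traces\<close>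

text \<open>The multiset of pairs (destination, item) of a run on \<^term>\<open>xs\<close>, where \<^term>\<open>D\<close> chooses the
  destination of the last item of its argument.\<close>

definition trace :: "(nat list \<Rightarrow> 'd) \<Rightarrow> nat list \<Rightarrow> ('d \<times> nat) multiset" where
  "trace D xs = mset (map (\<lambda>t. (D (take (Suc t) xs), xs ! t)) [0..<length xs])"

lemma trace_Nil [simp]: "trace D [] = {#}"
  by (simp add: trace_def)

lemma trace_cong:
  "(\<And>t. t < length xs \<Longrightarrow> D (take (Suc t) xs) = E (take (Suc t) xs)) \<Longrightarrow> trace D xs = trace E xs"
  unfolding trace_def by (intro arg_cong[where f = mset] map_cong) auto

lemma trace_snoc [simp]: "trace D (xs @ [x]) = add_mset (D (xs @ [x]), x) (trace D xs)"
proof -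
  have "map (\<lambda>t. (D (take (Suc t) (xs @ [x])), (xs @ [x]) ! t)) [0..<length xs] =
        map (\<lambda>t. (D (take (Suc t) xs), xs ! t)) [0..<length xs]"
    by (rule map_cong) (auto simp: nth_append)
  moreover have "[0..<length (xs @ [x])] = [0..<length xs] @ [length xs]" by simp
  ultimately show ?thesis unfolding trace_def by (simp only: map_append mset_append) simp
qed

lemma trace_append: "trace D (xs @ ys) = trace D xs + trace (\<lambda>zs. D (xs @ zs)) ys"
proof (induction ys rule: rev_induct)
  case (snoc y ys)
  have "trace D (xs @ ys @ [y]) = trace D ((xs @ ys) @ [y])" by simp
  also have "\<dots> = add_mset (D (xs @ ys @ [y]), y) (trace D (xs @ ys))" by (subst trace_snoc) simp
  finally show ?case using snoc by simp
qed simp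

lemma image_snd_trace: "image_mset snd (trace D xs) = mset xs"
  by (induction xs rule: rev_induct) auto

lemma trace_map: "trace D (map f xs) = image_mset (apsnd f) (trace (\<lambda>ys. D (map f ys)) xs)"
proof (induction xs rule: rev_induct)
  case (snoc x xs)
  then show ?case using trace_snoc[of D "map f xs" "f x"] by simp
qed simp

lemma mem_trace_less: "p \<in># trace D xs \<Longrightarrow> xs \<in> words N n \<Longrightarrow> snd p < N"
proof -
  assume p: "p \<in># trace D xs" and xs: "xs \<in> words N n"
  from p have "snd p \<in># image_mset snd (trace D xs)" by auto
  then have "snd p \<in> set xs" unfolding image_snd_trace by simp
  with xs show ?thesis by (auto simp: words_def)
qed

text \<open>A list and not a multiset as in \<open>trace\<close>, because the algorithm inside the
  bin is online and depends on the order of arrival.\<close>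

definition routed :: "(nat list \<Rightarrow> nat + nat) \<Rightarrow> nat \<Rightarrow> nat list \<Rightarrow> nat list" where
  "routed D Q xs = concat (map (\<lambda>t. if D (take (Suc t) xs) = Inl Q then [xs ! t] else []) [0..<length xs])"

lemma routed_Nil [simp]: "routed D Q [] = []"
  by (simp add: routed_def)

lemma routed_snoc [simp]:
  "routed D Q (xs @ [x]) = routed D Q xs @ (if D (xs @ [x]) = Inl Q then [x] else [])"
proof -
  have "map (\<lambda>t. if D (take (Suc t) (xs @ [x])) = Inl Q then [(xs @ [x]) ! t] else []) [0..<length xs] =
        map (\<lambda>t. if D (take (Suc t) xs) = Inl Q then [xs ! t] else []) [0..<length xs]"
    by (rule map_cong) (auto simp: nth_append)
  moreover have "[0..<length (xs @ [x])] = [0..<length xs] @ [length xs]" by simp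
  ultimately show ?thesis unfolding routed_def by (simp only: map_append concat_append) simp
qed

lemma length_routed: "length (routed D Q xs) = count (image_mset fst (trace D xs)) (Inl Q)"
  by (induction xs rule: rev_induct) auto

lemma length_routed_append: "length (routed D Q xs) \<le> length (routed D Q (xs @ ys))"
  by (simp add: length_routed trace_append)

lemma trace_split:
  assumes "\<And>d x. (d, x) \<in># trace D xs \<Longrightarrow> (case d of Inl Q \<Rightarrow> Q < K | Inr _ \<Rightarrow> True)"
  shows "trace D xs = filter_mset (\<lambda>p. \<not> isl (fst p)) (trace D xs)
     + (\<Sum>Q<K. image_mset (Pair (Inl Q)) (mset (routed D Q xs)))"
  using assms
proof (induction xs rule: rev_induct)
  case (snoc x xs)
  have *: "trace D xs = filter_mset (\<lambda>p. \<not> isl (fst p)) (trace D xs)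
     + (\<Sum>Q<K. image_mset (Pair (Inl Q)) (mset (routed D Q xs)))"
    by (rule snoc.IH, rule snoc.prems) auto
  show ?case
  proof (cases "D (xs @ [x])")
    case (Inl Q0)
    with snoc.prems[of "Inl Q0" x] have "Q0 < K" by simp
    have eq: "image_mset (Pair (Inl Q)) (mset (routed D Q (xs @ [x]))) =
       image_mset (Pair (Inl Q)) (mset (routed D Q xs)) + (if Q = Q0 then {#(Inl Q0, x)#} else {#})" for Q
      using Inl by auto
    have sum: "(\<Sum>Q<K. image_mset (Pair (Inl Q)) (mset (routed D Q (xs @ [x])))) =
       (\<Sum>Q<K. image_mset (Pair (Inl Q)) (mset (routed D Q xs))) + {#(Inl Q0, x)#}"
      unfolding eq using \<open>Q0 < K\<close> by (simp add: sum.distrib)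
    have "trace D (xs @ [x]) = trace D xs + {#(Inl Q0, x)#}" using Inl by simp
    also have "\<dots> = (filter_mset (\<lambda>p. \<not> isl (fst p)) (trace D xs)
       + (\<Sum>Q<K. image_mset (Pair (Inl Q)) (mset (routed D Q xs)))) + {#(Inl Q0, x)#}"
      using * by (rule arg_cong)
    finally show ?thesis unfolding sum using Inl by simp
  next
    case (Inr i)
    then show ?thesis using * by simp
  qed
qed simp

section \<open>Composition\<close>

definition lift_dest :: "nat \<Rightarrow> (nat \<Rightarrow> nat) \<Rightarrow> nat \<Rightarrow> nat + nat \<Rightarrow> nat + nat" where
  "lift_dest q off Q a = (case a of Inl j \<Rightarrow> Inl (Q * q + j) | Inr i \<Rightarrow> Inr (off Q + i))"

text \<open>An outer bin is no place of its own. It stands for \<open>q\<close> finer bins together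
  with a chunk of cells, and the inner algorithm of the bin chooses among these. In the array the
  chunks come first; the outer reserve follows from \<open>off K\<close> on.\<close>

definition cascade ::
  "nat \<Rightarrow> nat \<Rightarrow> nat \<Rightarrow> (nat \<Rightarrow> nat) \<Rightarrow> (nat list \<Rightarrow> nat + nat) \<Rightarrow> (nat \<Rightarrow> nat list \<Rightarrow> nat + nat) \<Rightarrow>
   nat list \<Rightarrow> nat + nat" where
  "cascade K q m off D E xs = (case D xs of Inr i \<Rightarrow> Inr (off K + i)
     | Inl Q \<Rightarrow> lift_dest q off Q (E Q (map (\<lambda>x. x mod m) (routed D Q xs))))"

lemma trace_compose:
  fixes m :: nat
  defines "f \<equiv> (\<lambda>x. x mod m)"
  assumes "\<And>d x. (d, x) \<in># trace D xs \<Longrightarrow> (case d of Inl Q \<Rightarrow> Q < K | Inr _ \<Rightarrow> True)"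
  shows "trace (cascade K q m off D E) xs =
      image_mset (apfst (\<lambda>d. Inr (off K + projr d))) (filter_mset (\<lambda>p. \<not> isl (fst p)) (trace D xs))
     + (\<Sum>Q<K. image_mset (apfst (lift_dest q off Q)) (trace (\<lambda>ys. E Q (map f ys)) (routed D Q xs)))"
  using assms(2)
proof (induction xs rule: rev_induct)
  case (snoc x xs)
  have *: "trace (cascade K q m off D E) xs =
      image_mset (apfst (\<lambda>d. Inr (off K + projr d))) (filter_mset (\<lambda>p. \<not> isl (fst p)) (trace D xs))
     + (\<Sum>Q<K. image_mset (apfst (lift_dest q off Q)) (trace (\<lambda>ys. E Q (map f ys)) (routed D Q xs)))"
    by (rule snoc.IH, rule snoc.prems) auto
  show ?case
  proof (cases "D (xs @ [x])")
    case (Inl Q0)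
    with snoc.prems[of "Inl Q0" x] have "Q0 < K" by simp
    let ?new = "(lift_dest q off Q0 (E Q0 (map f (routed D Q0 (xs @ [x])))), x)"
    have eq: "image_mset (apfst (lift_dest q off Q)) (trace (\<lambda>ys. E Q (map f ys)) (routed D Q (xs @ [x]))) =
       image_mset (apfst (lift_dest q off Q)) (trace (\<lambda>ys. E Q (map f ys)) (routed D Q xs)) +
       (if Q = Q0 then {#?new#} else {#})" for Q
      using Inl by auto
    have sum: "(\<Sum>Q<K. image_mset (apfst (lift_dest q off Q)) (trace (\<lambda>ys. E Q (map f ys)) (routed D Q (xs @ [x])))) =
       (\<Sum>Q<K. image_mset (apfst (lift_dest q off Q)) (trace (\<lambda>ys. E Q (map f ys)) (routed D Q xs))) + {#?new#}"
      unfolding eq using \<open>Q0 < K\<close> by (simp add: sum.distrib del: routed_snoc)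
    have "cascade K q m off D E (xs @ [x]) = fst ?new"
      using Inl by (simp add: cascade_def f_def del: routed_snoc)
    then have "trace (cascade K q m off D E) (xs @ [x]) = add_mset ?new (trace (cascade K q m off D E) xs)"
      by (simp del: routed_snoc)
    then show ?thesis unfolding sum * using Inl by (simp del: routed_snoc)
  next
    case (Inr i)
    then have "cascade K q m off D E (xs @ [x]) = Inr (off K + i)" by (simp add: cascade_def)
    then show ?thesis using * Inr by simp
  qed
qed simp

section \<open>Costs\<close>

text \<open>If \<open>image_mset fst\<close> of a trace equals this multiset, then every bin ends
  exactly full, no cell is used twice and none stays empty, all in one equation.\<close>

definition slots :: "nat \<Rightarrow> (nat \<Rightarrow> nat) \<Rightarrow> nat \<Rightarrow> (nat + nat) multiset" where
  "slots K g R = (\<Sum>l<K. replicate_mset (g l) (Inl l)) + image_mset Inr (mset_set {..<R})"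

text \<open>A sum, because a cell receives exactly one item in every run that fills \<^const>\<open>slots\<close>.\<close>

definition content :: "nat \<Rightarrow> ((nat + nat) \<times> nat) multiset \<Rightarrow> nat \<Rightarrow> real" where
  "content N T i = (\<Sum>(d, x)\<in>#T. if d = Inr i then real x / real N else 0)"

text \<open>A cell costs nothing here, because its item enters the variation with its true
  value.\<close>

definition displacement :: "nat \<Rightarrow> nat \<Rightarrow> nat + nat \<Rightarrow> nat \<Rightarrow> real" where
  "displacement K M d x = (case d of Inl l \<Rightarrow> \<bar>real (x div M) - real l\<bar> / real K | Inr _ \<Rightarrow> 0)"

text \<open>An item has type \<open>x div M\<close>, its interval, and residue \<open>x mod M\<close>. An item in bin \<open>l\<close> is later treated as
  if its type were \<open>l\<close>. The factor 2 pays for the error in the two cost terms of its cell.\<close>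

definition run_cost :: "nat \<Rightarrow> nat \<Rightarrow> nat \<Rightarrow> ((nat + nat) \<times> nat) multiset \<Rightarrow> real" where
  "run_cost K M R T = variation (map (content (K * M) T) [0..<R]) + 2 * (\<Sum>(d, x)\<in>#T. displacement K M d x)"

lemma image_Inr_lessThan: "image_mset Inr (mset_set {..<R}) = mset_set (Inr ` {..<R})"
  by (rule image_mset_mset_set) simp

lemma count_slots_Inl: "count (slots K g R) (Inl l) = (if l < K then g l else 0)"
proof -
  have "(\<Sum>x<K. count (replicate_mset (g x) (Inl x :: nat + nat)) (Inl l)) = (\<Sum>x<K. if x = l then g x else 0)"
    by (intro sum.cong) auto
  then show ?thesis by (auto simp: slots_def count_sum image_Inr_lessThan count_mset_set')
qed

lemma count_slots_Inr: "count (slots K g R) (Inr i) = (if i < R then 1 else 0)"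
  by (auto simp: slots_def count_sum image_Inr_lessThan count_mset_set')

lemma slots_Inl: "Inl l \<in># slots K g R \<Longrightarrow> l < K"
  by (metis count_eq_zero_iff count_slots_Inl)

lemma slots_Inr: "Inr i \<in># slots K g R \<Longrightarrow> i < R"
  by (metis count_eq_zero_iff count_slots_Inr)

text \<open>The witness \<open>x\<close> stands outside the quantifier over \<open>G\<close>, so
  that one item yields the true value, the perceived value and the error of its cell.\<close>

lemma unique_slot:
  assumes "count (image_mset fst T) d = 1"
  shows "\<exists>x. (d, x) \<in># T \<and> (\<forall>G :: nat \<Rightarrow> real. (\<Sum>(d', y)\<in>#T. if d' = d then G y else 0) = G x)"
proof -
  have "d \<in># image_mset fst T" using assms count_greater_zero_iff[of "image_mset fst T" d] by linarith
  then obtain x where x: "(d, x) \<in># T" by auto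
  then obtain T' where T: "T = add_mset (d, x) T'" by (blast dest: multi_member_split)
  have 0: "d \<notin># image_mset fst T'" using assms by (simp add: T del: set_image_mset) (simp add: not_in_iff del: set_image_mset)
  have "(\<Sum>(d', y)\<in>#T. if d' = d then G y else 0) = G x" for G :: "nat \<Rightarrow> real"
  proof -
    have "image_mset (\<lambda>(d', y). if d' = d then G y else 0) T' = image_mset (\<lambda>_. 0) T'"
      using 0 by (intro image_mset_cong) force
    then show ?thesis by (simp add: T)
  qed
  with x show ?thesis by blast
qed

lemma sum_cells:
  fixes G :: "nat \<Rightarrow> real" and r :: nat
  assumes "\<And>i x. (Inr i, x) \<in># T \<Longrightarrow> i < r"
  shows "(\<Sum>i<r. \<Sum>(a, x)\<in>#T. if a = Inr i then G x else 0) =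
         (\<Sum>(a, x)\<in>#T. case a of Inl _ \<Rightarrow> 0 | Inr _ \<Rightarrow> G x)"
  using assms
proof (induction T)
  case (add p T)
  obtain a x where p: "p = (a, x)" by (cases p)
  have "(\<Sum>i<r. if a = Inr i then G x else 0) = (case a of Inl _ \<Rightarrow> 0 | Inr _ \<Rightarrow> G x)"
  proof (cases a)
    case (Inr i)
    have "i < r" by (rule add.prems[of i x]) (simp add: p Inr)
    then show ?thesis using sum.delta'[of "{..<r}" i "\<lambda>_. G x"] by (simp add: Inr)
  qed simp
  moreover have "(\<Sum>i<r. \<Sum>(a, x)\<in>#T. if a = Inr i then G x else 0) =
      (\<Sum>(a, x)\<in>#T. case a of Inl _ \<Rightarrow> 0 | Inr _ \<Rightarrow> G x)"
    using add.prems by (intro add.IH) (metis union_single_eq_member insert_iff set_mset_add_mset_insert)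
  ultimately show ?case by (simp add: p sum.distrib)
qed simp

lemma content_unit:
  assumes "count (image_mset fst T) (Inr i) = 1" "\<And>p. p \<in># T \<Longrightarrow> snd p < N"
  shows "content N T i \<in> {0..1}"
proof -
  from unique_slot[OF assms(1)] obtain x where x: "(Inr i, x) \<in># T"
    "\<And>G :: nat \<Rightarrow> real. (\<Sum>(d', y)\<in>#T. if d' = Inr i then G y else 0) = G x"
    by blast
  have "content N T i = real x / real N" unfolding content_def by (rule x(2))
  then show ?thesis using assms(2)[OF x(1)] by auto
qed

section \<open>The layout of consecutive chunks\<close>

lemma sum_offsets_inj:
  fixes r :: "nat \<Rightarrow> nat"
  assumes "sum r {..<Q} + i = sum r {..<Q'} + i'" "i < r Q" "i' < r Q'"
  shows "Q = Q' \<and> i = i'"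
proof -
  have *: "sum r {..<Q} + r Q \<le> sum r {..<Q'}" if "Q < Q'" for Q Q'
  proof -
    have "sum r {..<Suc Q} \<le> sum r {..<Q'}" using that by (intro sum_mono2) auto
    then show ?thesis by simp
  qed
  show ?thesis using *[of Q Q'] *[of Q' Q] assms by (cases Q Q' rule: linorder_cases) auto
qed

lemma sum_offset_less:
  fixes r :: "nat \<Rightarrow> nat"
  assumes "Q < K" "i < r Q"
  shows "sum r {..<Q} + i < sum r {..<K}"
proof -
  have "sum r {..<Suc Q} \<le> sum r {..<K}" using assms by (intro sum_mono2) auto
  then show ?thesis using assms by simp
qed

lemma upt_blocks:
  fixes r :: "nat \<Rightarrow> nat"
  shows "map c [0..<sum r {..<K} + R] =
    concat (map (\<lambda>Q. map (\<lambda>i. c (sum r {..<Q} + i)) [0..<r Q]) [0..<K]) @ map (\<lambda>i. c (sum r {..<K} + i)) [0..<R]"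
proof -
  have *: "map c [0..<a + b] = map c [0..<a] @ map (\<lambda>i. c (a + i)) [0..<b]" for a b
    by (induction b) auto
  have "map c [0..<sum r {..<K}] =
    concat (map (\<lambda>Q. map (\<lambda>i. c (sum r {..<Q} + i)) [0..<r Q]) [0..<K])"
    by (induction K) (simp_all add: *)
  then show ?thesis by (simp add: *)
qed

lemma sum_mset_image_sum:
  "(\<Sum>x\<in>#(\<Sum>Q<(K::nat). B Q). f x) = (\<Sum>Q<K. \<Sum>x\<in>#B Q. f x)"
  by (induction K) simp_all

lemma sum_mset_image_zero:
  "(\<And>x. x \<in># A \<Longrightarrow> f x = 0) \<Longrightarrow> (\<Sum>x\<in>#A. f x) = (0 :: 'a :: comm_monoid_add)"
  by (induction A) auto

lemma sum_mset_add_divide: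
  "(\<Sum>(a, x)\<in>#Z. u a x + v a x / c) = (\<Sum>(a, x)\<in>#Z. u a x) + (\<Sum>(a, x)\<in>#Z. v a x) / (c :: real)"
  by (induction Z) (auto simp: add_divide_distrib)

lemma image_mset_sum_lessThan: "image_mset f (\<Sum>Q<(K::nat). B Q) = (\<Sum>Q<K. image_mset f (B Q))"
  by (induction K) simp_all

lemma mset_set_lessThan_add:
  "mset_set {..<a + b :: nat} = mset_set {..<a} + image_mset ((+) a) (mset_set {..<b})"
proof -
  have "image_mset ((+) a) (mset_set {..<b}) = mset_set ((+) a ` {..<b})"
    by (rule image_mset_mset_set) simp
  moreover have "{..<a + b} = {..<a} \<union> (+) a ` {..<b}"
  proof (intro set_eqI iffI)
    fix x assume "x \<in> {..<a + b}"
    then have "x < a \<or> x = a + (x - a) \<and> x - a < b" by auto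
    then show "x \<in> {..<a} \<union> (+) a ` {..<b}" by blast
  qed auto
  moreover have "mset_set ({..<a} \<union> (+) a ` {..<b}) = mset_set {..<a} + mset_set ((+) a ` {..<b})"
    by (rule mset_set_Union) auto
  ultimately show ?thesis by metis
qed

lemma mset_set_lessThan_sum:
  fixes r :: "nat \<Rightarrow> nat"
  shows "mset_set {..<sum r {..<K}} = (\<Sum>Q<K. image_mset ((+) (sum r {..<Q})) (mset_set {..<r Q}))"
  by (induction K) (simp_all add: mset_set_lessThan_add)

lemma slots_filter: "filter_mset (\<lambda>d. \<not> isl d) (slots K g R) = image_mset Inr (mset_set {..<R})"
proof (rule multiset_eqI)
  fix d
  have "count (slots 0 g R) d = count (filter_mset (\<lambda>d. \<not> isl d) (slots K g R)) d"
    by (cases d) (simp_all add: count_slots_Inl count_slots_Inr)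
  then show "count (filter_mset (\<lambda>d. \<not> isl d) (slots K g R)) d = count (image_mset Inr (mset_set {..<R})) d"
    by (simp add: slots_def)
qed

lemma slots_compose:
  fixes r :: "nat \<Rightarrow> nat"
  defines "off \<equiv> (\<lambda>Q. sum r {..<Q})"
  assumes "0 < q"
  shows "image_mset (\<lambda>d. Inr (off K + projr d)) (filter_mset (\<lambda>d. \<not> isl d) (slots K h R))
      + (\<Sum>Q<K. image_mset (lift_dest q off Q) (slots q (g Q) (r Q)))
     = slots (K * q) (\<lambda>l. g (l div q) (l mod q)) (sum r {..<K} + R)"
proof -
  have "image_mset (lift_dest q off Q) (slots q (g Q) (r Q)) =
     (\<Sum>j<q. replicate_mset (g Q j) (Inl (Q * q + j))) + image_mset Inr (image_mset ((+) (off Q)) (mset_set {..<r Q}))" for Q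
    by (simp add: slots_def image_mset_sum_lessThan lift_dest_def multiset.map_comp comp_def)
  then have "(\<Sum>Q<K. image_mset (lift_dest q off Q) (slots q (g Q) (r Q))) =
     (\<Sum>Q<K. \<Sum>j<q. replicate_mset (g Q j) (Inl (Q * q + j))) +
     image_mset Inr (\<Sum>Q<K. image_mset ((+) (off Q)) (mset_set {..<r Q}))"
    by (simp add: sum.distrib image_mset_sum_lessThan)
  also have "(\<Sum>Q<K. \<Sum>j<q. replicate_mset (g Q j) (Inl (Q * q + j))) =
      (\<Sum>l<K * q. replicate_mset (g (l div q) (l mod q)) (Inl l :: nat + nat))"
    unfolding sum_lessThan_mult using \<open>0 < q\<close> by (intro sum.cong refl) auto
  finally show ?thesis
    unfolding slots_filter
    by (simp add: slots_def mset_set_lessThan_add mset_set_lessThan_sum off_def multiset.map_comp comp_def)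
qed

text \<open>As \<open>m = q * M\<close>, the fine type \<open>x div M\<close> is
  \<open>x div m * q + x mod m div M\<close>. Hence its error is at most \<open>q\<close> times the
  outer error plus the inner error. Division by \<open>K * q\<close> gives the outer displacement
  plus the inner one, shrunk to an interval of length \<open>1 / K\<close>.\<close>

lemma item_bound:
  fixes x m q M Q j :: nat
  assumes "m = q * M" "0 < q" "0 < M" "0 < K"
  shows "\<bar>real (x div M) - real (Q * q + j)\<bar> / real (K * q) \<le>
     \<bar>real (x div m) - real Q\<bar> / real K + \<bar>real (x mod m div M) - real j\<bar> / real q / real K"
proof -
  have "x = x div m * m + x mod m" by simp
  then have "x = x mod m + (x div m * q) * M" using assms(1) by (simp add: algebra_simps)
  then have "x div M = x mod m div M + x div m * q"
    using div_mult_self1[of M "x mod m" "x div m * q"] \<open>0 < M\<close> by simp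
  then have "real (x div M) - real (Q * q + j)
      = real q * (real (x div m) - real Q) + (real (x mod m div M) - real j)"
    by (simp add: algebra_simps)
  then have "\<bar>real (x div M) - real (Q * q + j)\<bar>
      \<le> real q * \<bar>real (x div m) - real Q\<bar> + \<bar>real (x mod m div M) - real j\<bar>"
    by (metis abs_mult abs_of_nat abs_triangle_ineq)
  then have "\<bar>real (x div M) - real (Q * q + j)\<bar> / real (K * q) \<le>
     (real q * \<bar>real (x div m) - real Q\<bar> + \<bar>real (x mod m div M) - real j\<bar>) / real (K * q)"
    by (rule divide_right_mono) simp
  also have "\<dots> = \<bar>real (x div m) - real Q\<bar> / real K + \<bar>real (x mod m div M) - real j\<bar> / real q / real K"
    using assms by (simp add: field_simps)
  finally show ?thesis .
qed

text \<open>The algorithm inside bin \<open>Q\<close> perceives \<open>x\<close> at the same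
  relative position, but in interval \<open>Q\<close>; so the shift is a whole number of
  intervals.\<close>

lemma perceived_diff:
  fixes x m Q :: nat
  assumes "0 < m" "0 < K"
  shows "\<bar>real x / real (K * m) - (real Q + real (x mod m) / real m) / real K\<bar> = \<bar>real (x div m) - real Q\<bar> / real K"
proof -
  have "real x = real (x div m) * real m + real (x mod m)"
    by (metis div_mult_mod_eq of_nat_add of_nat_mult)
  then have "real x / real (K * m) - (real Q + real (x mod m) / real m) / real K = (real (x div m) - real Q) / real K"
    using assms by (simp add: field_simps)
  then show ?thesis by (simp add: abs_divide)
qed

text \<open>The outer displacement \<open>e Q x\<close> of an item is charged once. If the inner
  algorithm puts the item on a cell, it is the error of the perceived value and enters the two
  differences at this cell; if the item goes on to a finer bin, it is passed on to the displacement
  there by \<open>item_bound\<close>. The factor 2 in \<open>run_cost\<close> fits both cases, and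
  \<open>eS\<close> adds them up. Costs inside a bin are scaled by \<open>1 / K\<close>, and the 3
  comes from \<open>variation_blocks\<close>.\<close>

lemma compose_trace:
  fixes K q M R n :: nat and h :: "nat \<Rightarrow> nat" and r g D E xs
  defines "m \<equiv> q * M"
  defines "f \<equiv> (\<lambda>x. x mod m)"
  defines "W \<equiv> trace (cascade K q m (\<lambda>Q. sum r {..<Q}) D E) xs"
  assumes pos: "0 < K" "0 < q" "0 < M" and xs: "xs \<in> words (K * m) n"
    and D: "image_mset fst (trace D xs) = slots K h R"
    and E: "\<And>Q. Q < K \<Longrightarrow> image_mset fst (trace (E Q) (map f (routed D Q xs))) = slots q (g Q) (r Q)"
  shows "image_mset fst W = slots (K * q) (\<lambda>l. g (l div q) (l mod q)) (sum r {..<K} + R)" (is ?slots)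
    and "run_cost (K * q) M (sum r {..<K} + R) W \<le> run_cost K m R (trace D xs)
      + (\<Sum>Q<K. run_cost q M (r Q) (trace (E Q) (map f (routed D Q xs)))) / real K + 3" (is ?cost)
proof -
  define off where "off = (\<lambda>Q. sum r {..<Q})"
  define T where "T = trace D xs"
  define S where "S Q = trace (\<lambda>ys. E Q (map f ys)) (routed D Q xs)" for Q
  define S' where "S' Q = trace (E Q) (map f (routed D Q xs))" for Q
  define e where "e Q x = \<bar>real (x div m) - real Q\<bar> / real K" for Q x :: nat
  have m: "0 < m" using pos by (simp add: m_def)
  have S': "S' Q = image_mset (apsnd f) (S Q)" for Q
    unfolding S_def S'_def by (rule trace_map)
  have fstS: "image_mset fst (S Q) = slots q (g Q) (r Q)" if "Q < K" for Q
    using E[OF that] unfolding S'_def[symmetric] S' by (simp add: multiset.map_comp)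
  have dests: "case d of Inl Q \<Rightarrow> Q < K | Inr i \<Rightarrow> i < R" if "(d, x) \<in># T" for d x
  proof -
    have "d \<in># slots K h R" using that D unfolding T_def[symmetric] by (metis fst_conv image_eqI set_image_mset)
    then show ?thesis using slots_Inl slots_Inr by (auto split: sum.split)
  qed
  then have dests': "case d of Inl Q \<Rightarrow> Q < K | Inr i \<Rightarrow> True" if "(d, x) \<in># trace D xs" for d x
    using that by (force simp: T_def split: sum.splits)
  have destS: "case a of Inl j \<Rightarrow> j < q | Inr i \<Rightarrow> i < r Q" if "(a, x) \<in># S Q" "Q < K" for a x Q
  proof -
    have "a \<in># slots q (g Q) (r Q)" using that fstS by (metis fst_conv image_eqI set_image_mset)
    then show ?thesis using slots_Inl slots_Inr by (auto split: sum.split)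
  qed
  have W: "W = image_mset (apfst (\<lambda>d. Inr (off K + projr d))) (filter_mset (\<lambda>p. \<not> isl (fst p)) T)
      + (\<Sum>Q<K. image_mset (apfst (lift_dest q off Q)) (S Q))"
    unfolding W_def S_def f_def T_def off_def by (rule trace_compose[OF dests'])
  show ?slots
  proof -
    have "image_mset fst W = image_mset (\<lambda>d. Inr (off K + projr d)) (filter_mset (\<lambda>d. \<not> isl d) (image_mset fst T))
      + (\<Sum>Q<K. image_mset (lift_dest q off Q) (image_mset fst (S Q)))"
      unfolding W by (simp add: image_mset_sum_lessThan multiset.map_comp comp_def filter_mset_image_mset)
    also have "\<dots> = image_mset (\<lambda>d. Inr (off K + projr d)) (filter_mset (\<lambda>d. \<not> isl d) (slots K h R))
      + (\<Sum>Q<K. image_mset (lift_dest q off Q) (slots q (g Q) (r Q)))"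
      using fstS D by (simp add: T_def)
    finally show ?thesis unfolding off_def slots_compose[OF pos(2)] .
  qed
  have sumW: "(\<Sum>(d, x)\<in>#W. F d x) = (\<Sum>(d, x)\<in>#T. if isl d then 0 else F (Inr (off K + projr d)) x)
      + (\<Sum>Q<K. \<Sum>(a, x)\<in>#S Q. F (lift_dest q off Q a) x)" for F :: "nat + nat \<Rightarrow> nat \<Rightarrow> real"
  proof -
    have "(\<Sum>(d, x)\<in>#filter_mset (\<lambda>p. \<not> isl (fst p)) T. F (Inr (off K + projr d)) x) =
       (\<Sum>(d, x)\<in>#T. if isl d then 0 else F (Inr (off K + projr d)) x)"
      by (induction T) auto
    then show ?thesis
      unfolding W by (simp add: sum_mset_image_sum multiset.map_comp comp_def apfst_def map_prod_def case_prod_unfold)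
  qed
  \<comment> \<open>Only chunk \<open>Q\<close> can reach this cell: the offsets separate the
    chunks, and the outer reserve starts behind all of them.\<close>
  have contS: "content (K * m) W (off Q + i) = (\<Sum>(a, x)\<in>#S Q. if a = Inr i then real x / real (K * m) else 0)"
    if Q: "Q < K" and i: "i < r Q" for Q i
  proof -
    let ?F = "\<lambda>d x. if d = Inr (off Q + i) then real x / real (K * m) else 0"
    have "off Q + i < off K" unfolding off_def using Q i by (rule sum_offset_less)
    then have "(\<Sum>(d, x)\<in>#T. if isl d then 0 else ?F (Inr (off K + projr d)) x) = 0"
      by (intro sum_mset_image_zero) auto
    moreover have "(\<Sum>(a, x)\<in>#S Q'. ?F (lift_dest q off Q' a) x)
       = (if Q' = Q then (\<Sum>(a, x)\<in>#S Q. if a = Inr i then real x / real (K * m) else 0) else 0)" if "Q' < K" for Q'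
    proof -
      have *: "lift_dest q off Q' a = Inr (off Q + i) \<longleftrightarrow> Q' = Q \<and> a = Inr i" if "(a, x) \<in># S Q'" for a x
      proof (cases a)
        case (Inr i')
        have "i' < r Q'" using destS[OF that \<open>Q' < K\<close>] Inr by simp
        with sum_offsets_inj[of r Q' i' Q i] i show ?thesis
          unfolding Inr lift_dest_def off_def by auto
      qed (simp add: lift_dest_def)
      show ?thesis
      proof (cases "Q' = Q")
        case True
        have "image_mset (\<lambda>(a, x). ?F (lift_dest q off Q' a) x) (S Q') =
           image_mset (\<lambda>(a, x). if a = Inr i then real x / real (K * m) else 0) (S Q')"
          by (rule image_mset_cong) (use * True in auto)
        then show ?thesis using True by simp
      next
        case False
        then show ?thesis using * by (auto intro!: sum_mset_image_zero)
      qed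
    qed
    ultimately show ?thesis unfolding content_def sumW[of ?F] using Q by simp
  qed
  have contT: "content (K * m) W (off K + i) = content (K * m) T i" for i
  proof -
    let ?F = "\<lambda>d x. if d = Inr (off K + i) then real x / real (K * m) else 0"
    have "(\<Sum>(a, x)\<in>#S Q. ?F (lift_dest q off Q a) x) = 0" if "Q < K" for Q
    proof (rule sum_mset_image_zero, clarify)
      fix a x assume a: "(a, x) \<in># S Q"
      show "(if lift_dest q off Q a = Inr (off K + i) then real x / real (K * m) else 0) = 0"
      proof (cases a)
        case (Inr i')
        have "i' < r Q" using destS[OF a that] Inr by simp
        with that have "off Q + i' < off K" unfolding off_def by (rule sum_offset_less)
        then show ?thesis by (simp add: Inr lift_dest_def)
      qed (simp add: lift_dest_def)
    qed
    moreover have "(\<Sum>(d, x)\<in>#T. if isl d then 0 else ?F (Inr (off K + projr d)) x) = content (K * m) T i"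
      unfolding content_def by (intro arg_cong[where f = sum_mset] image_mset_cong) (auto split: sum.split simp: isl_def)
    ultimately show ?thesis unfolding content_def[of "K * m" W] sumW[of ?F] by simp
  qed
  have lessN: "snd p < K * m" if "p \<in># T" for p
    using mem_trace_less[OF that[unfolded T_def] xs] .
  have lessS': "snd p < m" if "p \<in># S' Q" for p Q
    using that m unfolding S' by (auto simp: f_def)
  have close: "\<bar>content (K * m) W (off Q + i) - (real Q + content m (S' Q) i) / real K\<bar>
      \<le> (\<Sum>(a, x)\<in>#S Q. if a = Inr i then e Q x else 0)" if Q: "Q < K" and i: "i < r Q" for Q i
  proof -
    have "count (image_mset fst (S Q)) (Inr i) = 1"
      using fstS[OF Q] i by (simp add: count_slots_Inr)
    from unique_slot[OF this] obtain x where x: "\<And>G. (\<Sum>(d', y)\<in>#S Q. if d' = Inr i then G y else 0) = (G x :: real)"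
      by blast
    have "content m (S' Q) i = (\<Sum>(d', y)\<in>#S Q. if d' = Inr i then real (f y) / real m else 0)"
      unfolding content_def S' by (simp add: multiset.map_comp comp_def apsnd_def map_prod_def case_prod_unfold cong: if_cong)
    then have "content m (S' Q) i = real (x mod m) / real m" using x[of "\<lambda>y. real (f y) / real m"] by (simp add: f_def)
    then show ?thesis
      unfolding contS[OF Q i] x using perceived_diff[OF m pos(1), of x Q] by (simp add: e_def)
  qed
  have unitS': "content m (S' Q) i \<in> {0..1}" if "Q < K" "i < r Q" for Q i
    using E[OF that(1)] that lessS' unfolding S'_def[symmetric] by (intro content_unit) (auto simp: count_slots_Inr)
  have unitT: "set (map (\<lambda>i. content (K * m) T i) [0..<R]) \<subseteq> {0..1}"
  proof
    fix y assume "y \<in> set (map (\<lambda>i. content (K * m) T i) [0..<R])"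
    then obtain i where "i < R" "y = content (K * m) T i" by auto
    then show "y \<in> {0..1}" using lessN D unfolding T_def[symmetric]
      by (metis content_unit count_slots_Inr)
  qed
  have N: "K * q * M = K * m" by (simp add: m_def)
  have "variation (map (content (K * m) W) [0..<sum r {..<K} + R]) \<le>
      (\<Sum>Q<K. variation (map (content m (S' Q)) [0..<r Q]) / real K
         + 2 * (\<Sum>i<r Q. \<Sum>(a, x)\<in>#S Q. if a = Inr i then e Q x else 0))
      + variation (map (content (K * m) T) [0..<R]) + 3"
  proof -
    have "variation (concat (map (\<lambda>Q. map (\<lambda>i. content (K * m) W (off Q + i)) [0..<r Q]) [0..<K])
        @ map (\<lambda>i. content (K * m) T i) [0..<R]) \<le>
      (\<Sum>Q<K. variation (map (\<lambda>i. content m (S' Q) i) [0..<r Q]) / real K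
         + 2 * (\<Sum>i<r Q. \<Sum>(a, x)\<in>#S Q. if a = Inr i then e Q x else 0))
      + variation (map (\<lambda>i. content (K * m) T i) [0..<R]) + 3"
      by (rule variation_blocks) (use pos(1) unitS' close unitT in auto)
    moreover have "map (content (K * m) W) [0..<sum r {..<K} + R] =
      concat (map (\<lambda>Q. map (\<lambda>i. content (K * m) W (off Q + i)) [0..<r Q]) [0..<K])
        @ map (\<lambda>i. content (K * m) T i) [0..<R]"
      unfolding upt_blocks using contT by (simp add: off_def)
    ultimately show ?thesis by simp
  qed
  also have "(\<Sum>Q<K. variation (map (content m (S' Q)) [0..<r Q]) / real K
         + 2 * (\<Sum>i<r Q. \<Sum>(a, x)\<in>#S Q. if a = Inr i then e Q x else 0)) =
     (\<Sum>Q<K. variation (map (content m (S' Q)) [0..<r Q]) / real K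
         + 2 * (\<Sum>(a, x)\<in>#S Q. case a of Inl _ \<Rightarrow> 0 | Inr _ \<Rightarrow> e Q x))"
  proof (intro sum.cong refl)
    fix Q assume "Q \<in> {..<K}"
    then have "(\<Sum>i<r Q. \<Sum>(a, x)\<in>#S Q. if a = Inr i then e Q x else 0) =
       (\<Sum>(a, x)\<in>#S Q. case a of Inl _ \<Rightarrow> 0 | Inr _ \<Rightarrow> e Q x)"
      using destS by (intro sum_cells) force
    then show "variation (map (content m (S' Q)) [0..<r Q]) / real K
         + 2 * (\<Sum>i<r Q. \<Sum>(a, x)\<in>#S Q. if a = Inr i then e Q x else 0) =
      variation (map (content m (S' Q)) [0..<r Q]) / real K
         + 2 * (\<Sum>(a, x)\<in>#S Q. case a of Inl _ \<Rightarrow> 0 | Inr _ \<Rightarrow> e Q x)" by simp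
  qed
  finally have var: "variation (map (content (K * m) W) [0..<sum r {..<K} + R]) \<le>
     (\<Sum>Q<K. variation (map (content m (S' Q)) [0..<r Q]) / real K
         + 2 * (\<Sum>(a, x)\<in>#S Q. case a of Inl _ \<Rightarrow> 0 | Inr _ \<Rightarrow> e Q x))
     + variation (map (content (K * m) T) [0..<R]) + 3" .
  have dispT: "(\<Sum>(d, x)\<in>#T. displacement K m d x) = (\<Sum>Q<K. \<Sum>(a, x)\<in>#S Q. e Q x)"
  proof -
    have T: "T = filter_mset (\<lambda>p. \<not> isl (fst p)) T + (\<Sum>Q<K. image_mset (Pair (Inl Q)) (mset (routed D Q xs)))"
      unfolding T_def by (rule trace_split[OF dests'])
    have "(\<Sum>(d, x)\<in>#filter_mset (\<lambda>p. \<not> isl (fst p)) T. displacement K m d x) = 0"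
      by (rule sum_mset_image_zero) (auto simp: displacement_def isl_def split: sum.split)
    then have "(\<Sum>(d, x)\<in>#T. displacement K m d x) =
        (\<Sum>Q<K. \<Sum>x\<in>#mset (routed D Q xs). displacement K m (Inl Q) x)"
      by (subst T) (simp add: sum_mset_image_sum multiset.map_comp comp_def)
    also have "\<dots> = (\<Sum>Q<K. \<Sum>(a, x)\<in>#S Q. e Q x)"
    proof (rule sum.cong[OF refl])
      fix Q
      have "mset (routed D Q xs) = image_mset snd (S Q)" unfolding S_def by (rule image_snd_trace[symmetric])
      then show "(\<Sum>x\<in>#mset (routed D Q xs). displacement K m (Inl Q) x) = (\<Sum>(a, x)\<in>#S Q. e Q x)"
        by (simp add: multiset.map_comp comp_def displacement_def e_def case_prod_unfold)
    qed
    finally show ?thesis .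
  qed
  have dispW: "(\<Sum>(d, x)\<in>#W. displacement (K * q) M d x) \<le>
     (\<Sum>Q<K. (\<Sum>(a, x)\<in>#S Q. case a of Inl _ \<Rightarrow> e Q x | Inr _ \<Rightarrow> 0)
        + (\<Sum>(a, v)\<in>#S' Q. displacement q M a v) / real K)"
  proof -
    have "(\<Sum>(d, x)\<in>#T. if isl d then 0 else displacement (K * q) M (Inr (off K + projr d)) x) = 0"
      by (rule sum_mset_image_zero) (auto simp: displacement_def)
    moreover have "(\<Sum>(a, x)\<in>#S Q. displacement (K * q) M (lift_dest q off Q a) x) \<le>
       (\<Sum>(a, x)\<in>#S Q. case a of Inl _ \<Rightarrow> e Q x | Inr _ \<Rightarrow> 0)
        + (\<Sum>(a, v)\<in>#S' Q. displacement q M a v) / real K" for Q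
    proof -
      have "(\<Sum>(a, x)\<in>#S Q. displacement (K * q) M (lift_dest q off Q a) x) \<le>
        (\<Sum>(a, x)\<in>#S Q. (case a of Inl _ \<Rightarrow> e Q x | Inr _ \<Rightarrow> 0) + displacement q M a (f x) / real K)"
        using item_bound[OF meta_eq_to_obj_eq[OF m_def] pos(2,3,1)]
        by (intro sum_mset_mono) (auto simp: displacement_def lift_dest_def e_def f_def split: sum.split)
      also have "\<dots> = (\<Sum>(a, x)\<in>#S Q. case a of Inl _ \<Rightarrow> e Q x | Inr _ \<Rightarrow> 0)
        + (\<Sum>(a, x)\<in>#S Q. displacement q M a (f x)) / real K"
        by (rule sum_mset_add_divide)
      also have "(\<Sum>(a, x)\<in>#S Q. displacement q M a (f x)) = (\<Sum>(a, v)\<in>#S' Q. displacement q M a v)"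
        unfolding S' by (simp add: multiset.map_comp comp_def apsnd_def map_prod_def case_prod_unfold)
      finally show ?thesis .
    qed
    ultimately show ?thesis
      unfolding sumW by (simp add: sum_mono)
  qed
  have eS: "(\<Sum>(a, x)\<in>#S Q. case a of Inl _ \<Rightarrow> 0 | Inr _ \<Rightarrow> e Q x) +
     (\<Sum>(a, x)\<in>#S Q. case a of Inl _ \<Rightarrow> e Q x | Inr _ \<Rightarrow> 0) = (\<Sum>(a, x)\<in>#S Q. e Q x)" for Q
  proof -
    have "(\<Sum>(a, x)\<in>#Z. case a of Inl _ \<Rightarrow> 0 | Inr _ \<Rightarrow> e Q x) +
     (\<Sum>(a, x)\<in>#Z. case a of Inl _ \<Rightarrow> e Q x | Inr _ \<Rightarrow> 0) = (\<Sum>(a, x)\<in>#Z. e Q x)" for Z :: "((nat + nat) \<times> nat) multiset"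
      by (induction Z) (auto split: sum.split)
    then show ?thesis .
  qed
  have "run_cost (K * q) M (sum r {..<K} + R) W \<le>
    (\<Sum>Q<K. variation (map (content m (S' Q)) [0..<r Q]) / real K
         + 2 * (\<Sum>(a, x)\<in>#S Q. case a of Inl _ \<Rightarrow> 0 | Inr _ \<Rightarrow> e Q x))
     + variation (map (content (K * m) T) [0..<R]) + 3
     + 2 * (\<Sum>Q<K. (\<Sum>(a, x)\<in>#S Q. case a of Inl _ \<Rightarrow> e Q x | Inr _ \<Rightarrow> 0)
        + (\<Sum>(a, v)\<in>#S' Q. displacement q M a v) / real K)"
    unfolding run_cost_def N using var dispW by linarith
  also have "\<dots> = variation (map (content (K * m) T) [0..<R]) + 3
     + 2 * (\<Sum>Q<K. (\<Sum>(a, x)\<in>#S Q. case a of Inl _ \<Rightarrow> 0 | Inr _ \<Rightarrow> e Q x) +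
         (\<Sum>(a, x)\<in>#S Q. case a of Inl _ \<Rightarrow> e Q x | Inr _ \<Rightarrow> 0))
     + (\<Sum>Q<K. run_cost q M (r Q) (S' Q)) / real K"
    by (simp add: run_cost_def m_def sum.distrib sum_divide_distrib sum_distrib_left add_divide_distrib)
  also have "\<dots> = run_cost K m R T + (\<Sum>Q<K. run_cost q M (r Q) (S' Q)) / real K + 3"
    unfolding eS dispT[symmetric] by (simp add: run_cost_def)
  finally show ?cost by (simp add: T_def S'_def)
qed

section \<open>Solvers\<close>

text \<open>The decision to put an item into a bin may not depend on its residue.\<close>

definition local_bins :: "nat \<Rightarrow> (nat list \<Rightarrow> nat + nat) \<Rightarrow> bool" where
  "local_bins M D \<longleftrightarrow> (\<forall>xs x y l. x div M = y div M \<longrightarrow> D (xs @ [x]) = Inl l \<longrightarrow> D (xs @ [y]) = Inl l)"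

definition solver ::
  "nat \<Rightarrow> nat \<Rightarrow> (nat \<Rightarrow> nat) \<Rightarrow> nat \<Rightarrow> real \<Rightarrow> (nat list \<Rightarrow> nat + nat) \<Rightarrow> bool" where
  "solver K M g R c D \<longleftrightarrow> local_bins M D \<and>
     (\<forall>xs\<in>words (K * M) (sum g {..<K} + R). image_mset fst (trace D xs) = slots K g R) \<and>
     avg (K * M) (sum g {..<K} + R) (\<lambda>xs. run_cost K M R (trace D xs)) \<le> c"

text \<open>Quantifying over all sufficiently divisible resolutions makes solvers with different resolutions
  composable.\<close>

definition solvable :: "nat \<Rightarrow> (nat \<Rightarrow> nat) \<Rightarrow> nat \<Rightarrow> real \<Rightarrow> bool" where
  "solvable K g R c \<longleftrightarrow> (\<exists>M0>0. \<forall>M>0. M0 dvd M \<longrightarrow> (\<exists>D. solver K M g R c D))"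

lemma local_binsD: "local_bins M D \<Longrightarrow> x div M = y div M \<Longrightarrow> D (xs @ [x]) = Inl l \<longleftrightarrow> D (xs @ [y]) = Inl l"
  unfolding local_bins_def by metis

lemma solvable_mono: "solvable K g R c \<Longrightarrow> c \<le> c' \<Longrightarrow> solvable K g R c'"
  unfolding solvable_def solver_def by (meson order_trans)

text \<open>The conditional expectation of \<^term>\<open>F\<close> given the past is a martingale, because the residue of the
  current item is independent of the decision whether it is routed to bin \<^term>\<open>Q\<close>.\<close>

lemma avg_routed:
  assumes pos: "0 < K" "0 < m" and loc: "local_bins m D"
    and len: "\<And>xs. xs \<in> words (K * m) n \<Longrightarrow> length (routed D Q xs) = H"
  shows "avg (K * m) n (\<lambda>xs. F (map (\<lambda>x. x mod m) (routed D Q xs))) = avg m H F"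
proof -
  define G where "G ys = avg m (H - length ys) (\<lambda>zs. F (ys @ zs))" for ys
  let ?f = "\<lambda>xs. map (\<lambda>x. x mod m) (routed D Q xs)"
  \<comment> \<open>A prefix extends to a word of full length, where the bin holds exactly
    \<open>H\<close> items. Hence the truncated subtraction in \<open>G\<close> is exact.\<close>
  have le: "length (routed D Q xs) \<le> H" if xs: "xs \<in> words (K * m) t" and t: "t \<le> n" for xs t
  proof -
    obtain ys where "xs @ ys \<in> words (K * m) n" using words_extend[OF xs t] pos by auto
    then show ?thesis using len length_routed_append[of D Q xs ys] by simp
  qed
  have step: "(\<Sum>x<K * m. G (?f (xs @ [x]))) / real (K * m) = G (?f xs)"
    if xs: "xs \<in> words (K * m) t" and t: "t < n" for xs t
  proof -
    \<comment> \<open>By locality, whether the item joins bin \<open>Q\<close> depends on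
      \<open>s\<close> alone. Either all residues \<open>v\<close> join, and their average appends
      one fresh uniform letter, or none does and the list stays as it is.\<close>
    have "(\<Sum>v<m. G (?f (xs @ [s * m + v]))) = real m * G (?f xs)" if s: "s < K" for s
    proof (cases "D (xs @ [s * m]) = Inl Q")
      case True
      then have D: "D (xs @ [s * m + v]) = Inl Q" if "v < m" for v
        using local_binsD[OF loc, of "s * m" "s * m + v" xs Q] that by simp
      have "xs @ [s * m] \<in> words (K * m) (Suc t)"
        using xs s pos by (simp add: words_snoc)
      then have "length (routed D Q (xs @ [s * m])) \<le> H" using t by (intro le) auto
      then have "Suc (length (?f xs)) \<le> H" using True by simp
      then obtain k where k: "H - length (?f xs) = Suc k" "H - Suc (length (?f xs)) = k"
        by (metis Suc_diff_le diff_Suc_Suc)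
      have "(\<Sum>v<m. G (?f (xs @ [s * m + v]))) = (\<Sum>v<m. G (?f xs @ [v]))"
        using D by (intro sum.cong) auto
      also have "\<dots> = (\<Sum>v<m. avg m k (\<lambda>zs. F (?f xs @ v # zs)))"
        using k by (simp add: G_def)
      also have "\<dots> = real m * G (?f xs)"
        unfolding G_def k(1) avg_Cons using pos by simp
      finally show ?thesis .
    next
      case False
      then have D: "D (xs @ [s * m + v]) \<noteq> Inl Q" if "v < m" for v
        using local_binsD[OF loc, of "s * m" "s * m + v" xs Q] that by simp
      then have "(\<Sum>v<m. G (?f (xs @ [s * m + v]))) = (\<Sum>v<m. G (?f xs))"
        by (intro sum.cong) auto
      then show ?thesis by simp
    qed
    then show ?thesis unfolding sum_lessThan_mult using pos by simp
  qed
  have "avg (K * m) t (\<lambda>xs. G (?f xs)) = G []" if "t \<le> n" for t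
    using that
  proof (induction t)
    case (Suc t)
    have "avg (K * m) (Suc t) (\<lambda>xs. G (?f xs)) = avg (K * m) t (\<lambda>xs. G (?f xs))"
      unfolding avg.simps using step Suc.prems by (intro avg_cong) auto
    then show ?case using Suc by simp
  qed simp
  then have "avg (K * m) n (\<lambda>xs. G (?f xs)) = G []" by simp
  moreover have "avg (K * m) n (\<lambda>xs. G (?f xs)) = avg (K * m) n (\<lambda>xs. F (?f xs))"
    using len by (intro avg_cong) (simp add: G_def)
  ultimately show ?thesis by (simp add: G_def)
qed

text \<open>\<open>x div M\<close> determines both the outer type \<open>x div (q * M)\<close> and
  the inner type \<open>x mod (q * M) div M\<close>, hence both choices of a bin.\<close>

lemma local_bins_compose:
  assumes "local_bins (q * M) D" "\<And>Q. local_bins M (E Q)" "0 < M"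
  shows "local_bins M (cascade K q (q * M) off D E)"
  unfolding local_bins_def
proof (intro allI impI)
  fix xs x y l
  assume eq: "x div M = y div M" and x: "cascade K q (q * M) off D E (xs @ [x]) = Inl l"
  have eq1: "x div (q * M) = y div (q * M)"
    using eq by (metis div_mult2_eq mult.commute)
  have eq2: "x mod (q * M) div M = y mod (q * M) div M"
    using eq \<open>0 < M\<close> by (simp add: mult.commute[of q] mod_mult2_eq)
  let ?g = "\<lambda>Q z. E Q (map (\<lambda>x. x mod (q * M)) (routed D Q xs) @ [z mod (q * M)])"
  from x obtain Q where Q: "D (xs @ [x]) = Inl Q" and l: "lift_dest q off Q (?g Q x) = Inl l"
    by (auto simp: cascade_def split: sum.splits)
  from l obtain j where j: "?g Q x = Inl j" "l = Q * q + j"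
    by (auto simp: lift_dest_def split: sum.splits)
  have "D (xs @ [y]) = Inl Q" using local_binsD[OF assms(1) eq1] Q by simp
  moreover have "?g Q y = Inl j" using local_binsD[OF assms(2) eq2] j(1) by simp
  ultimately show "cascade K q (q * M) off D E (xs @ [y]) = Inl l"
    by (simp add: cascade_def lift_dest_def j(2))
qed

lemma prod_dvd_member: "finite I \<Longrightarrow> i \<in> I \<Longrightarrow> (f i :: nat) dvd prod f I"
  by (simp add: dvd_prodI)

text \<open>A merge: a coarse bin that is to receive \<open>H\<close> items consists of
  \<open>q\<close> finer bins with remaining capacities \<open>g Q\<close> and of a chunk of
  \<open>r Q\<close> cells. By \<open>avg_routed\<close> each inner algorithm sees an exactly
  uniform word of length \<open>H\<close>, so its expected cost is at most \<open>c1\<close>; the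
  \<open>K\<close> inner costs, each scaled by \<open>1 / K\<close>, add up to
  \<open>c1\<close>.\<close>

theorem solvable_compose:
  assumes pos: "0 < K" "0 < q" and outer: "solvable K (\<lambda>_. H) R c"
    and inner: "\<And>Q. Q < K \<Longrightarrow> solvable q (g Q) (r Q) c1"
    and cap: "\<And>Q. Q < K \<Longrightarrow> sum (g Q) {..<q} + r Q = H"
  shows "solvable (K * q) (\<lambda>l. g (l div q) (l mod q)) (sum r {..<K} + R) (c + c1 + 3)"
proof -
  obtain M1 where M1: "0 < M1" "\<And>M. 0 < M \<Longrightarrow> M1 dvd M \<Longrightarrow> \<exists>D. solver K M (\<lambda>_. H) R c D"
    using outer unfolding solvable_def by blast
  have "\<forall>Q. \<exists>M2>0. Q < K \<longrightarrow> (\<forall>M>0. M2 dvd M \<longrightarrow> (\<exists>D. solver q M (g Q) (r Q) c1 D))"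
    using inner unfolding solvable_def by (metis zero_less_one)
  then obtain M2 where M2: "\<And>Q. 0 < (M2 Q :: nat)"
    "\<And>Q M. Q < K \<Longrightarrow> 0 < M \<Longrightarrow> M2 Q dvd M \<Longrightarrow> \<exists>D. solver q M (g Q) (r Q) c1 D"
    by metis
  define M0 where "M0 = M1 * prod M2 {..<K}"
  have "0 < M0" using M1(1) M2(1) by (simp add: M0_def prod_pos)
  have "\<exists>D. solver (K * q) M (\<lambda>l. g (l div q) (l mod q)) (sum r {..<K} + R) (c + c1 + 3) D"
    if M: "0 < M" "M0 dvd M" for M
  proof -
    let ?m = "q * M" and ?g = "\<lambda>l. g (l div q) (l mod q)"
    have "M1 dvd ?m" using M(2) unfolding M0_def by (metis dvd_mult dvd_mult_left)
    then obtain D where D: "solver K ?m (\<lambda>_. H) R c D" using M1(2)[of ?m] M pos by auto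
    have "M2 Q dvd M" if "Q < K" for Q
    proof -
      have "M2 Q dvd prod M2 {..<K}" by (rule prod_dvd_member) (use that in auto)
      then have "M2 Q dvd M0" by (simp add: M0_def dvd_mult)
      then show ?thesis using M(2) by (rule dvd_trans)
    qed
    then have "\<forall>Q. \<exists>D. Q < K \<longrightarrow> solver q M (g Q) (r Q) c1 D" using M2(2) M(1) by blast
    then obtain E0 where E0: "\<And>Q. Q < K \<Longrightarrow> solver q M (g Q) (r Q) c1 (E0 Q)" by metis
    \<comment> \<open>The default never answers with a bin, so that \<open>E Q\<close> is local for
      every \<open>Q\<close>, as \<open>local_bins_compose\<close> demands.\<close>
    define E where "E Q = (if Q < K then E0 Q else (\<lambda>_. Inr 0))" for Q
    have E: "solver q M (g Q) (r Q) c1 (E Q)" if "Q < K" for Q using E0 that by (simp add: E_def)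
    have locE: "local_bins M (E Q)" for Q
    proof (cases "Q < K")
      case True
      then show ?thesis using E[of Q] unfolding solver_def by blast
    next
      case False
      then show ?thesis by (simp add: E_def local_bins_def)
    qed
    let ?C = "cascade K q ?m (\<lambda>Q. sum r {..<Q}) D E"
    define n where "n = sum ?g {..<K * q} + (sum r {..<K} + R)"
    have n: "n = K * H + R"
    proof -
      have "sum ?g {..<K * q} = (\<Sum>Q<K. sum (g Q) {..<q})"
        unfolding sum_lessThan_mult using pos by (intro sum.cong) auto
      then have "sum ?g {..<K * q} + sum r {..<K} = (\<Sum>Q<K. sum (g Q) {..<q} + r Q)"
        by (simp add: sum.distrib)
      also have "\<dots> = K * H" using cap by simp
      finally show ?thesis by (simp add: n_def)
    qed
    have N: "K * q * M = K * ?m" by simp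
    have traceD: "image_mset fst (trace D xs) = slots K (\<lambda>_. H) R" if "xs \<in> words (K * ?m) n" for xs
      using D that unfolding solver_def n by simp
    have len: "length (routed D Q xs) = H" if "xs \<in> words (K * ?m) n" "Q < K" for xs Q
      unfolding length_routed traceD[OF that(1)] count_slots_Inl using that by simp
    have traceE: "image_mset fst (trace (E Q) (map (\<lambda>x. x mod ?m) (routed D Q xs))) = slots q (g Q) (r Q)"
      if "xs \<in> words (K * ?m) n" "Q < K" for xs Q
    proof -
      have "map (\<lambda>x. x mod ?m) (routed D Q xs) \<in> words ?m H"
        using len[OF that] pos M by (auto simp: words_def)
      then show ?thesis using E[OF that(2)] cap[OF that(2)] unfolding solver_def by simp
    qed
    note ct = compose_trace[OF pos M(1) _ traceD traceE]
    have "avg (K * ?m) n (\<lambda>xs. run_cost (K * q) M (sum r {..<K} + R) (trace ?C xs)) \<le>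
      avg (K * ?m) n (\<lambda>xs. run_cost K ?m R (trace D xs)
        + ((1 / real K) * (\<Sum>Q<K. run_cost q M (r Q) (trace (E Q) (map (\<lambda>x. x mod ?m) (routed D Q xs)))) + 3))"
      by (rule avg_mono) (use ct(2) in \<open>simp add: add.assoc\<close>)
    also have "\<dots> = avg (K * ?m) n (\<lambda>xs. run_cost K ?m R (trace D xs))
        + ((1 / real K) * (\<Sum>Q<K. avg (K * ?m) n (\<lambda>xs. run_cost q M (r Q)
             (trace (E Q) (map (\<lambda>x. x mod ?m) (routed D Q xs))))) + 3)"
      using pos M by (simp only: avg_add avg_cmult avg_sum avg_const finite_lessThan nat_0_less_mult_iff)
    also have "\<dots> \<le> c + ((1 / real K) * (\<Sum>Q<K. c1) + 3)"
    proof (intro add_mono mult_left_mono sum_mono)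
      show "avg (K * ?m) n (\<lambda>xs. run_cost K ?m R (trace D xs)) \<le> c"
        using D unfolding solver_def n by simp
      fix Q assume "Q \<in> {..<K}"
      then have Q: "Q < K" by simp
      have "avg (K * ?m) n (\<lambda>xs. run_cost q M (r Q) (trace (E Q) (map (\<lambda>x. x mod ?m) (routed D Q xs))))
         = avg ?m H (\<lambda>ys. run_cost q M (r Q) (trace (E Q) ys))"
        using D len Q pos M by (intro avg_routed) (auto simp: solver_def)
      also have "\<dots> \<le> c1" using E[OF Q] cap[OF Q] unfolding solver_def by simp
      finally show "avg (K * ?m) n (\<lambda>xs. run_cost q M (r Q) (trace (E Q) (map (\<lambda>x. x mod ?m) (routed D Q xs)))) \<le> c1" .
    qed auto
    also have "\<dots> = c + c1 + 3" using pos by simp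
    finally have cost: "avg (K * ?m) n (\<lambda>xs. run_cost (K * q) M (sum r {..<K} + R) (trace ?C xs)) \<le> c + c1 + 3" .
    have "solver (K * q) M ?g (sum r {..<K} + R) (c + c1 + 3) ?C"
      unfolding solver_def n_def[symmetric] N
      using cost ct(1) local_bins_compose[OF _ locE M(1)] D by (simp add: solver_def)
    then show ?thesis by blast
  qed
  with \<open>0 < M0\<close> show ?thesis unfolding solvable_def by blast
qed

lemma solvable_cong: "(\<And>l. l < K \<Longrightarrow> g l = g' l) \<Longrightarrow> solvable K g R c = solvable K g' R c"
proof -
  assume "\<And>l. l < K \<Longrightarrow> g l = g' l"
  then have "slots K g R = slots K g' R" "sum g {..<K} = sum g' {..<K}"
    by (auto simp: slots_def intro!: sum.cong)
  then show ?thesis unfolding solvable_def solver_def by simp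
qed

section \<open>Problems without bins\<close>

lemma no_bins_trace:
  assumes "image_mset fst T = slots K (\<lambda>_. 0) R"
  shows "(\<Sum>(d, x)\<in>#T. displacement K' M d x) = 0"
proof (rule sum_mset_image_zero, clarify)
  fix d x assume "(d, x) \<in># T"
  then have "d \<in># slots K (\<lambda>_. 0) R" using assms by (metis fst_conv image_eqI set_image_mset)
  then show "displacement K' M d x = 0"
    by (auto simp: slots_def displacement_def)
qed

lemma no_bins_slots: "slots K (\<lambda>_. 0) R = slots K' (\<lambda>_. 0) R"
  by (simp add: slots_def)

lemma solvable_sequential:
  assumes "0 < K"
  shows "solvable K (\<lambda>_. 0) R (real R)"
proof -
  let ?D = "\<lambda>xs::nat list. Inr (length xs - 1) :: nat + nat"
  have tr: "image_mset fst (trace ?D xs) = image_mset Inr (mset_set {..<length xs})" for xs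
    by (induction xs rule: rev_induct) (auto simp: lessThan_Suc)
  have "solver K M (\<lambda>_. 0) R (real R) ?D" if "0 < M" for M
    unfolding solver_def
  proof (intro conjI ballI)
    show sl: "image_mset fst (trace ?D xs) = slots K (\<lambda>_. 0) R" if "xs \<in> words (K * M) (sum (\<lambda>_. 0) {..<K} + R)" for xs
      using that unfolding tr by (simp add: slots_def words_def)
    have "run_cost K M R (trace ?D xs) \<le> real R" if xs: "xs \<in> words (K * M) (sum (\<lambda>_. 0) {..<K} + R)" for xs
    proof -
      have "content (K * M) (trace ?D xs) i \<in> {0..1}" if "i < R" for i
        using mem_trace_less[OF _ xs] sl[OF xs] that by (intro content_unit) (auto simp: count_slots_Inr)
      then have "set (map (content (K * M) (trace ?D xs)) [0..<R]) \<subseteq> {0..1}" by auto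
      from variation_unit[OF this] have "variation (map (content (K * M) (trace ?D xs)) [0..<R]) \<le> real R"
        by simp
      then show ?thesis unfolding run_cost_def using no_bins_trace[OF sl[OF xs]] by simp
    qed
    then have "avg (K * M) (sum (\<lambda>_. 0) {..<K} + R) (\<lambda>xs. run_cost K M R (trace ?D xs)) \<le>
      avg (K * M) (sum (\<lambda>_. 0) {..<K} + R) (\<lambda>_. real R)"
      by (rule avg_mono)
    then show "avg (K * M) (sum (\<lambda>_. 0) {..<K} + R) (\<lambda>xs. run_cost K M R (trace ?D xs)) \<le> real R"
      using avg_const[of "K * M"] assms \<open>0 < M\<close> by simp
  qed (auto simp: local_bins_def)
  then show ?thesis unfolding solvable_def by (intro exI[of _ 1]) auto
qed

text \<open>Without bins nothing is displaced, so only the product \<open>K * M\<close> matters.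
  \<open>projr\<close> alters \<open>D\<close> only where it would answer with a bin, which happens
  in no run, and this makes the new algorithm local at the coarser resolution.\<close>

lemma solvable_no_bins_coarsen:
  assumes "solvable K (\<lambda>_. 0) R c" "0 < K"
  shows "solvable 1 (\<lambda>_. 0) R c"
proof -
  obtain M0 where M0: "0 < M0" "\<And>M. 0 < M \<Longrightarrow> M0 dvd M \<Longrightarrow> \<exists>D. solver K M (\<lambda>_. 0) R c D"
    using assms(1) unfolding solvable_def by blast
  have "\<exists>D. solver 1 M (\<lambda>_. 0) R c D" if M: "0 < M" "K * M0 dvd M" for M
  proof -
    from M(2) obtain M' where M': "M = K * M'" "M0 dvd M'"
      by (metis dvdE dvd_triv_left mult.assoc)
    obtain D where D: "solver K M' (\<lambda>_. 0) R c D" using M0(2)[of M'] M M' by auto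
    let ?D = "\<lambda>xs. Inr (projr (D xs)) :: nat + nat"
    have tr0: "image_mset fst (trace D xs) = slots K (\<lambda>_. 0) R" if "xs \<in> words M R" for xs
      using D that unfolding solver_def M' by simp
    have tr: "trace ?D xs = trace D xs" if "xs \<in> words M R" for xs
    proof (rule trace_cong)
      fix t assume t: "t < length xs"
      then have "D (take (Suc t) xs) \<in># image_mset fst (trace D xs)"
        by (force simp: trace_def)
      then show "?D (take (Suc t) xs) = D (take (Suc t) xs)"
        unfolding tr0[OF that] by (auto simp: slots_def)
    qed
    have "avg M R (\<lambda>xs. run_cost 1 M R (trace ?D xs)) = avg M R (\<lambda>xs. run_cost K M' R (trace D xs))"
      by (rule avg_cong) (simp add: tr run_cost_def no_bins_trace[OF tr0] M')
    moreover have "avg M R (\<lambda>xs. run_cost K M' R (trace D xs)) \<le> c"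
      using D unfolding solver_def M' by simp
    moreover have "image_mset fst (trace ?D xs) = slots 1 (\<lambda>_. 0) R" if "xs \<in> words M R" for xs
      using tr[OF that] tr0[OF that] no_bins_slots by metis
    moreover have "local_bins M ?D" by (simp add: local_bins_def)
    ultimately have "solver 1 M (\<lambda>_. 0) R c ?D" unfolding solver_def by simp
    then show ?thesis by blast
  qed
  moreover have "0 < K * M0" using M0 assms by simp
  ultimately show ?thesis unfolding solvable_def by blast
qed

section \<open>Balanced routing\<close>

lemma trace_nth: "t < length xs \<Longrightarrow> (D (take (Suc t) xs), xs ! t) \<in># trace D xs"
  by (force simp: trace_def)

text \<open>\<open>L'\<close> is a possible vector of final loads. Keeping its existence invariant
  lets \<open>balanced_routing\<close> depart from the types only when it must.\<close>

definition completable :: "nat \<Rightarrow> nat \<Rightarrow> nat \<Rightarrow> nat \<Rightarrow> (nat \<Rightarrow> nat) \<Rightarrow> bool" where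
  "completable K lo hi n L \<longleftrightarrow>
     (\<exists>L'. (\<forall>l<K. L l \<le> L' l \<and> lo \<le> L' l \<and> L' l \<le> hi) \<and> sum L' {..<K} = n)"

lemma completable_step:
  assumes "completable K lo hi n L" "sum L {..<K} < n"
  shows "\<exists>l<K. completable K lo hi n (L(l := Suc (L l)))"
proof -
  obtain L' where L': "\<And>l. l < K \<Longrightarrow> L l \<le> L' l \<and> lo \<le> L' l \<and> L' l \<le> hi" "sum L' {..<K} = n"
    using assms(1) unfolding completable_def by blast
  have "\<exists>l<K. L l < L' l"
  proof (rule ccontr)
    assume "\<not> (\<exists>l<K. L l < L' l)"
    then have "sum L' {..<K} \<le> sum L {..<K}" by (intro sum_mono) (metis lessThan_iff not_less)
    with assms(2) L'(2) show False by simp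
  qed
  then obtain l where l: "l < K" "L l < L' l" by blast
  then have "completable K lo hi n (L(l := Suc (L l)))"
    unfolding completable_def using L' by (intro exI[of _ L']) auto
  with l show ?thesis by blast
qed

lemma completable_full:
  assumes "completable K lo hi n L" "sum L {..<K} = n" "l < K"
  shows "lo \<le> L l \<and> L l \<le> hi"
proof -
  obtain L' where L': "\<And>l. l < K \<Longrightarrow> L l \<le> L' l \<and> lo \<le> L' l \<and> L' l \<le> hi" "sum L' {..<K} = n"
    using assms(1) unfolding completable_def by blast
  have "L l = L' l"
  proof (rule ccontr)
    assume "L l \<noteq> L' l"
    then have "L l < L' l" using L'(1)[OF assms(3)] by simp
    then have "sum L {..<K} < sum L' {..<K}"
      using L'(1) assms(3) by (intro sum_strict_mono_ex1) auto
    with assms(2) L'(2) show False by simp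
  qed
  with L'(1)[OF assms(3)] show ?thesis by simp
qed

lemma sum_count_types:
  fixes ss :: "nat list"
  shows "set ss \<subseteq> {..<K} \<Longrightarrow> (\<Sum>l<K. count (mset ss) l) = length ss"
proof (induction ss)
  case (Cons s ss)
  have "(\<Sum>l<K. count (mset (s # ss)) l) = (\<Sum>l<K. count (mset ss) l + (if l = s then 1 else 0))"
    by (intro sum.cong) auto
  then show ?case using Cons by (simp add: sum.distrib)
qed simp

lemma sum_bump: "b < (K::nat) \<Longrightarrow> sum (L(b := Suc (L b))) {..<K} = Suc (sum L {..<K})"
proof -
  assume "b < K"
  then have "sum (L(b := Suc (L b))) ({..<K}) = Suc (L b) + sum (L(b := Suc (L b))) ({..<K} - {b})"
    by (subst sum.remove[of _ b]) auto
  also have "sum (L(b := Suc (L b))) ({..<K} - {b}) = sum L ({..<K} - {b})"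
    by (rule sum.cong) auto
  also have "Suc (L b) + sum L ({..<K} - {b}) = Suc (sum L {..<K})"
    using \<open>b < K\<close> by (subst sum.remove[of "{..<K}" b L]) auto
  finally show ?thesis .
qed

text \<open>Every item goes to the bin of its type unless this would make it impossible to end with all loads
  between \<^term>\<open>lo\<close> and \<^term>\<open>hi\<close>.\<close>

lemma balanced_routing:
  assumes "lo \<le> mu" "mu \<le> hi"
  obtains \<beta> :: "nat list \<Rightarrow> nat" where
    "\<And>ss t. ss \<in> words K (K * mu) \<Longrightarrow> t < K * mu \<Longrightarrow> \<beta> (take (Suc t) ss) < K"
    "\<And>ss l. ss \<in> words K (K * mu) \<Longrightarrow> l < K \<Longrightarrow>
       lo \<le> count (image_mset fst (trace \<beta> ss)) l \<and> count (image_mset fst (trace \<beta> ss)) l \<le> hi"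
    "\<And>ss t. ss \<in> words K (K * mu) \<Longrightarrow> t < K * mu \<Longrightarrow>
       (\<forall>l<K. lo \<le> count (mset ss) l \<and> count (mset ss) l \<le> hi) \<Longrightarrow> \<beta> (take (Suc t) ss) = ss ! t"
proof -
  let ?n = "K * mu"
  define ok where "ok = completable K lo hi ?n"
  define bump :: "nat \<Rightarrow> (nat \<Rightarrow> nat) \<Rightarrow> nat \<Rightarrow> nat" where "bump l L = L(l := Suc (L l))" for l L
  define pick where "pick L s = (if s < K \<and> ok (bump s L) then s else (SOME l. l < K \<and> ok (bump l L)))" for L s
  define loads where "loads ss = fold (\<lambda>s L. bump (pick L s) L) ss (\<lambda>_. 0)" for ss
  define \<beta> where "\<beta> ss = pick (loads (butlast ss)) (last ss)" for ss
  have \<beta>_snoc: "\<beta> (ss @ [s]) = pick (loads ss) s" for ss s by (simp add: \<beta>_def)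
  have loads_snoc: "loads (ss @ [s]) = bump (\<beta> (ss @ [s])) (loads ss)" for ss s
    by (simp add: loads_def \<beta>_snoc)
  have loads_count: "loads ss l = count (image_mset fst (trace \<beta> ss)) l" for ss l
  proof (induction ss rule: rev_induct)
    case (snoc s ss)
    then show ?case unfolding loads_snoc by (simp add: bump_def)
  qed (simp add: loads_def)
  have ok0: "ok (\<lambda>_. 0)"
    unfolding ok_def completable_def using assms by (intro exI[of _ "\<lambda>_. mu"]) auto
  have pick: "pick L s < K \<and> ok (bump (pick L s) L)" if "ok L" "sum L {..<K} < ?n" for L s
  proof (cases "s < K \<and> ok (bump s L)")
    case False
    have "\<exists>l. l < K \<and> ok (bump l L)"
      using completable_step[of K lo hi ?n L] that unfolding ok_def bump_def by blast
    from someI_ex[OF this] False show ?thesis by (auto simp: pick_def)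
  qed (auto simp: pick_def)
  have inv: "ok (loads ss) \<and> sum (loads ss) {..<K} = length ss" if "length ss \<le> ?n" for ss
    using that
  proof (induction ss rule: rev_induct)
    case Nil
    then show ?case using ok0 by (simp add: loads_def)
  next
    case (snoc s ss)
    then have IH: "ok (loads ss)" "sum (loads ss) {..<K} = length ss" by auto
    then have \<beta>: "\<beta> (ss @ [s]) < K \<and> ok (loads (ss @ [s]))"
      unfolding loads_snoc \<beta>_snoc using snoc.prems by (intro pick) auto
    then have "sum (loads (ss @ [s])) {..<K} = Suc (length ss)"
      unfolding loads_snoc bump_def using IH(2) by (simp only: sum_bump)
    with \<beta> show ?case by (simp only: length_append_singleton)
  qed
  show ?thesis
  proof (rule that[of \<beta>])
    fix ss t assume ss: "ss \<in> words K ?n" and t: "t < ?n"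
    have snoc: "take (Suc t) ss = take t ss @ [ss ! t]"
      using ss t by (simp add: words_def take_Suc_conv_app_nth)
    show "\<beta> (take (Suc t) ss) < K"
      unfolding snoc \<beta>_snoc using inv[of "take t ss"] t ss by (intro conjunct1[OF pick]) (auto simp: words_def)
    assume good: "\<forall>l<K. lo \<le> count (mset ss) l \<and> count (mset ss) l \<le> hi"
    have "length ss = ?n" "set ss \<subseteq> {..<K}" using ss by (auto simp: words_def)
    \<comment> \<open>The type counts of the whole word are themselves admissible final loads and
      dominate those of every prefix, so the exceptional choice never occurs.\<close>
    have ok_le: "ok L" if "\<And>l. l < K \<Longrightarrow> L l \<le> count (mset ss) l" for L
      unfolding ok_def completable_def
      using good that sum_count_types[OF \<open>set ss \<subseteq> {..<K}\<close>] \<open>length ss = ?n\<close>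
      by (intro exI[of _ "count (mset ss)"]) auto
    have one: "\<beta> (take (Suc i) ss) = ss ! i" if L: "loads (take i ss) = count (mset (take i ss))" and i: "i < ?n" for i
    proof -
      have sn: "take (Suc i) ss = take i ss @ [ss ! i]"
        using \<open>length ss = ?n\<close> i by (simp add: take_Suc_conv_app_nth)
      have "bump (ss ! i) (loads (take i ss)) = count (mset (take (Suc i) ss))"
        unfolding sn L by (auto simp: bump_def fun_eq_iff)
      moreover have "count (mset (take (Suc i) ss)) l \<le> count (mset ss) l" for l
        by (metis append_take_drop_id mset_append count_union le_add1)
      ultimately have "ok (bump (ss ! i) (loads (take i ss)))" by (intro ok_le) simp
      moreover have "ss ! i \<in> set ss" using \<open>length ss = ?n\<close> i by simp
      then have "ss ! i < K" using \<open>set ss \<subseteq> {..<K}\<close> by auto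
      ultimately show ?thesis unfolding sn \<beta>_snoc by (simp add: pick_def)
    qed
    have natural: "loads (take i ss) = count (mset (take i ss))" if "i \<le> ?n" for i
      using that
    proof (induction i)
      case (Suc i)
      then have IH: "loads (take i ss) = count (mset (take i ss))" by simp
      have sn: "take (Suc i) ss = take i ss @ [ss ! i]"
        using \<open>length ss = ?n\<close> Suc.prems by (simp add: take_Suc_conv_app_nth)
      have "loads (take (Suc i) ss) = bump (\<beta> (take (Suc i) ss)) (loads (take i ss))"
        unfolding sn by (rule loads_snoc)
      also have "\<dots> = bump (ss ! i) (count (mset (take i ss)))"
        using one[OF IH] Suc.prems IH by simp
      also have "\<dots> = count (mset (take (Suc i) ss))"
        unfolding sn by (auto simp: bump_def fun_eq_iff)
      finally show ?case .
    qed (simp add: loads_def fun_eq_iff)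
    show "\<beta> (take (Suc t) ss) = ss ! t" using t by (intro one natural) auto
  next
    fix ss l assume ss: "ss \<in> words K ?n" and l: "l < K"
    have "length ss = ?n" using ss by (simp add: words_def)
    then show "lo \<le> count (image_mset fst (trace \<beta> ss)) l \<and> count (image_mset fst (trace \<beta> ss)) l \<le> hi"
      using completable_full[of K lo hi ?n "loads ss" l] inv[of ss] l
      by (simp add: ok_def loads_count)
  qed
qed

definition unbalanced :: "nat \<Rightarrow> nat \<Rightarrow> nat \<Rightarrow> nat list \<Rightarrow> real" where
  "unbalanced K lo hi ss = (if \<forall>l<K. lo \<le> count (mset ss) l \<and> count (mset ss) l \<le> hi then 0 else 1)"

lemma run_cost_prefix:
  assumes "\<And>p. p \<in># T1 \<Longrightarrow> isl (fst p)"
  shows "run_cost K M R (T1 + T2) = run_cost K M R T2 + 2 * (\<Sum>(d, x)\<in>#T1. displacement K M d x)"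
proof -
  have "(\<Sum>(d, x)\<in>#T1. if d = Inr i then real x / real (K * M) else 0) = 0" for i
    using assms by (intro sum_mset_image_zero) force
  then have "content (K * M) (T1 + T2) = content (K * M) T2"
    by (simp add: content_def fun_eq_iff)
  then show ?thesis by (simp add: run_cost_def)
qed

lemma sum_trace: "(\<Sum>(d, x)\<in>#trace D xs. f d x) = (\<Sum>t<length xs. f (D (take (Suc t) xs)) (xs ! t))"
proof -
  have "(\<Sum>(d, x)\<in>#trace D xs. f d x) = sum_list (map (\<lambda>t. f (D (take (Suc t) xs)) (xs ! t)) [0..<length xs])"
    by (simp add: trace_def sum_mset_sum_list[symmetric] multiset.map_comp comp_def)
  then show ?thesis by (simp add: interv_sum_list_conv_sum_set_nat lessThan_atLeast0)
qed

lemma count_image_Inl: "count (image_mset Inl A) (Inl l) = count A l"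
  by (induction A) auto

lemma count_image_Inl_Inr: "count (image_mset Inl A) (Inr i) = 0"
  by (induction A) auto

text \<open>After \<open>K * (h - d)\<close> routed items the remaining capacities are at most
  \<open>h'\<close> and always add up to \<open>K * d\<close>; only their distribution depends on
  the run, so \<open>rest\<close> covers all such \<open>g\<close>. Items are displaced only if the
  type counts leave the window, each then by at most 1, and \<open>run_cost\<close> counts this
  twice.\<close>

theorem solvable_phase:
  assumes K: "0 < K" and d: "d \<le> h" "d \<le> h'"
    and rest: "\<And>g. (\<forall>l<K. g l \<le> h') \<Longrightarrow> sum g {..<K} = K * d \<Longrightarrow> solvable K g R c"
  shows "solvable K (\<lambda>_. h) R
    (c + 2 * (real (K * (h - d)) * avg K (K * (h - d)) (unbalanced K (h - h') h)))"
proof -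
  let ?t0 = "K * (h - d)"
  have t0: "?t0 + K * d = K * h" using d(1) by (metis add_mult_distrib2 le_add_diff_inverse2)
  obtain \<beta> where \<beta>:
    "\<And>ss t. ss \<in> words K ?t0 \<Longrightarrow> t < ?t0 \<Longrightarrow> \<beta> (take (Suc t) ss) < K"
    "\<And>ss l. ss \<in> words K ?t0 \<Longrightarrow> l < K \<Longrightarrow>
       h - h' \<le> count (image_mset fst (trace \<beta> ss)) l \<and> count (image_mset fst (trace \<beta> ss)) l \<le> h"
    "\<And>ss t. ss \<in> words K ?t0 \<Longrightarrow> t < ?t0 \<Longrightarrow>
       (\<forall>l<K. h - h' \<le> count (mset ss) l \<and> count (mset ss) l \<le> h) \<Longrightarrow> \<beta> (take (Suc t) ss) = ss ! t"
    using balanced_routing[of "h - h'" "h - d" h K] d by (metis diff_le_mono2 diff_le_self)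
  \<comment> \<open>Vanishing outside \<open>{..<K}\<close> makes the set of possible remaining
    capacities finite, so that one resolution serves all continuations.\<close>
  define G where "G = {g. (\<forall>l. (l \<in> {..<K} \<longrightarrow> g l \<in> {..h'}) \<and> (l \<notin> {..<K} \<longrightarrow> g l = 0)) \<and> sum g {..<K} = K * d}"
  have "finite {g. \<forall>l. (l \<in> {..<K} \<longrightarrow> g l \<in> {..h'}) \<and> (l \<notin> {..<K} \<longrightarrow> g l = (0::nat))}"
    by (rule finite_set_of_finite_funs) auto
  then have "finite G" unfolding G_def by (rule rev_finite_subset) auto
  have "\<forall>g. \<exists>M0>0. g \<in> G \<longrightarrow> (\<forall>M>0. M0 dvd M \<longrightarrow> (\<exists>D. solver K M g R c D))"
    using rest unfolding solvable_def G_def by (metis (mono_tags, lifting) lessThan_iff mem_Collect_eq zero_less_one atMost_iff)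
  then obtain m where m: "\<And>g. 0 < (m g :: nat)"
    "\<And>g M. g \<in> G \<Longrightarrow> 0 < M \<Longrightarrow> m g dvd M \<Longrightarrow> \<exists>D. solver K M g R c D"
    by metis
  have "0 < prod m G" using m(1) by (simp add: prod_pos)
  moreover have "\<exists>D. solver K M (\<lambda>_. h) R
      (c + 2 * (real ?t0 * avg K ?t0 (unbalanced K (h - h') h))) D" if M: "0 < M" "prod m G dvd M" for M
  proof -
    have "m g dvd M" if "g \<in> G" for g
      using prod_dvd_member[OF \<open>finite G\<close> that, of m] M(2) by (rule dvd_trans)
    then have "\<forall>g. \<exists>D. g \<in> G \<longrightarrow> solver K M g R c D" using m(2) M(1) by blast
    then obtain E0 where E0: "\<And>g. g \<in> G \<Longrightarrow> solver K M g R c (E0 g)" by metis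
    define E where "E g = (if g \<in> G then E0 g else (\<lambda>_. Inr 0))" for g
    have E: "solver K M g R c (E g)" if "g \<in> G" for g using E0 that by (simp add: E_def)
    have locE: "local_bins M (E g)" for g
    proof (cases "g \<in> G")
      case True
      then show ?thesis using E[of g] unfolding solver_def by blast
    next
      case False
      then show ?thesis by (simp add: E_def local_bins_def)
    qed
    let ?ty = "map (\<lambda>x. x div M)"
    define cnt where "cnt as l = count (image_mset fst (trace \<beta> (?ty as))) l" for as l
    define left where "left as l = (if l < K then h - cnt as l else 0)" for as l
    define D0 where "D0 xs = (Inl (\<beta> (?ty xs)) :: nat + nat)" for xs
    \<comment> \<open>The argument already contains the current item, so \<open>\<le>\<close> sends
      exactly the first \<open>?t0\<close> items through the routing.\<close>
    define D where "D xs = (if length xs \<le> ?t0 then D0 xs else E (left (take ?t0 xs)) (drop ?t0 xs))" for xs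
    have types: "?ty as \<in> words K n" if "as \<in> words (K * M) n" for as n
      using that by (auto simp: words_def less_mult_imp_div_less)
    have fst0: "image_mset fst (trace D0 as) = image_mset Inl (image_mset fst (trace \<beta> (?ty as)))" for as
    proof -
      have "image_mset fst (trace D0 as) = image_mset Inl (image_mset fst (trace (\<lambda>xs. \<beta> (?ty xs)) as))"
        by (induction as rule: rev_induct) (simp_all add: D0_def)
      then show ?thesis by (simp add: trace_map multiset.map_comp comp_def)
    qed
    have cnt_ge: "cnt as l = 0" if as: "as \<in> words (K * M) ?t0" and "K \<le> l" for as l
    proof -
      have "l \<notin># image_mset fst (trace \<beta> (?ty as))"
      proof
        assume "l \<in># image_mset fst (trace \<beta> (?ty as))"
        then obtain t where t: "t < length as" "l = \<beta> (take (Suc t) (?ty as))"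
          by (force simp: trace_def)
        then have "l < K" using \<beta>(1)[OF types[OF as]] as by (simp add: words_def)
        with \<open>K \<le> l\<close> show False by simp
      qed
      then show ?thesis unfolding cnt_def by (simp only: not_in_iff)
    qed
    have cnt: "h - h' \<le> cnt as l \<and> cnt as l \<le> h" if "as \<in> words (K * M) ?t0" "l < K" for as l
      using \<beta>(2)[OF types[OF that(1)] that(2)] by (simp add: cnt_def)
    have sum_cnt: "sum (cnt as) {..<K} = ?t0" if as: "as \<in> words (K * M) ?t0" for as
    proof -
      have "size (image_mset fst (trace \<beta> (?ty as))) = length as"
        by (simp add: trace_def)
      moreover have "size (image_mset fst (trace \<beta> (?ty as))) = sum (cnt as) {..<K}"
        unfolding size_multiset_overloaded_eq cnt_def[symmetric]
      proof (rule sum.mono_neutral_left)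
        show "set_mset (image_mset fst (trace \<beta> (?ty as))) \<subseteq> {..<K}"
          using cnt_ge[OF as] by (metis cnt_def count_eq_zero_iff lessThan_iff not_less subsetI)
        show "\<forall>i\<in>{..<K} - set_mset (image_mset fst (trace \<beta> (?ty as))). cnt as i = 0"
          unfolding cnt_def by (metis DiffD2 count_eq_zero_iff)
      qed simp
      ultimately show ?thesis using as by (simp add: words_def)
    qed
    have leftG: "left as \<in> G" if as: "as \<in> words (K * M) ?t0" for as
    proof -
      have "sum (left as) {..<K} + sum (cnt as) {..<K} = (\<Sum>l<K. h)"
        unfolding sum.distrib[symmetric] using cnt[OF as] by (intro sum.cong) (auto simp: left_def)
      then have "sum (left as) {..<K} + ?t0 = K * h" using sum_cnt[OF as] by simp
      then have "sum (left as) {..<K} = K * d" using t0 by linarith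
      then show ?thesis using cnt[OF as] by (force simp: G_def left_def)
    qed
    have total: "K * h + R = ?t0 + (K * d + R)" using t0 by simp
    have tr: "trace D (as @ bs) = trace D0 as + trace (E (left as)) bs"
      if as: "as \<in> words (K * M) ?t0" for as bs
    proof -
      have len: "length as = ?t0" using as by (simp add: words_def)
      have "trace D as = trace D0 as" using len by (intro trace_cong) (simp add: D_def)
      moreover have "trace (\<lambda>zs. D (as @ zs)) bs = trace (E (left as)) bs"
        using len by (intro trace_cong) (auto simp: D_def)
      ultimately show ?thesis by (simp add: trace_append)
    qed
    have disp: "(\<Sum>(d, x)\<in>#trace D0 as. displacement K M d x)
        \<le> real ?t0 * unbalanced K (h - h') h (?ty as)" if as: "as \<in> words (K * M) ?t0" for as
    proof -
      have len: "length as = ?t0" and lt: "\<And>t. t < ?t0 \<Longrightarrow> as ! t div M < K"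
        using as types[OF as] by (auto simp: words_def image_subset_iff)
      have "(\<Sum>(d, x)\<in>#trace D0 as. displacement K M d x) =
         (\<Sum>t<?t0. \<bar>real (as ! t div M) - real (\<beta> (take (Suc t) (?ty as)))\<bar> / real K)"
        unfolding sum_trace len by (simp add: displacement_def D0_def take_map)
      also have "\<dots> \<le> (\<Sum>t<?t0. unbalanced K (h - h') h (?ty as))"
      proof (rule sum_mono)
        fix t assume "t \<in> {..<?t0}"
        then have t: "t < ?t0" by simp
        have "\<bar>real (as ! t div M) - real (\<beta> (take (Suc t) (?ty as)))\<bar> \<le> real K"
          using lt[OF t] \<beta>(1)[OF types[OF as] t] by linarith
        then have "\<bar>real (as ! t div M) - real (\<beta> (take (Suc t) (?ty as)))\<bar> / real K \<le> 1"
          using K by simp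
        moreover have "\<beta> (take (Suc t) (?ty as)) = as ! t div M"
          if "\<forall>l<K. h - h' \<le> count (mset (?ty as)) l \<and> count (mset (?ty as)) l \<le> h"
          using \<beta>(3)[OF types[OF as] t that] t len by simp
        ultimately show "\<bar>real (as ! t div M) - real (\<beta> (take (Suc t) (?ty as)))\<bar> / real K
            \<le> unbalanced K (h - h') h (?ty as)"
          unfolding unbalanced_def by (simp only: split: if_split) simp
      qed
      finally show ?thesis by simp
    qed
    have slotsD: "image_mset fst (trace D xs) = slots K (\<lambda>_. h) R" if xs: "xs \<in> words (K * M) (K * h + R)" for xs
    proof -
      from xs total obtain as bs where ab: "xs = as @ bs" "as \<in> words (K * M) ?t0" "bs \<in> words (K * M) (K * d + R)"
        by (metis words_splitE)
      have E': "image_mset fst (trace (E (left as)) bs) = slots K (left as) R"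
        using E[OF leftG[OF ab(2)]] leftG[OF ab(2)] ab(3) unfolding solver_def by (simp add: G_def)
      show ?thesis
      proof (rule multiset_eqI)
        fix a :: "nat + nat"
        show "count (image_mset fst (trace D xs)) a = count (slots K (\<lambda>_. h) R) a"
        proof (cases a)
          case (Inl l)
          have "count (image_mset Inl (image_mset fst (trace \<beta> (?ty as)))) (Inl l :: nat + nat) = cnt as l"
            unfolding cnt_def by (rule count_image_Inl)
          then show ?thesis
            unfolding ab(1) tr[OF ab(2)] using cnt[OF ab(2), of l] cnt_ge[OF ab(2), of l]
            by (simp add: fst0 E' Inl count_slots_Inl left_def del: image_mset.compositionality)
        next
          case (Inr i)
          have "count (image_mset Inl (image_mset fst (trace \<beta> (?ty as)))) (Inr i :: nat + nat) = 0"
            by (rule count_image_Inl_Inr)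
          then show ?thesis
            unfolding ab(1) tr[OF ab(2)] by (simp add: fst0 E' Inr count_slots_Inr)
        qed
      qed
    qed
    have cost: "avg (K * M) (K * h + R) (\<lambda>xs. run_cost K M R (trace D xs))
       \<le> c + 2 * (real ?t0 * avg K ?t0 (unbalanced K (h - h') h))"
    proof -
      have "avg (K * M) (K * h + R) (\<lambda>xs. run_cost K M R (trace D xs)) =
        avg (K * M) ?t0 (\<lambda>as. avg (K * M) (K * d + R) (\<lambda>bs. run_cost K M R (trace D (as @ bs))))"
        unfolding total by (rule avg_append)
      also have "\<dots> \<le> avg (K * M) ?t0 (\<lambda>as. c + 2 * (real ?t0 * unbalanced K (h - h') h (?ty as)))"
      proof (rule avg_mono)
        fix as assume as: "as \<in> words (K * M) ?t0"
        have "run_cost K M R (trace D (as @ bs)) \<le>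
            run_cost K M R (trace (E (left as)) bs) + 2 * (real ?t0 * unbalanced K (h - h') h (?ty as))" for bs
          using disp[OF as] unfolding tr[OF as]
          by (subst run_cost_prefix) (auto simp: trace_def D0_def)
        then have "avg (K * M) (K * d + R) (\<lambda>bs. run_cost K M R (trace D (as @ bs))) \<le>
          avg (K * M) (K * d + R) (\<lambda>bs. run_cost K M R (trace (E (left as)) bs) + 2 * (real ?t0 * unbalanced K (h - h') h (?ty as)))"
          by (intro avg_mono)
        also have "\<dots> = avg (K * M) (K * d + R) (\<lambda>bs. run_cost K M R (trace (E (left as)) bs))
            + 2 * (real ?t0 * unbalanced K (h - h') h (?ty as))"
          using K M by (simp add: avg_add avg_const)
        also have "avg (K * M) (K * d + R) (\<lambda>bs. run_cost K M R (trace (E (left as)) bs)) \<le> c"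
          using E[OF leftG[OF as]] leftG[OF as] unfolding solver_def by (simp add: G_def)
        finally show "avg (K * M) (K * d + R) (\<lambda>bs. run_cost K M R (trace D (as @ bs)))
            \<le> c + 2 * (real ?t0 * unbalanced K (h - h') h (?ty as))" by simp
      qed
      also have "\<dots> = c + 2 * (real ?t0 * avg K ?t0 (unbalanced K (h - h') h))"
        using K M avg_div[OF M(1), of K ?t0 "unbalanced K (h - h') h"]
        by (simp only: avg_add avg_cmult avg_const nat_0_less_mult_iff)
      finally show ?thesis .
    qed
    have "local_bins M D"
      unfolding local_bins_def
    proof (intro allI impI)
      fix xs :: "nat list" and x y l :: nat
      assume eq: "x div M = y div M" and x: "D (xs @ [x]) = Inl l"
      show "D (xs @ [y]) = Inl l"
      proof (cases "length xs < ?t0")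
        case True
        then show ?thesis using x eq by (simp add: D_def D0_def)
      next
        case False
        then show ?thesis using x local_binsD[OF locE eq] by (simp add: D_def)
      qed
    qed
    then show ?thesis using slotsD cost unfolding solver_def by (intro exI[of _ D]) simp
  qed
  ultimately show ?thesis unfolding solvable_def by blast
qed

section \<open>Concentration of the loads\<close>

text \<open>The moment generating function of a binomial distribution with success probability
  \<open>1 / K\<close>.\<close>

lemma avg_exp_count:
  assumes "l < K"
  shows "avg K t (\<lambda>ss. exp (a * real (count (mset ss) l))) = (1 + (exp a - 1) / real K) ^ t"
proof (induction t)
  case (Suc t)
  have "(\<Sum>x<K. exp (a * real (count (mset (ss @ [x])) l))) / real K =
      (1 + (exp a - 1) / real K) * exp (a * real (count (mset ss) l))" for ss
  proof -
    have "(\<Sum>x<K. exp (a * real (count (mset (ss @ [x])) l))) =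
       (\<Sum>x<K. exp (a * real (count (mset ss) l)) + (if x = l then exp (a * real (count (mset ss) l)) * (exp a - 1) else 0))"
      by (intro sum.cong) (auto simp: algebra_simps exp_add)
    also have "\<dots> = real K * exp (a * real (count (mset ss) l)) + exp (a * real (count (mset ss) l)) * (exp a - 1)"
      using assms by (simp add: sum.distrib)
    finally show ?thesis using assms by (simp add: field_simps)
  qed
  then show ?case by (simp add: avg_cmult Suc)
qed simp

lemma exp_le_quadratic:
  fixes x :: real
  assumes "\<bar>x\<bar> \<le> 1"
  shows "exp x \<le> 1 + x + x\<^sup>2"
proof (cases "0 \<le> x")
  case True
  then show ?thesis using exp_bound[of x] assms by simp
next
  case False
  define y where "y = - x"
  have y: "0 \<le> y" using False by (simp add: y_def)
  \<comment> \<open>The product is \<open>1 + y ^ 3\<close>.\<close>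
  have "1 \<le> (1 - y + y\<^sup>2) * (1 + y)" using y by (simp add: power2_eq_square algebra_simps)
  also have "\<dots> \<le> (1 - y + y\<^sup>2) * exp y"
  proof (rule mult_left_mono)
    show "1 + y \<le> exp y" by (rule exp_ge_add_one_self)
    have "0 \<le> (1 - y)\<^sup>2 + y" using y by (intro add_nonneg_nonneg) auto
    then show "0 \<le> 1 - y + y\<^sup>2" by (simp add: power2_eq_square algebra_simps)
  qed
  finally have "exp (- y) \<le> (1 - y + y\<^sup>2) * exp y * exp (- y)"
    by (metis exp_ge_zero mult_1 mult_right_mono)
  then show ?thesis by (simp add: y_def mult.assoc flip: exp_add)
qed

lemma chernoff:
  assumes "l < K" "\<bar>a\<bar> \<le> 1"
  shows "avg K (K * mu) (\<lambda>ss. exp (a * real (count (mset ss) l))) \<le> exp (real mu * (a + a\<^sup>2))"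
proof -
  \<comment> \<open>For negative \<open>a\<close> too, the base in \<open>avg_exp_count\<close> is
    nonnegative, as \<open>power_mono\<close> requires.\<close>
  have "(exp a - 1) / real K \<ge> -1"
  proof -
    have "1 \<le> real K" using assms by simp
    then have "- real K \<le> exp a - 1" using exp_ge_zero[of a] by linarith
    then show ?thesis using assms by (simp add: field_simps)
  qed
  then have "avg K (K * mu) (\<lambda>ss. exp (a * real (count (mset ss) l))) \<le> exp ((exp a - 1) / real K) ^ (K * mu)"
    unfolding avg_exp_count[OF assms(1)] by (intro power_mono exp_ge_add_one_self) simp
  also have "\<dots> = exp (real mu * (exp a - 1))"
    using assms by (simp flip: exp_of_nat_mult)
  also have "\<dots> \<le> exp (real mu * (a + a\<^sup>2))"
    using exp_le_quadratic[OF assms(2)] by (simp add: mult_left_mono)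
  finally show ?thesis .
qed

lemma avg_nonneg: "(\<And>xs. 0 \<le> F xs) \<Longrightarrow> 0 \<le> avg N n F"
proof (induction n arbitrary: F)
  case (Suc n)
  then show ?case by (auto intro!: Suc.IH divide_nonneg_nonneg sum_nonneg)
qed simp

lemma unbalanced_le_1: "avg K n (unbalanced K lo hi) \<le> 1" if "0 < K"
proof -
  have "avg K n (unbalanced K lo hi) \<le> avg K n (\<lambda>_. 1)"
    by (rule avg_mono) (simp add: unbalanced_def)
  then show ?thesis using avg_const[OF that] by simp
qed

text \<open>The mean load is \<open>h - d\<close>, so both limits of the window are \<open>d\<close>
  away from it. The proof takes exponential Markov bounds on both sides and a union over the
  \<open>K\<close> types. The choice \<open>a = d / (2 * h)\<close> minimises the exponent
  \<open>h * a ^ 2 - a * d\<close>, with minimum \<open>- d ^ 2 / (4 * h)\<close>.\<close>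

lemma unbalanced_tail:
  assumes "0 < K" "d \<le> h" "0 < h"
  shows "avg K (K * (h - d)) (unbalanced K (h - 2 * d) h) \<le> 2 * real K * exp (- (real d ^ 2 / (4 * real h)))"
proof -
  define a where "a = real d / (2 * real h)"
  have a: "0 \<le> a" "\<bar>a\<bar> \<le> 1" "\<bar>- a\<bar> \<le> 1" using assms by (auto simp: a_def divide_simps)
  let ?N = "\<lambda>ss l. real (count (mset ss) l)"
  let ?u = "exp (- a * real h)" and ?v = "exp (a * (real h - 2 * real d))"
  have pt: "unbalanced K (h - 2 * d) h ss \<le> (\<Sum>l<K. ?u * exp (a * ?N ss l) + ?v * exp (- a * ?N ss l))" for ss
  proof (cases "\<forall>l<K. h - 2 * d \<le> count (mset ss) l \<and> count (mset ss) l \<le> h")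
    case True
    then show ?thesis by (simp add: unbalanced_def sum_nonneg)
  next
    case False
    then obtain l where l: "l < K" "count (mset ss) l < h - 2 * d \<or> h < count (mset ss) l"
      by (meson linorder_not_less)
    have "1 \<le> ?u * exp (a * ?N ss l) + ?v * exp (- a * ?N ss l)"
      using l(2)
    proof
      assume "count (mset ss) l < h - 2 * d"
      \<comment> \<open>Truncated subtraction is harmless: a count below \<open>h - 2 * d\<close>
        forces \<open>2 * d < h\<close>.\<close>
      then have "real (count (mset ss) l) \<le> real h - 2 * real d" by linarith
      then have "0 \<le> a * (real h - 2 * real d) + - a * ?N ss l" using a(1) by (simp add: mult_left_mono)
      then have "1 \<le> ?v * exp (- a * ?N ss l)" unfolding exp_add[symmetric] by simp
      then show ?thesis by (smt (verit) exp_ge_zero mult_nonneg_nonneg)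
    next
      assume "h < count (mset ss) l"
      then have "0 \<le> - a * real h + a * ?N ss l" using a(1) by (simp add: mult_left_mono)
      then have "1 \<le> ?u * exp (a * ?N ss l)" unfolding exp_add[symmetric] by simp
      then show ?thesis by (smt (verit) exp_ge_zero mult_nonneg_nonneg)
    qed
    also have "\<dots> \<le> (\<Sum>l<K. ?u * exp (a * ?N ss l) + ?v * exp (- a * ?N ss l))"
      using l(1) by (intro member_le_sum) auto
    finally show ?thesis using False by (simp add: unbalanced_def)
  qed
  have h2: "a * (2 * real h) = real d" using assms by (simp add: a_def)
  have e: "real (h - d) * a\<^sup>2 - a * real d \<le> - (real d ^ 2 / (4 * real h))"
  proof -
    have "real (h - d) * a\<^sup>2 \<le> real h * a\<^sup>2" by (rule mult_right_mono) auto
    moreover have "real h * a\<^sup>2 - a * real d = - (real d ^ 2 / (4 * real h))"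
      using assms by (simp add: a_def field_simps power2_eq_square)
    ultimately show ?thesis by linarith
  qed
  have "avg K (K * (h - d)) (unbalanced K (h - 2 * d) h) \<le>
     avg K (K * (h - d)) (\<lambda>ss. \<Sum>l<K. ?u * exp (a * ?N ss l) + ?v * exp (- a * ?N ss l))"
    by (rule avg_mono) (rule pt)
  also have "\<dots> = (\<Sum>l<K. ?u * avg K (K * (h - d)) (\<lambda>ss. exp (a * ?N ss l))
      + ?v * avg K (K * (h - d)) (\<lambda>ss. exp (- a * ?N ss l)))"
    using assms(1) by (simp only: avg_sum finite_lessThan avg_add avg_cmult)
  also have "\<dots> \<le> (\<Sum>l<K. ?u * exp (real (h - d) * (a + a\<^sup>2)) + ?v * exp (real (h - d) * (- a + (- a)\<^sup>2)))"
    using chernoff[OF _ a(2)] chernoff[OF _ a(3)] by (intro sum_mono add_mono mult_left_mono) auto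
  also have "\<dots> \<le> (\<Sum>l<K. exp (- (real d ^ 2 / (4 * real h))) + exp (- (real d ^ 2 / (4 * real h))))"
  proof (intro sum_mono add_mono)
    have "- a * real h + real (h - d) * (a + a\<^sup>2) = real (h - d) * a\<^sup>2 - a * real d"
      using assms(2) by (simp add: of_nat_diff algebra_simps)
    then show "?u * exp (real (h - d) * (a + a\<^sup>2)) \<le> exp (- (real d ^ 2 / (4 * real h)))"
      using e by (simp flip: exp_add)
    have "a * (real h - 2 * real d) + real (h - d) * (- a + (- a)\<^sup>2) = real (h - d) * a\<^sup>2 - a * real d"
      using assms(2) by (simp add: of_nat_diff algebra_simps)
    then show "?v * exp (real (h - d) * (- a + (- a)\<^sup>2)) \<le> exp (- (real d ^ 2 / (4 * real h)))"
      using e by (simp flip: exp_add)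
  qed
  also have "\<dots> = 2 * real K * exp (- (real d ^ 2 / (4 * real h)))" by simp
  finally show ?thesis .
qed

section \<open>Equalising the bins\<close>

text \<open>With a single type the load after \<open>a\<close> items is surely \<open>a\<close>, so
  the bin can be filled to the brim (\<open>h' = 0\<close>) without any failure.\<close>

lemma solvable_single:
  assumes "solvable 1 (\<lambda>_. 0) e c"
  shows "solvable 1 (\<lambda>_. a) e c"
proof -
  have "unbalanced 1 a a ss = 0" if "ss \<in> words 1 a" for ss
  proof -
    have "count (mset ss) 0 = a"
      using sum_count_types[of ss 1] that by (simp add: words_def)
    then show ?thesis by (simp add: unbalanced_def)
  qed
  then have "avg 1 a (unbalanced 1 a a) = avg 1 a (\<lambda>_. 0)"
    by (rule avg_cong)
  then have 0: "avg 1 (1 * (a - 0)) (unbalanced 1 (a - 0) a) = 0"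
    using avg_const[of 1 a 0] by simp
  have "solvable 1 (\<lambda>_. a) e (c + 2 * (real (1 * (a - 0)) * avg 1 (1 * (a - 0)) (unbalanced 1 (a - 0) a)))"
  proof (rule solvable_phase)
    fix g :: "nat \<Rightarrow> nat"
    assume "\<forall>l<1. g l \<le> 0"
    then show "solvable 1 g e c" using assms solvable_cong[of 1 g "\<lambda>_. 0"] by simp
  qed auto
  then show ?thesis unfolding 0 by simp
qed

text \<open>Composition with \<open>q = 1\<close>: an outer bin of capacity \<open>h'\<close>
  consists of the \<open>g Q\<close> places left and a chunk of \<open>h' - g Q\<close> cells,
  filled in this order by \<open>solvable_single\<close>. The chunk sizes vary with
  \<open>g\<close>, their total \<open>K * (h' - d)\<close> does not.\<close>

lemma solvable_equalise:
  assumes K: "0 < K" and g: "\<forall>l<K. g l \<le> h'" "sum g {..<K} = K * d" and d: "d \<le> h'"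
    and rest: "solvable K (\<lambda>_. h') R c" and chunks: "\<And>e. e \<le> h' \<Longrightarrow> solvable 1 (\<lambda>_. 0) e c1"
  shows "solvable K g (K * (h' - d) + R) (c + c1 + 3)"
proof -
  have single: "solvable 1 (\<lambda>_. g Q) (h' - g Q) c1" if "Q < K" for Q
    by (rule solvable_single, rule chunks) simp
  have cap: "(\<Sum>j<1::nat. g Q) + (h' - g Q) = h'" if "Q < K" for Q
    using g(1) that by simp
  have "solvable (K * 1) (\<lambda>l. g (l div 1)) ((\<Sum>Q<K. h' - g Q) + R) (c + c1 + 3)"
    using solvable_compose[of K 1 h' R c "\<lambda>Q _. g Q" "\<lambda>Q. h' - g Q" c1, OF K zero_less_one rest single cap]
    by blast
  moreover have "(\<Sum>Q<K. h' - g Q) = K * (h' - d)"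
  proof -
    have "(\<Sum>Q<K. h' - g Q) + sum g {..<K} = (\<Sum>Q<K. h')"
      unfolding sum.distrib[symmetric] using g(1) by (intro sum.cong) auto
    moreover have "K * (h' - d) + K * d = K * h'"
      using d by (metis add_mult_distrib2 le_add_diff_inverse2)
    ultimately show ?thesis using g(2) by simp
  qed
  ultimately show ?thesis by simp
qed

text \<open>Equal capacities can be enlarged without routing, hence without a tail bound. This
  starts the sorting at \<open>h = 0\<close>, and it also disposes of surplus reserve.\<close>

lemma solvable_raise:
  assumes "0 < K" "h \<le> h'" "solvable K (\<lambda>_. h') R c" "\<And>e. e \<le> h' \<Longrightarrow> solvable 1 (\<lambda>_. 0) e c1"
  shows "solvable K (\<lambda>_. h) (K * (h' - h) + R) (c + c1 + 4)"
proof -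
  have "solvable K (\<lambda>_. h) (K * (h' - h) + R) (c + c1 + 3)"
    using assms by (intro solvable_equalise) auto
  then show ?thesis by (rule solvable_mono) simp
qed

text \<open>Routing stops when \<open>d\<close> places per bin are left on average, and chunks of
  \<open>d\<close> cells on average bring all bins to \<open>2 * d\<close>. The routing is forced to
  leave at most \<open>2 * d\<close> in each bin; \<open>tail\<close> bounds the expected price of
  this force by 1, and the other 3 of the 4 come from the composition.\<close>

lemma solvable_lower:
  assumes "0 < K" "d \<le> h" "0 < h" "solvable K (\<lambda>_. 2 * d) R c"
    and "\<And>e. e \<le> 2 * d \<Longrightarrow> solvable 1 (\<lambda>_. 0) e c1"
    and tail: "4 * real K ^ 2 * real h * exp (- (real d ^ 2 / (4 * real h))) \<le> 1"
  shows "solvable K (\<lambda>_. h) (K * d + R) (c + c1 + 4)"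
proof -
  let ?t0 = "K * (h - d)"
  have A: "solvable K (\<lambda>_. h) (K * d + R)
    ((c + c1 + 3) + 2 * (real ?t0 * avg K ?t0 (unbalanced K (h - 2 * d) h)))"
  proof (rule solvable_phase)
    fix g assume "\<forall>l<K. g l \<le> 2 * d" "sum g {..<K} = K * d"
    then have "solvable K g (K * (2 * d - d) + R) (c + c1 + 3)"
      using assms by (intro solvable_equalise) auto
    then show "solvable K g (K * d + R) (c + c1 + 3)" by simp
  qed (use assms in auto)
  have B: "2 * (real ?t0 * avg K ?t0 (unbalanced K (h - 2 * d) h)) \<le> 1"
  proof -
    have "real ?t0 * avg K ?t0 (unbalanced K (h - 2 * d) h) \<le>
       real (K * h) * (2 * real K * exp (- (real d ^ 2 / (4 * real h))))"
      using assms(1-3) by (intro mult_mono unbalanced_tail) (auto simp: unbalanced_def intro!: avg_nonneg)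
    then show ?thesis using tail by (simp add: power2_eq_square algebra_simps)
  qed
  show ?thesis by (rule solvable_mono[OF A]) (use B in linarith)
qed

section \<open>The recursion over levels\<close>

text \<open>The exponent \<open>d ^ 2 / (4 * h)\<close> is at least \<open>p ^ 3 / 32\<close>, while
  the factor in front is at most \<open>p ^ (p + 12 * p + 5 * p)\<close>, hence at most
  \<open>exp (18 * p ^ 2)\<close>. The former wins once \<open>p \<ge> 18 * 32\<close>, which 1024
  satisfies.\<close>

lemma tail_small:
  assumes p: "1024 \<le> p" and K: "K \<le> p ^ (6 * p)" and h: "h \<le> p ^ (5 * p)" "0 < h"
    and d: "h * p ^ 3 \<le> 8 * d ^ 2"
  shows "4 * real K ^ 2 * real h * exp (- (real d ^ 2 / (4 * real h))) \<le> 1"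
proof -
  let ?p = "real p"
  have pp: "1024 \<le> ?p" using p by simp
  have K': "real K \<le> ?p ^ (6 * p)" using K by (metis of_nat_le_iff of_nat_power)
  have h': "real h \<le> ?p ^ (5 * p)" using h by (metis of_nat_le_iff of_nat_power)
  have "real h * ?p ^ 3 \<le> 8 * real d ^ 2" using d by (metis of_nat_le_iff of_nat_mult of_nat_power of_nat_numeral)
  then have dd: "?p ^ 3 / 32 \<le> real d ^ 2 / (4 * real h)" using h(2) by (simp add: field_simps)
  have "4 \<le> ?p ^ p" using pp p self_le_power[of ?p p] by linarith
  then have "4 * real K ^ 2 * real h \<le> ?p ^ p * (?p ^ (6 * p)) ^ 2 * ?p ^ (5 * p)"
    using K' h' by (intro mult_mono power_mono) auto
  also have "\<dots> = ?p ^ (18 * p)" by (simp flip: power_mult power_add)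
  also have "\<dots> \<le> exp ?p ^ (18 * p)"
  proof (rule power_mono)
    show "?p \<le> exp ?p" using exp_ge_add_one_self[of ?p] by linarith
  qed simp
  also have "\<dots> = exp (18 * ?p ^ 2)" by (simp flip: exp_of_nat_mult add: power2_eq_square)
  also have "\<dots> \<le> exp (?p ^ 3 / 32)"
    using pp by (simp add: power2_eq_square power3_eq_cube)
  also have "\<dots> \<le> exp (real d ^ 2 / (4 * real h))" using dd by simp
  finally have "4 * real K ^ 2 * real h * exp (- (real d ^ 2 / (4 * real h))) \<le>
      exp (real d ^ 2 / (4 * real h)) * exp (- (real d ^ 2 / (4 * real h)))"
    by (rule mult_right_mono) simp
  then show ?thesis by (simp flip: exp_add)
qed

text \<open>Bins are merged \<^term>\<open>p\<close> at a time, starting from remaining capacity \<^term>\<open>p ^ 4\<close>. This suffices for the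
  concentration of \<^term>\<open>K\<close> loads with \<^term>\<open>ln K\<close> of order \<open>p ln p\<close>, so the next level can have
  \<^term>\<open>p ^ p\<close> in place of \<^term>\<open>p\<close>.\<close>

definition level :: "nat \<Rightarrow> real \<Rightarrow> bool" where
  "level p B \<longleftrightarrow> even p \<and> 1024 \<le> p \<and> 8 \<le> B \<and> (\<forall>e\<le>p ^ 6. solvable 1 (\<lambda>_. 0) e B) \<and>
     (\<forall>R. p ^ 4 \<le> R \<longrightarrow> R \<le> p ^ 5 \<longrightarrow> solvable p (\<lambda>_. p ^ 4) R B)"

lemma power_bracket:
  fixes a p n :: nat
  assumes "a \<le> n" "2 \<le> p" "0 < a"
  obtains k where "a * p ^ k \<le> n" "n < a * p ^ Suc k"
proof -
  have ex: "\<exists>j. n < a * p ^ j"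
  proof
    have "n < p ^ n" using assms(2) by (intro power_gt_expt) auto
    also have "\<dots> \<le> a * p ^ n" using assms(3) by simp
    finally show "n < a * p ^ n" .
  qed
  define j where "j = (LEAST j. n < a * p ^ j)"
  have j: "n < a * p ^ j" unfolding j_def by (rule LeastI_ex[OF ex])
  have "j \<noteq> 0" using j assms(1) by (intro notI) simp
  then obtain k where k: "j = Suc k" by (cases j) auto
  have "\<not> n < a * p ^ k" using not_less_Least[of k "\<lambda>j. n < a * p ^ j"] k by (simp add: j_def)
  with j k that show ?thesis by (metis not_less)
qed

context
  fixes p :: nat and B :: real
  assumes lv: "level p B"
begin

lemma p_large: "1024 \<le> p" and p_even: "even p" and B_large: "8 \<le> B"
  and sort_small: "e \<le> p ^ 6 \<Longrightarrow> solvable 1 (\<lambda>_. 0) e B"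
  and merge: "p ^ 4 \<le> R \<Longrightarrow> R \<le> p ^ 5 \<Longrightarrow> solvable p (\<lambda>_. p ^ 4) R B"
  using lv unfolding level_def by auto

text \<open>The use of even \<open>p\<close>: the mean remaining capacity \<open>d\<close> is
  exactly half of the next capacity.\<close>

lemma half_power: "0 < k \<Longrightarrow> 2 * (p ^ k div 2) = p ^ k"
  using p_even by simp

lemma pow_step: "b = Suc a \<Longrightarrow> 1024 * p ^ a \<le> p ^ b"
  using p_large by simp

lemma pow_steps: "1024 * p ^ 3 \<le> p ^ 4" "1024 * p ^ 4 \<le> p ^ 5" "1024 * p ^ 5 \<le> p ^ 6"
  by (rule pow_step, simp)+

lemma sq_half: "0 < k \<Longrightarrow> 4 * (p ^ k div 2) ^ 2 = p ^ (2 * k)"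
proof -
  assume "0 < k"
  have "4 * (p ^ k div 2) ^ 2 = (2 * (p ^ k div 2)) ^ 2" by (simp add: power2_eq_square)
  then show ?thesis unfolding half_power[OF \<open>0 < k\<close>] by (simp add: power_mult mult.commute)
qed

text \<open>A merge turns \<open>p\<close> bins with \<open>p ^ 4\<close> places each and a chunk of
  \<open>r\<close> cells into one bin, which \<open>solvable_lower\<close> brings back to
  \<open>p ^ 4\<close>. The \<open>2 * p ^ 3\<close> cells of reserve per bin are
  \<open>2 * p ^ 4\<close> per merged bin: enough for \<open>r \<ge> p ^ 4\<close>, for
  \<open>p ^ 4 div 2\<close> cells of equalisation, and for \<open>2 * p ^ 3\<close> cells at the
  next stage. The total need not be divisible by the number of bins, so \<open>R\<close> ranges over
  a window and the remainder is handed on.\<close>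

lemma chain:
  assumes "k \<le> 6 * p" "2 * p ^ 3 * p ^ k \<le> R" "R < (2 * p ^ 3 + 1) * p ^ k"
  shows "solvable (p ^ k) (\<lambda>_. p ^ 4) R (B + real k * (2 * B + 8))"
  using assms
proof (induction k arbitrary: R)
  case 0
  then have R: "R = 2 * p ^ 3" by simp
  have "R \<le> p ^ 6"
    using pow_steps R by linarith
  then have "solvable 1 (\<lambda>_. p ^ 4) R B" using solvable_single sort_small by blast
  then show ?case by simp
next
  case (Suc k)
  let ?K = "p ^ k" and ?d = "p ^ 4 div 2"
  define r where "r = R div ?K - ?d - 2 * p ^ 3"
  define R' where "R' = R mod ?K + 2 * p ^ 3 * ?K"
  have K: "0 < ?K" using p_large by simp
  have d: "2 * ?d = p ^ 4" by (rule half_power) simp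
  have s3: "1024 * p ^ 3 \<le> p ^ 4" and s4: "1024 * p ^ 4 \<le> p ^ 5"
    by (rule pow_steps)+
  have p34: "p \<le> p ^ 3" using p_large by (intro self_le_power) auto
  have p4: "p ^ 4 = p * p ^ 3" and p5: "p * p ^ 4 = p ^ 5" by (simp_all flip: power_Suc)
  have "2 * p ^ 4 * ?K \<le> R" using Suc.prems(2) unfolding p4 by (simp add: ac_simps)
  then have lo: "2 * p ^ 4 \<le> R div ?K" using K by (simp add: less_eq_div_iff_mult_less_eq)
  have "R < (2 * p ^ 4 + p) * ?K" using Suc.prems(3) unfolding p4 by (simp add: algebra_simps)
  then have hi: "R div ?K < 2 * p ^ 4 + p" by (simp add: less_mult_imp_div_less)
  have r: "p ^ 4 \<le> r" "r \<le> p ^ 5" "r + ?d + 2 * p ^ 3 = R div ?K"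
    using lo hi d s3 s4 p34 unfolding r_def by linarith+
  have IH: "solvable ?K (\<lambda>_. 2 * ?d) R' (B + real k * (2 * B + 8))"
    unfolding d
  proof (rule Suc.IH)
    have "R mod ?K < ?K" using K by simp
    then show "R' < (2 * p ^ 3 + 1) * ?K" unfolding R'_def by simp
  qed (use Suc.prems in \<open>auto simp: R'_def\<close>)
  let ?h = "p ^ 5 + r"
  have A: "solvable ?K (\<lambda>_. ?h) (?K * ?d + R') (B + real k * (2 * B + 8) + B + 4)"
  proof (rule solvable_lower)
    show "?d \<le> ?h" using d s4 by linarith
    show "0 < ?h" using p_large by simp
    show "solvable 1 (\<lambda>_. 0) e B" if "e \<le> 2 * ?d" for e
      by (rule sort_small) (use that d s4 pow_steps(3) in linarith)
    show "4 * real ?K ^ 2 * real ?h * exp (- (real ?d ^ 2 / (4 * real ?h))) \<le> 1"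
    proof (rule tail_small[OF p_large])
      show "?K \<le> p ^ (6 * p)" using Suc.prems(1) p_large by (intro power_increasing) auto
      have "?h \<le> p ^ 6" using r(2) pow_steps(3) by linarith
      also have "\<dots> \<le> p ^ (5 * p)" using p_large by (intro power_increasing) auto
      finally show "?h \<le> p ^ (5 * p)" .
      \<comment> \<open>Capacity \<open>p ^ 4\<close> is just enough: for
        \<open>h = 2 * p ^ 5\<close> and \<open>d = p ^ 4 div 2\<close> the condition of
        \<open>tail_small\<close> holds with equality.\<close>
      have "?h * p ^ 3 \<le> (2 * p ^ 5) * p ^ 3" using r(2) by (intro mult_right_mono) auto
      also have "\<dots> = 2 * p ^ (2 * 4)" by (simp flip: power_add)
      also have "\<dots> = 8 * ?d ^ 2" using sq_half[of 4] by simp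
      finally show "?h * p ^ 3 \<le> 8 * ?d ^ 2" .
    qed (use p_large in simp)
  qed (use K IH in auto)
  have cap: "(\<Sum>j<p. p ^ 4) + r = ?h" by (simp add: p5)
  have "solvable (?K * p) (\<lambda>l. p ^ 4) ((\<Sum>Q<?K. r) + (?K * ?d + R'))
      (B + real k * (2 * B + 8) + B + 4 + B + 3)"
    using solvable_compose[of ?K p ?h "?K * ?d + R'" _ "\<lambda>_ _. p ^ 4" "\<lambda>_. r" B, OF K _ A merge[OF r(1,2)] cap]
      p_large by simp
  moreover have "(\<Sum>Q<?K. r) + (?K * ?d + R') = R"
  proof -
    have "(\<Sum>Q<?K. r) + (?K * ?d + R') = ?K * (r + ?d + 2 * p ^ 3) + R mod ?K"
      unfolding R'_def by (simp add: algebra_simps)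
    then show ?thesis unfolding r(3) by simp
  qed
  ultimately have "solvable (p ^ Suc k) (\<lambda>l. p ^ 4) R (B + real k * (2 * B + 8) + B + 4 + B + 3)"
    by (simp add: mult.commute)
  then show ?case by (rule solvable_mono) (simp add: algebra_simps)
qed

text \<open>The number \<open>p ^ k\<close> of types is chosen such that each has between
  \<open>2 * p ^ 4\<close> and \<open>2 * p ^ 5\<close> cells. All bins have capacity 0 at first;
  \<open>solvable_raise\<close> gives each a chunk of \<open>h\<close> cells,
  \<open>solvable_lower\<close> reduces the capacity to \<open>p ^ 4\<close>, and
  \<open>chain\<close> does the merging. The bound \<open>p ^ 6\<close> on chunks in
  \<open>level\<close> leaves room for \<open>h\<close>. As there are no places in bins at the
  start, the types can be forgotten at the end.\<close>

lemma sort_large: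
  assumes n: "p ^ 6 < n" "n \<le> p ^ (6 * p)"
  obtains k where "p ^ k \<le> n" "solvable 1 (\<lambda>_. 0) n (3 * B * (real k + 2))"
proof -
  let ?d = "p ^ 4 div 2"
  have d: "2 * ?d = p ^ 4" by (rule half_power) simp
  have s3: "1024 * p ^ 3 \<le> p ^ 4" and s4: "1024 * p ^ 4 \<le> p ^ 5" and s5: "1024 * p ^ 5 \<le> p ^ 6"
    by (rule pow_steps)+
  have "2 * p ^ 4 \<le> n" using n(1) s4 s5 by linarith
  then obtain k where k: "2 * p ^ 4 * p ^ k \<le> n" "n < 2 * p ^ 4 * p ^ Suc k"
  proof (rule power_bracket)
    show "2 \<le> p" "0 < 2 * p ^ 4" using p_large by auto
  qed
  let ?K = "p ^ k"
  have K: "0 < ?K" using p_large by simp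
  have "p ^ k = 1 * p ^ k" by simp
  also have "\<dots> \<le> 2 * p ^ 4 * p ^ k" using p_large by (intro mult_right_mono) auto
  also have "\<dots> \<le> n" by (rule k(1))
  finally have kn: "p ^ k \<le> n" .
  then have "p ^ k \<le> p ^ (6 * p)" using n(2) by simp
  then have k6: "k \<le> 6 * p" by (rule power_le_imp_le_exp[rotated]) (use p_large in auto)
  have lo: "2 * p ^ 4 \<le> n div ?K" using k(1) K by (simp add: less_eq_div_iff_mult_less_eq)
  have p5: "p ^ 5 = p * p ^ 4" by (simp flip: power_Suc)
  have "n < 2 * p ^ 5 * ?K" using k(2) unfolding p5 by (simp add: ac_simps)
  then have hi: "n div ?K < 2 * p ^ 5" by (rule less_mult_imp_div_less)
  define h where "h = n div ?K - (?d + 2 * p ^ 3)"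
  define R where "R = n mod ?K + 2 * p ^ 3 * ?K"
  have h: "h + (?d + 2 * p ^ 3) = n div ?K" "p ^ 4 \<le> h" "h \<le> 2 * p ^ 5"
    using lo hi d s3 unfolding h_def by linarith+
  have A: "solvable ?K (\<lambda>_. 2 * ?d) R (B + real k * (2 * B + 8))"
    unfolding d
  proof (rule chain[OF k6])
    have "n mod ?K < ?K" using K by simp
    then show "R < (2 * p ^ 3 + 1) * ?K" unfolding R_def by simp
  qed (simp add: R_def)
  have A': "solvable ?K (\<lambda>_. h) (?K * ?d + R) (B + real k * (2 * B + 8) + B + 4)"
  proof (rule solvable_lower)
    show "?d \<le> h" using d h by linarith
    show "0 < h" using h(2) p_large by (metis gr0I le_zero_eq power_not_zero not_numeral_le_zero)
    show "solvable 1 (\<lambda>_. 0) e B" if "e \<le> 2 * ?d" for e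
      by (rule sort_small) (use that d s4 s5 in linarith)
    show "4 * real ?K ^ 2 * real h * exp (- (real ?d ^ 2 / (4 * real h))) \<le> 1"
    proof (rule tail_small[OF p_large])
      show "?K \<le> p ^ (6 * p)" using k6 p_large by (intro power_increasing) auto
      have "h \<le> p ^ 6" using h s5 by linarith
      also have "\<dots> \<le> p ^ (5 * p)" using p_large by (intro power_increasing) auto
      finally show "h \<le> p ^ (5 * p)" .
      have "h * p ^ 3 \<le> (2 * p ^ 5) * p ^ 3" using h by (intro mult_right_mono) auto
      also have "\<dots> = 2 * p ^ (2 * 4)" by (simp flip: power_add)
      also have "\<dots> = 8 * ?d ^ 2" using sq_half[of 4] by simp
      finally show "h * p ^ 3 \<le> 8 * ?d ^ 2" .
    qed fact
  qed (use K A in auto)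
  have "solvable ?K (\<lambda>_. 0) (?K * (h - 0) + (?K * ?d + R)) (B + real k * (2 * B + 8) + B + 4 + B + 4)"
    using h s5 by (intro solvable_raise[OF K _ A'] sort_small) auto
  moreover have "?K * (h - 0) + (?K * ?d + R) = n"
  proof -
    have "?K * (h - 0) + (?K * ?d + R) = ?K * (h + (?d + 2 * p ^ 3)) + n mod ?K"
      unfolding R_def by (simp add: algebra_simps)
    then show ?thesis unfolding h(1) by simp
  qed
  ultimately have "solvable 1 (\<lambda>_. 0) n (B + real k * (2 * B + 8) + B + 4 + B + 4)"
    using solvable_no_bins_coarsen[OF _ K] by simp
  moreover have "B + real k * (2 * B + 8) + B + 4 + B + 4 \<le> 3 * B * (real k + 2)"
  proof -
    have "real k * (2 * B + 8) \<le> real k * (3 * B)" using B_large by (intro mult_left_mono) auto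
    then show ?thesis using B_large by (simp add: algebra_simps)
  qed
  ultimately show ?thesis using that kn solvable_mono by blast
qed

lemma sort_power:
  assumes "n \<le> p ^ m" "m \<le> 6 * p"
  shows "solvable 1 (\<lambda>_. 0) n (3 * B * (real m + 2))"
proof (cases "n \<le> p ^ 6")
  case True
  have "B * 1 \<le> B * (3 * (real m + 2))" using B_large by (intro mult_left_mono) auto
  then show ?thesis using sort_small[OF True] by (elim solvable_mono) (simp add: algebra_simps)
next
  case False
  have "p ^ m \<le> p ^ (6 * p)" using assms p_large by (intro power_increasing) auto
  with assms(1) have "n \<le> p ^ (6 * p)" by (rule order_trans)
  with False obtain k where k: "p ^ k \<le> n" "solvable 1 (\<lambda>_. 0) n (3 * B * (real k + 2))"
    by (metis sort_large linorder_not_le)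
  have "p ^ k \<le> p ^ m" using k(1) assms(1) by simp
  then have "k \<le> m" by (rule power_le_imp_le_exp[rotated]) (use p_large in auto)
  then show ?thesis using B_large by (intro solvable_mono[OF k(2)] mult_left_mono) auto
qed

text \<open>Since \<open>2 * m' \<ge> m + 3\<close>, \<open>d = p ^ m' div 2\<close> satisfies
  \<open>h * p ^ 3 \<le> 4 * d ^ 2\<close>, enough for \<open>tail_small\<close>. The chunks have up
  to \<open>p ^ m'\<close> cells, so their cost comes from \<open>sort_power\<close> and is
  proportional to the exponent.\<close>

lemma lower_step:
  assumes m: "5 \<le> m" "m \<le> 4 * p + 1" and m': "m' = m div 2 + 2"
    and h: "p ^ m' div 2 \<le> h" "h \<le> p ^ m"
    and A: "solvable (p ^ p) (\<lambda>_. p ^ m') R c"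
  shows "solvable (p ^ p) (\<lambda>_. h) (p ^ p * (p ^ m' div 2) + R) (c + 3 * B * (real m' + 2) + 4)"
proof -
  let ?d = "p ^ m' div 2"
  have d: "2 * ?d = p ^ m'" using m' by (intro half_power) simp
  have "0 < p ^ m'" using p_large by simp
  then have h0: "0 < h" using d h(1) by linarith
  show ?thesis
  proof (rule solvable_lower[OF _ h(1) h0])
    show "solvable (p ^ p) (\<lambda>_. 2 * ?d) R c" unfolding d by (rule A)
    show "solvable 1 (\<lambda>_. 0) e (3 * B * (real m' + 2))" if "e \<le> 2 * ?d" for e
      using that unfolding d by (rule sort_power) (use m m' in auto)
    show "4 * real (p ^ p) ^ 2 * real h * exp (- (real ?d ^ 2 / (4 * real h))) \<le> 1"
    proof (rule tail_small[OF p_large])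
      show "p ^ p \<le> p ^ (6 * p)" using p_large by (intro power_increasing) auto
      have "p ^ m \<le> p ^ (5 * p)" using p_large m by (intro power_increasing) auto
      then show "h \<le> p ^ (5 * p)" using h by simp
      have "h * p ^ 3 \<le> p ^ m * p ^ 3" using h by (intro mult_right_mono) auto
      also have "\<dots> = p ^ (m + 3)" by (simp add: power_add)
      also have "\<dots> \<le> p ^ (2 * m')" using p_large m' by (intro power_increasing) auto
      also have "\<dots> = 4 * ?d ^ 2" using sq_half[of m'] m' by simp
      also have "\<dots> \<le> 8 * ?d ^ 2" by simp
      finally show "h * p ^ 3 \<le> 8 * ?d ^ 2" .
    qed (rule h0)
  qed (use p_large in simp)
qed

text \<open>One application of \<open>lower_step\<close> takes the remaining capacity \<^term>\<open>p ^ m\<close> to about its square root, so the costs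
  of the chunks form a geometric series.\<close>

lemma rounds:
  assumes "4 \<le> m" "m \<le> 4 * p + 1"
  shows "\<exists>\<rho>\<le>p ^ m. \<forall>R. \<rho> * p ^ p \<le> R \<longrightarrow> R < (\<rho> + 1) * p ^ p \<longrightarrow>
    solvable (p ^ p) (\<lambda>_. p ^ m) R (B + real p * (2 * B + 8) + 40 * real m * B)"
  using assms
proof (induction m rule: less_induct)
  case (less m)
  let ?q = "p ^ p"
  show ?case
  proof (cases "m = 4")
    case True
    have "solvable ?q (\<lambda>_. p ^ m) R (B + real p * (2 * B + 8) + 40 * real m * B)"
      if R: "2 * p ^ 3 * ?q \<le> R" "R < (2 * p ^ 3 + 1) * ?q" for R
      unfolding True by (rule solvable_mono[OF chain[OF _ R]]) (use B_large in auto)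
    moreover have "2 * p ^ 3 \<le> p ^ m" unfolding True using pow_steps(1) by linarith
    ultimately show ?thesis by blast
  next
    case False
    define m' where "m' = m div 2 + 2"
    have m: "5 \<le> m" "m \<le> 4 * p + 1" and m': "4 \<le> m'" "m' < m" "m' \<le> 4 * p + 1"
      using less.prems False by (auto simp: m'_def)
    from less.IH[OF m'(2,1,3)] obtain \<rho> where \<rho>: "\<rho> \<le> p ^ m'" and IH:
      "\<And>R. \<rho> * ?q \<le> R \<Longrightarrow> R < (\<rho> + 1) * ?q \<Longrightarrow>
        solvable ?q (\<lambda>_. p ^ m') R (B + real p * (2 * B + 8) + 40 * real m' * B)" by blast
    let ?d = "p ^ m' div 2"
    have up: "1024 * p ^ m' \<le> p ^ m"
      using pow_step[of "Suc m'" m'] power_increasing[of "Suc m'" m p] m'(2) p_large by linarith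
    have cost: "B + real p * (2 * B + 8) + 40 * real m' * B + 3 * B * (real m' + 2) + 4
       \<le> B + real p * (2 * B + 8) + 40 * real m * B"
    proof -
      \<comment> \<open>The exponent is about halved, so the drop of \<open>40 * m\<close> pays for
        the chunks. Any factor from 22 on would do in place of 40; \<open>m = 6\<close> is the
        tightest case.\<close>
      have "43 * m' + 7 \<le> 40 * m" using m(1) unfolding m'_def by (cases "even m") (auto elim!: evenE oddE)
      then have "43 * real m' + 7 \<le> 40 * real m" by linarith
      then have "B * (43 * real m' + 7) \<le> B * (40 * real m)" using B_large by (intro mult_left_mono) auto
      then show ?thesis using B_large by (simp add: algebra_simps)
    qed
    \<comment> \<open>Per bin, this round takes \<open>?d\<close> cells of the reserve and the later
      rounds take \<open>\<rho>\<close>.\<close>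
    have "solvable ?q (\<lambda>_. p ^ m) R (B + real p * (2 * B + 8) + 40 * real m * B)"
      if R: "(?d + \<rho>) * ?q \<le> R" "R < (?d + \<rho> + 1) * ?q" for R
    proof -
      let ?R = "R - ?q * ?d"
      have R': "?q * ?d + ?R = R" "\<rho> * ?q \<le> ?R" "?R < (\<rho> + 1) * ?q"
        using R by (auto simp: algebra_simps)
      have "solvable ?q (\<lambda>_. p ^ m) (?q * ?d + ?R)
         (B + real p * (2 * B + 8) + 40 * real m' * B + 3 * B * (real m' + 2) + 4)"
        using up by (intro lower_step[OF m m'_def _ _ IH[OF R'(2,3)]]) auto
      then show ?thesis unfolding R'(1) by (rule solvable_mono) (rule cost)
    qed
    moreover have "?d + \<rho> \<le> p ^ m" using \<rho> up by linarith
    ultimately show ?thesis by blast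
  qed
qed

text \<open>\<open>chain\<close> calls \<open>merge\<close> with chunks of varying size, whereas the
  rounds want a fixed number of cells per bin. The surplus of \<open>e\<close> cells per bin is
  spent first, by \<open>solvable_raise\<close>. This enlarges the capacity to at most
  \<open>2 * q ^ 4\<close>, which is why \<open>m\<close> is \<open>4 * p + 1\<close> and not
  \<open>4 * p\<close>.\<close>

lemma merge_next:
  defines "q \<equiv> p ^ p"
  assumes R: "q ^ 4 \<le> R" "R \<le> q ^ 5"
  shows "solvable q (\<lambda>_. q ^ 4) R (200 * real p * B)"
proof -
  define m where "m = 4 * p + 1"
  have m_eq: "p ^ m = p ^ Suc (4 * p)" by (simp add: m_def)
  define m' where "m' = m div 2 + 2"
  have m: "5 \<le> m" "m \<le> 4 * p + 1" and m': "4 \<le> m'" "m' \<le> 4 * p + 1" "m' = 2 * p + 2"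
    using p_large by (auto simp: m_def m'_def)
  obtain \<rho> where \<rho>: "\<rho> \<le> p ^ m'" and IH:
      "\<And>R. \<rho> * q \<le> R \<Longrightarrow> R < (\<rho> + 1) * q \<Longrightarrow>
        solvable q (\<lambda>_. p ^ m') R (B + real p * (2 * B + 8) + 40 * real m' * B)"
    using rounds[OF m'(1,2)] unfolding q_def by blast
  let ?d = "p ^ m' div 2"
  have q: "0 < q" using p_large by (simp add: q_def)
  have q3: "q ^ 3 = p ^ (3 * p)" and q4: "q ^ 4 = p ^ (4 * p)"
    by (simp_all add: q_def mult.commute flip: power_mult)
  have "p ^ Suc m' \<le> p ^ (3 * p)" using p_large m' by (intro power_increasing) auto
  then have small: "1024 * p ^ m' \<le> q ^ 3" using pow_step[of "Suc m'" m'] unfolding q3 by linarith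
  have "1 * q ^ 3 \<le> q * q ^ 3" using q by (intro mult_right_mono) auto
  moreover have q4': "q ^ 4 = q ^ 3 * q" and q5: "q ^ 5 = q ^ 4 * q" by (simp_all flip: power_Suc2)
  ultimately have q34: "q ^ 3 \<le> q ^ 4" by simp
  have lo: "q ^ 3 \<le> R div q" using R(1) q unfolding q4' by (simp add: less_eq_div_iff_mult_less_eq)
  have "R div q \<le> q ^ 5 div q" using R(2) by (rule div_le_mono)
  then have hi: "R div q \<le> q ^ 4" using q unfolding q5 by simp
  define e where "e = R div q - (?d + \<rho>)"
  have e: "e + (?d + \<rho>) = R div q" "e \<le> q ^ 4"
    using lo hi small \<rho> unfolding e_def by linarith+
  let ?h = "q ^ 4 + e" and ?R = "\<rho> * q + R mod q"
  have h: "?h \<le> p ^ m" using e(2) pow_step[of "Suc (4 * p)" "4 * p"] m_eq unfolding q4 by linarith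
  have "solvable q (\<lambda>_. p ^ m') ?R (B + real p * (2 * B + 8) + 40 * real m' * B)"
    using q by (intro IH) auto
  then have A: "solvable q (\<lambda>_. ?h) (q * ?d + ?R)
       (B + real p * (2 * B + 8) + 40 * real m' * B + 3 * B * (real m' + 2) + 4)"
    using h small q34 unfolding q_def[symmetric]
    by (intro lower_step[OF m m'_def, folded q_def]) auto
  have sol: "solvable q (\<lambda>_. q ^ 4) (q * (?h - q ^ 4) + (q * ?d + ?R))
       (B + real p * (2 * B + 8) + 40 * real m' * B + 3 * B * (real m' + 2) + 4 + 3 * B * (real m + 2) + 4)"
  proof (rule solvable_raise[OF q _ A])
    show "solvable 1 (\<lambda>_. 0) e (3 * B * (real m + 2))" if "e \<le> ?h" for e
      using that h m p_large by (intro sort_power) auto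
  qed simp
  have R_eq: "q * (?h - q ^ 4) + (q * ?d + ?R) = R"
  proof -
    have "q * (?h - q ^ 4) + (q * ?d + ?R) = q * (e + (?d + \<rho>)) + R mod q" by (simp add: algebra_simps)
    then show ?thesis unfolding e(1) by simp
  qed
  have le: "B + real p * (2 * B + 8) + 40 * real m' * B + 3 * B * (real m' + 2) + 4 + 3 * B * (real m + 2) + 4
     \<le> 200 * real p * B"
  proof -
    \<comment> \<open>All terms are linear in \<open>y\<close> and \<open>B\<close>, and
      \<open>103 * B \<le> y\<close> as \<open>p\<close> is large. The total is at most
      \<open>102 * y\<close>; 200 is a round bound.\<close>
    define y where "y = real p * B"
    have "real p * (2 * B + 8) \<le> real p * (3 * B)" using B_large by (intro mult_left_mono) auto
    then have 1: "real p * (2 * B + 8) \<le> 3 * y" by (simp add: y_def)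
    have "103 * B \<le> real p * B" using B_large p_large by (intro mult_right_mono) auto
    then have 2: "103 * B \<le> y" by (simp add: y_def)
    have "40 * real m' * B + 3 * B * (real m' + 2) + 3 * B * (real m + 2) = 98 * y + 101 * B"
      unfolding m'(3) m_def y_def by (simp add: algebra_simps)
    moreover have "200 * real p * B = 200 * y" by (simp add: y_def)
    ultimately show ?thesis using 1 2 B_large by linarith
  qed
  show ?thesis by (rule solvable_mono[OF sol[unfolded R_eq] le])
qed

lemma level_next: "level (p ^ p) (200 * real p * B)"
  unfolding level_def
proof (intro conjI allI impI)
  show "even (p ^ p)" using p_even p_large by simp
  show "1024 \<le> p ^ p" using p_large self_le_power[of p p] by linarith
  have "1 * 8 \<le> (200 * real p) * B" using p_large B_large by (intro mult_mono) auto
  then show "8 \<le> 200 * real p * B" by simp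
  show "solvable 1 (\<lambda>_. 0) e (200 * real p * B)" if "e \<le> (p ^ p) ^ 6" for e
  proof -
    have "e \<le> p ^ (6 * p)" using that by (simp add: mult.commute flip: power_mult)
    then have "solvable 1 (\<lambda>_. 0) e (3 * B * (real (6 * p) + 2))" by (rule sort_power) simp
    moreover have "B * (3 * (real (6 * p) + 2)) \<le> B * (200 * real p)"
      using B_large p_large by (intro mult_left_mono) auto
    then have "3 * B * (real (6 * p) + 2) \<le> 200 * real p * B" by (simp add: algebra_simps)
    ultimately show ?thesis by (rule solvable_mono)
  qed
qed (rule merge_next)

end

text \<open>Crude bounds suffice for a fixed \<open>p\<close>. Sequential filling costs at most 1
  per cell, and in the merge the bins are filled to the brim before the reserve, each of the
  \<open>1024 ^ 5\<close> routed items paying at most 2.\<close>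

lemma level_base: "level 1024 (1024 ^ 6)"
  unfolding level_def
proof (intro conjI allI impI)
  show "solvable 1 (\<lambda>_. 0) e (1024 ^ 6)" if "e \<le> 1024 ^ 6" for e
  proof (rule solvable_mono[OF solvable_sequential])
    show "real e \<le> 1024 ^ 6" using that by (metis of_nat_le_iff of_nat_numeral of_nat_power)
  qed simp
  fix R :: nat assume "R \<le> 1024 ^ 5"
  then have R: "real R \<le> 1024 ^ 5" by (metis of_nat_le_iff of_nat_numeral of_nat_power)
  let ?a = "avg 1024 (1024 * (1024 ^ 4 - 0)) (unbalanced 1024 (1024 ^ 4 - 0) (1024 ^ 4))"
  have A: "solvable 1024 (\<lambda>_. 1024 ^ 4) R (real R + 2 * (real (1024 * (1024 ^ 4 - 0)) * ?a))"
  proof (rule solvable_phase)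
    fix g :: "nat \<Rightarrow> nat" assume "\<forall>l<1024. g l \<le> 0"
    then show "solvable 1024 g R (real R)"
      using solvable_sequential[of 1024 R] solvable_cong[of 1024 g "\<lambda>_. 0" R "real R"] by simp
  qed auto
  have "?a \<le> 1" by (rule unbalanced_le_1) simp
  then show "solvable 1024 (\<lambda>_. 1024 ^ 4) R (1024 ^ 6)"
    by (intro solvable_mono[OF A]) (use R in simp)
qed auto

section \<open>The tower of levels\<close>

primrec tower :: "nat \<Rightarrow> nat" where
  "tower 0 = 1024"
| "tower (Suc j) = tower j ^ tower j"

lemma tower_large: "1024 \<le> tower j"
proof (induction j)
  case (Suc j)
  have "tower j \<le> tower j ^ tower j" using Suc by (intro self_le_power) auto
  with Suc have "1024 \<le> tower j ^ tower j" by linarith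
  then show ?case by simp
qed simp

lemma log_tower_Suc: "log 2 (real (tower (Suc j))) = real (tower j) * log 2 (real (tower j))"
  using tower_large[of j] by (simp add: log_nat_power)

lemma log_1024: "log 2 (1024 :: real) = 10"
  using log_pow_cancel[of "2::real" 10] by simp

lemma log_tower: "10 \<le> log 2 (real (tower j))"
proof -
  have "log 2 1024 \<le> log 2 (real (tower j))"
    using tower_large[of j] by (subst log_le_cancel_iff) auto
  then show ?thesis unfolding log_1024 .
qed

lemma tower_strict: "tower j < tower (Suc j)"
proof -
  have "1024 * tower j \<le> tower j ^ 2" using tower_large[of j] by (simp add: power2_eq_square)
  also have "\<dots> \<le> tower j ^ tower j" using tower_large[of j] by (intro power_increasing) auto
  finally show ?thesis using tower_large[of j] by simp
qed

lemma less_tower: "j < tower j"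
proof (induction j)
  case (Suc j)
  then show ?case using tower_strict[of j] by linarith
qed simp

text \<open>\<open>level_next\<close> multiplies the cost by \<open>200 * tower j\<close>. By
  \<open>log_tower_Suc\<close> the logarithm absorbs \<open>tower j\<close>, and 200 per storey
  remains; the 10 is \<open>log 2 1024\<close>.\<close>

lemma level_tower: "level (tower j) (1024 ^ 6 / 10 * 200 ^ j * log 2 (real (tower j)))"
proof (induction j)
  case 0
  show ?case using level_base log_1024 by simp
next
  case (Suc j)
  from level_next[OF this] show ?case
    unfolding log_tower_Suc by (simp add: mult_ac)
qed

text \<open>By \<open>log_tower_Suc\<close> the logarithm of \<open>tower (Suc i)\<close> is still
  at least \<open>tower i\<close>: one logarithm takes off at most one storey.\<close>

lemma iterated_log_tower:
  assumes "real (tower i) \<le> x" "k \<le> i"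
  shows "1 < (log 2 ^^ k) x"
  using assms
proof (induction i arbitrary: x k)
  case 0
  then show ?case by simp
next
  case (Suc i)
  show ?case
  proof (cases k)
    case 0
    then have "(log 2 ^^ k) x = x" by simp
    moreover have "1024 \<le> real (tower (Suc i))" using tower_large[of "Suc i"] by linarith
    ultimately show ?thesis using Suc.prems(1) by linarith
  next
    case (Suc k')
    have "real (tower i) * 1 \<le> real (tower i) * log 2 (real (tower i))"
      using log_tower[of i] by (intro mult_left_mono) auto
    also have "\<dots> = log 2 (real (tower (Suc i)))" by (rule log_tower_Suc[symmetric])
    also have "\<dots> \<le> log 2 x"
      using Suc.prems(1) tower_large[of "Suc i"] by (intro log_mono) auto
    finally have "1 < (log 2 ^^ k') (log 2 x)"
      using Suc.prems Suc by (intro Suc.IH) auto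
    then show ?thesis by (simp only: Suc funpow_Suc_right comp_apply)
  qed
qed

lemma log_star_tower: "real (tower i) \<le> x \<Longrightarrow> i \<le> log_star x"
proof (rule ccontr)
  assume x: "real (tower i) \<le> x" and "\<not> i \<le> log_star x"
  then have "1 < (log 2 ^^ log_star x) x" by (intro iterated_log_tower) auto
  moreover have "(log 2 ^^ log_star x) x \<le> 1"
    unfolding log_star_def by (rule LeastI_ex[OF log_star_exists])
  ultimately show False by simp
qed

lemma log_star_pos: "1 < x \<Longrightarrow> 1 \<le> log_star x"
proof (rule ccontr)
  assume x: "1 < x" and "\<not> 1 \<le> log_star x"
  then have "log_star x = 0" by simp
  moreover have "(log 2 ^^ log_star x) x \<le> 1"
    unfolding log_star_def by (rule LeastI_ex[OF log_star_exists])
  ultimately show False using x by simp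
qed

lemma solvable_log_star:
  assumes n: "2 \<le> n"
  shows "solvable 1 (\<lambda>_. 0) n (1024 ^ 6 * 200 ^ log_star (real n) * log 2 (real n))"
proof -
  have l1: "1 \<le> log 2 (real n)" using n by (simp add: le_log_iff)
  show ?thesis
  proof (cases "n \<le> 1024 ^ 6")
    case True
    then have "real n \<le> 1024 ^ 6" by (metis of_nat_le_iff of_nat_numeral of_nat_power)
    also have "(1024 ^ 6 :: real) * 1 * 1 \<le> 1024 ^ 6 * 200 ^ log_star (real n) * log 2 (real n)"
      using l1 by (intro mult_mono) auto
    finally show ?thesis by (intro solvable_mono[OF solvable_sequential]) auto
  next
    case False
    have ex: "\<exists>j. n \<le> tower j ^ 6"
      using less_tower[of n] self_le_power[of "tower n" 6] tower_large[of n]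
      by (intro exI[of _ n]) linarith
    \<comment> \<open>As \<open>(p ^ p) ^ 6 = p ^ (6 * p)\<close>, the ranges of
      \<open>sort_large\<close> for successive storeys adjoin and cover all \<open>n\<close> above
      \<open>1024 ^ 6\<close>.\<close>
    define j where "j = (LEAST j. n \<le> tower j ^ 6)"
    have j: "n \<le> tower j ^ 6" unfolding j_def by (rule LeastI_ex[OF ex])
    have "j \<noteq> 0" using j False by (intro notI) simp
    then obtain i where i: "j = Suc i" by (cases j) auto
    let ?p = "tower i" and ?L = "log 2 (real (tower i))"
    let ?B = "1024 ^ 6 / 10 * 200 ^ i * ?L :: real"
    have lo: "?p ^ 6 < n"
      using not_less_Least[of i "\<lambda>j. n \<le> tower j ^ 6"] i by (simp add: j_def not_le)
    have hi: "n \<le> ?p ^ (6 * ?p)" using j i by (simp add: mult.commute flip: power_mult)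
    obtain k where k: "?p ^ k \<le> n" "solvable 1 (\<lambda>_. 0) n (3 * ?B * (real k + 2))"
      by (rule sort_large[OF level_tower lo hi])
    have pos: "0 < real ?p" using tower_large[of i] by simp
    have logle: "real m * ?L \<le> log 2 (real n)" if "?p ^ m \<le> n" for m
    proof -
      have "real m * ?L = log 2 (real (?p ^ m))" using pos by (simp add: log_nat_power)
      also have "\<dots> \<le> log 2 (real n)" using that pos by (intro log_mono) (auto simp flip: of_nat_power)
      finally show ?thesis .
    qed
    \<comment> \<open>\<open>?p ^ k \<le> n\<close> bounds \<open>k * ?L\<close> and
      \<open>?p ^ 6 < n\<close> bounds \<open>2 * ?L\<close>, each by
      \<open>log 2 n\<close>.\<close>
    have "(real k + 2) * ?L \<le> 2 * log 2 (real n)"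
      using logle[OF k(1)] logle[of 6] lo log_tower[of i] by (simp add: algebra_simps)
    then have "1024 ^ 6 / 10 * 3 * 200 ^ i * ((real k + 2) * ?L) \<le> 1024 ^ 6 / 10 * 3 * 200 ^ i * (2 * log 2 (real n))"
      by (intro mult_left_mono) auto
    also have "\<dots> = 1024 ^ 6 * (6 / 10) * 200 ^ i * log 2 (real n)" by simp
    also have "\<dots> \<le> 1024 ^ 6 * 1 * 200 ^ log_star (real n) * log 2 (real n)"
    proof (intro mult_right_mono mult_mono power_increasing)
      have "?p \<le> n" using lo self_le_power[of ?p 6] tower_large[of i] by linarith
      then show "i \<le> log_star (real n)" by (intro log_star_tower) simp
    qed (use l1 in auto)
    finally show ?thesis by (intro solvable_mono[OF k(2)]) (simp add: mult_ac)
  qed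
qed

section \<open>From discrete solvers to online algorithms\<close>

text \<open>\<open>min\<close> assigns the end point 1 to the last interval and \<open>nat\<close>
  cuts off at 0. So for \<open>0 < M\<close> every real has a letter, and the placements are a
  bijection even for inputs outside \<open>{0..1}\<close>.\<close>

definition grid :: "nat \<Rightarrow> real \<Rightarrow> nat" where
  "grid M x = min (nat \<lfloor>real M * x\<rfloor>) (M - 1)"

lemma grid_less: "0 < M \<Longrightarrow> grid M x < M"
  by (simp add: grid_def min_less_iff_disj)

lemma grid_close:
  assumes "0 < M" "x \<in> {0..1}"
  shows "\<bar>x - real (grid M x) / real M\<bar> \<le> 1 / real M"
proof -
  let ?f = "\<lfloor>real M * x\<rfloor>"
  have f: "0 \<le> ?f" "real_of_int ?f \<le> real M * x" "real M * x < real_of_int ?f + 1"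
    using assms by auto
  have "real M * x \<le> real M" using assms by (simp add: mult_left_le)
  have "\<bar>real M * x - real (grid M x)\<bar> \<le> 1"
  proof (cases "nat ?f \<le> M - 1")
    case True
    then have "real (grid M x) = real_of_int ?f" using f(1) by (simp add: grid_def)
    then show ?thesis using f by linarith
  next
    case False
    then have "real (grid M x) = real M - 1" using assms(1) by (simp add: grid_def of_nat_diff)
    moreover have "int M \<le> ?f" using False assms(1) by linarith
    then have "real M \<le> real_of_int ?f" by linarith
    ultimately show ?thesis using f \<open>real M * x \<le> real M\<close> by linarith
  qed
  then have "\<bar>real M * x - real (grid M x)\<bar> / real M \<le> 1 / real M" by (rule divide_right_mono) simp
  moreover have "x - real (grid M x) / real M = (real M * x - real (grid M x)) / real M"
    using assms(1) by (simp add: field_simps)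
  ultimately show ?thesis by (simp add: abs_divide)
qed

lemma grid_measurable [measurable]: "grid M \<in> borel \<rightarrow>\<^sub>M count_space UNIV"
  unfolding grid_def[abs_def] by measurable

text \<open>The last interval alone is closed on the right, hence the case distinction.\<close>

lemma grid_prob:
  assumes "0 < M" "j < M"
  shows "measure (uniform_measure lborel {0..1::real}) {x. grid M x = j} = 1 / real M"
proof -
  have sets: "{x. grid M x = j} \<in> sets lborel"
    using measurable_sets[OF grid_measurable, of "{j}" M] by (simp add: vimage_def)
  have "measure lborel ({0..1} \<inter> {x. grid M x = j}) = 1 / real M"
  proof (cases "Suc j < M")
    case True
    have "{0..1} \<inter> {x. grid M x = j} = {real j / real M..<real (Suc j) / real M}"
    proof (intro set_eqI iffI)
      fix x assume x: "x \<in> {0..1} \<inter> {x. grid M x = j}"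
      then have "0 \<le> \<lfloor>real M * x\<rfloor>" "nat \<lfloor>real M * x\<rfloor> = j" using True by (auto simp: grid_def min_def split: if_splits)
      then have "\<lfloor>real M * x\<rfloor> = int j" by (metis nat_0_le)
      then have "real j \<le> real M * x" "real M * x < real j + 1" by linarith+
      then show "x \<in> {real j / real M..<real (Suc j) / real M}" using assms by (simp add: field_simps)
    next
      fix x assume x: "x \<in> {real j / real M..<real (Suc j) / real M}"
      then have b: "real j \<le> real M * x" "real M * x < real j + 1" using assms by (auto simp: field_simps)
      then have "\<lfloor>real M * x\<rfloor> = int j" by linarith
      moreover have "0 \<le> x" using x by (smt (verit) atLeastLessThan_iff divide_nonneg_nonneg of_nat_0_le_iff)
      moreover have "real M * x \<le> real M * 1" using b True by linarith
      then have "x \<le> 1" using assms by simp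
      ultimately show "x \<in> {0..1} \<inter> {x. grid M x = j}" using True by (simp add: grid_def)
    qed
    then show ?thesis using assms by (simp add: divide_right_mono flip: diff_divide_distrib)
  next
    case False
    then have M: "M = Suc j" using assms by simp
    have "{0..1} \<inter> {x. grid M x = j} = {real j / real M..1}"
    proof (intro set_eqI iffI)
      fix x assume x: "x \<in> {0..1} \<inter> {x. grid M x = j}"
      then have "0 \<le> \<lfloor>real M * x\<rfloor>" "j \<le> nat \<lfloor>real M * x\<rfloor>" using M by (auto simp: grid_def min_def split: if_splits)
      then have "real j \<le> real M * x" by linarith
      then show "x \<in> {real j / real M..1}" using x assms by (simp add: field_simps)
    next
      fix x assume x: "x \<in> {real j / real M..1}"
      then have "real j \<le> real M * x" using assms by (auto simp: field_simps)
      then have "j \<le> nat \<lfloor>real M * x\<rfloor>" by linarith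
      moreover have "0 \<le> x" using x by (smt (verit) atLeastAtMost_iff divide_nonneg_nonneg of_nat_0_le_iff)
      ultimately show "x \<in> {0..1} \<inter> {x. grid M x = j}" using x M by (simp add: grid_def)
    qed
    moreover have "real j / real M \<le> 1" "1 - real j / real M = 1 / real M" using M by (auto simp: field_simps)
    ultimately show ?thesis by simp
  qed
  then show ?thesis using sets by (subst measure_uniform_measure) auto
qed

section \<open>The distribution of discretised inputs\<close>

definition grid_word :: "nat \<Rightarrow> nat \<Rightarrow> (nat \<Rightarrow> real) \<Rightarrow> nat list" where
  "grid_word M m x = map (\<lambda>i. grid M (x i)) [0..<m]"

lemma grid_word_words: "0 < M \<Longrightarrow> grid_word M m x \<in> words M m"
  by (auto simp: grid_word_def words_def grid_less)

lemma grid_word_measurable: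
  "m \<le> n \<Longrightarrow> grid_word M m \<in> uniform_input n \<rightarrow>\<^sub>M count_space UNIV"
proof (induction m)
  case 0
  then show ?case by (simp add: grid_word_def[abs_def])
next
  case (Suc m)
  have "(\<lambda>x. x m) \<in> uniform_input n \<rightarrow>\<^sub>M uniform_measure lborel {0..1::real}"
    unfolding uniform_input_def using Suc.prems by (intro measurable_component_singleton) auto
  then have coord: "(\<lambda>x. x m) \<in> borel_measurable (uniform_input n)" by (simp cong: measurable_cong_sets)
  have last: "(\<lambda>x. grid M (x m)) \<in> uniform_input n \<rightarrow>\<^sub>M count_space UNIV"
    using measurable_compose[OF coord grid_measurable] .
  have "(\<lambda>x. (\<lambda>l x. l @ [grid M (x m)]) (grid_word M m x) x) \<in> uniform_input n \<rightarrow>\<^sub>M count_space UNIV"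
  proof (rule measurable_compose_countable[where f = "\<lambda>l x. l @ [grid M (x m)]" and g = "grid_word M m"])
    show "grid_word M m \<in> uniform_input n \<rightarrow>\<^sub>M count_space UNIV" using Suc by simp
    fix l :: "nat list"
    show "(\<lambda>x. l @ [grid M (x m)]) \<in> uniform_input n \<rightarrow>\<^sub>M count_space UNIV"
      using last by (auto intro: measurable_compose)
  qed
  then show ?case by (simp add: grid_word_def[abs_def])
qed

lemma finite_words: "finite (words N n)"
proof -
  have "words N n = {xs. set xs \<subseteq> {..<N} \<and> length xs = n}" by (auto simp: words_def)
  then show ?thesis using finite_lists_length_eq[of "{..<N}" n] by simp
qed

lemma avg_words: "avg N n F = (\<Sum>ws\<in>words N n. F ws) / real N ^ n"
proof (induction n arbitrary: F)
  case (Suc n)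
  have "words N (Suc n) = (\<lambda>(ws, x). ws @ [x]) ` (words N n \<times> {..<N})"
    by (auto simp: words_snoc elim!: words_SucE)
  moreover have "inj_on (\<lambda>(ws, x). ws @ [x]) (words N n \<times> {..<N})" by (auto simp: inj_on_def)
  ultimately have "(\<Sum>ws\<in>words N (Suc n). F ws) = (\<Sum>ws\<in>words N n. \<Sum>x<N. F (ws @ [x]))"
    by (simp add: sum.reindex sum.cartesian_product case_prod_unfold)
  then show ?case by (simp add: Suc sum_divide_distrib)
qed simp

text \<open>The inputs with a given grid word form a box, whose measure is the product over its
  sides.\<close>

lemma prob_grid_word:
  assumes M: "0 < M" and ws: "ws \<in> words M n"
  shows "measure (uniform_input n) {x \<in> space (uniform_input n). grid_word M n x = ws} = (1 / real M) ^ n"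
proof -
  have "prob_space (uniform_measure lborel {0..1::real})" by (rule prob_space_uniform_measure) auto
  then have "product_prob_space (\<lambda>_::nat. uniform_measure lborel {0..1::real})"
    by (intro product_prob_spaceI)
  then interpret finite_product_prob_space "\<lambda>_::nat. uniform_measure lborel {0..1::real}" "{..<n}"
    by (simp add: finite_product_prob_space_def finite_product_sigma_finite_def
        finite_product_sigma_finite_axioms_def product_prob_space_def)
  have sets: "{x. grid M x = j} \<in> sets (uniform_measure lborel {0..1})" for j
    using measurable_sets[OF grid_measurable, of "{j}" M] by (simp add: vimage_def)
  have "{x \<in> space (uniform_input n). grid_word M n x = ws} = (\<Pi>\<^sub>E i\<in>{..<n}. {x. grid M x = ws ! i})"
    using ws by (auto simp: uniform_input_def space_PiM grid_word_def words_def list_eq_iff_nth_eq PiE_iff extensional_def)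
  then have "measure (uniform_input n) {x \<in> space (uniform_input n). grid_word M n x = ws} =
     (\<Prod>i<n. measure (uniform_measure lborel {0..1::real}) {x. grid M x = ws ! i})"
    using prob_times[of "\<lambda>i. {x. grid M x = ws ! i}", OF sets] by (simp add: uniform_input_def)
  also have "\<dots> = (\<Prod>i<n. 1 / real M)"
    using M ws by (intro prod.cong refl grid_prob) (auto simp: words_def image_subset_iff subset_iff)
  finally show ?thesis by simp
qed

lemma integral_grid_word:
  assumes M: "0 < M"
  shows "integrable (uniform_input n) (\<lambda>x. F (grid_word M n x))"
    and "(\<integral>x. F (grid_word M n x) \<partial>uniform_input n) = avg M n F"
proof -
  interpret prob_space "uniform_input n" by (rule prob_space_uniform_input)
  let ?S = "\<lambda>ws. {x \<in> space (uniform_input n). grid_word M n x = ws}"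
  have sets: "?S ws \<in> sets (uniform_input n)" for ws
    using measurable_sets[OF grid_word_measurable[OF order_refl, where M = M], where S = "{ws}"]
    by (simp add: vimage_def Int_def conj_commute)
  have eq: "F (grid_word M n x) = (\<Sum>ws\<in>words M n. F ws * indicator (?S ws) x)" if "x \<in> space (uniform_input n)" for x
  proof -
    have "(\<Sum>ws\<in>words M n. F ws * indicator (?S ws) x) = (\<Sum>ws\<in>words M n. if ws = grid_word M n x then F ws else 0)"
      using that by (intro sum.cong) (auto simp: indicator_def)
    then show ?thesis using grid_word_words[OF M] finite_words by simp
  qed
  have int: "integrable (uniform_input n) (\<lambda>x. F ws * indicator (?S ws) x)" for ws
    using sets by (intro integrable_mult_right) (auto simp: emeasure_eq_measure)
  have cong: "integrable (uniform_input n) (\<lambda>x. F (grid_word M n x)) \<longleftrightarrow>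
      integrable (uniform_input n) (\<lambda>x. \<Sum>ws\<in>words M n. F ws * indicator (?S ws) x)"
    by (rule Bochner_Integration.integrable_cong) (auto simp: eq)
  show "integrable (uniform_input n) (\<lambda>x. F (grid_word M n x))"
    unfolding cong by (intro Bochner_Integration.integrable_sum int)
  have "(\<integral>x. F (grid_word M n x) \<partial>uniform_input n) = (\<integral>x. (\<Sum>ws\<in>words M n. F ws * indicator (?S ws) x) \<partial>uniform_input n)"
    by (rule Bochner_Integration.integral_cong) (auto simp: eq)
  also have "\<dots> = (\<Sum>ws\<in>words M n. F ws * measure (uniform_input n) (?S ws))"
    using sets int by (subst Bochner_Integration.integral_sum) (auto simp: Int_absorb1 sets.sets_into_space)
  also have "\<dots> = (\<Sum>ws\<in>words M n. F ws * (1 / real M) ^ n)"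
    using prob_grid_word[OF M] by (intro sum.cong) auto
  also have "\<dots> = avg M n F"
    by (simp add: avg_words sum_divide_distrib power_divide)
  finally show "(\<integral>x. F (grid_word M n x) \<partial>uniform_input n) = avg M n F" .
qed

text \<open>Rounding shifts each of the \<open>n\<close> cells by at most \<open>1 / M\<close>, and
  a cell lies in at most two differences. So it costs at most \<open>2 * n / M\<close>, which
  divisibility of \<open>M\<close> by \<open>2 * n\<close> keeps below the extra 1.\<close>

lemma solver_online:
  assumes D: "solver 1 M (\<lambda>_. 0) n c D" and M: "0 < M" "2 * n dvd M" and n: "0 < n"
  defines "A \<equiv> (\<lambda>xs. projr (D (map (grid M) xs)))"
  shows "online_algorithm n A" "expected_cost n A \<le> c + 1"
proof -
  let ?w = "grid_word M n"
  have slots: "image_mset fst (trace D (?w x)) = image_mset Inr (mset_set {..<n})" for x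
    using D grid_word_words[OF M(1), of n x] by (simp add: solver_def slots_def)
  have take: "take (Suc t) (?w x) = map (grid M) (map x [0..<Suc t])" if "t < n" for x t
    using that by (simp add: grid_word_def take_map comp_def del: upt_Suc)
  \<comment> \<open>Without bins every answer in a run is an \<open>Inr\<close>, so
    \<open>projr\<close> loses nothing.\<close>
  have place: "D (take (Suc t) (?w x)) = Inr (placement A x t)" if t: "t < n" for x t
  proof -
    have "D (take (Suc t) (?w x)) \<in># image_mset fst (trace D (?w x))"
      using trace_nth[of t "?w x" D] t by (force simp: grid_word_def)
    then obtain i where "D (take (Suc t) (?w x)) = Inr i" unfolding slots by auto
    then show ?thesis unfolding take[OF t] by (simp add: placement_def A_def)
  qed
  have "mset (map (placement A x) [0..<n]) = mset_set {..<n}" for x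
  proof -
    have "image_mset Inr (mset (map (placement A x) [0..<n])) = mset (map (\<lambda>t. Inr (placement A x t) :: nat + nat) [0..<n])"
      by (simp add: multiset.map_comp comp_def)
    also have "map (\<lambda>t. Inr (placement A x t) :: nat + nat) [0..<n] = map (\<lambda>t. D (take (Suc t) (?w x))) [0..<n]"
      using place by (intro map_cong) auto
    also have "mset \<dots> = image_mset fst (trace D (?w x))"
      by (simp add: trace_def multiset.map_comp comp_def grid_word_def)
    finally have "image_mset projr (image_mset (Inr :: nat \<Rightarrow> nat + nat) (mset (map (placement A x) [0..<n])))
        = image_mset projr (image_mset (Inr :: nat \<Rightarrow> nat + nat) (mset_set {..<n}))"
      unfolding slots by simp
    then show ?thesis by (simp add: multiset.map_comp comp_def)
  qed
  then have dist: "distinct (map (placement A x) [0..<n])" and set: "placement A x ` {..<n} = {..<n}" for x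
  proof -
    assume a: "\<And>x. mset (map (placement A x) [0..<n]) = mset_set {..<n}"
    have "mset (map (placement A x) [0..<n]) = mset [0..<n]" unfolding a by (simp add: lessThan_atLeast0)
    then show "distinct (map (placement A x) [0..<n])" by (metis distinct_upt mset_eq_imp_distinct_iff)
    have "set (map (placement A x) [0..<n]) = {..<n}" using a[of x] by (metis finite_lessThan finite_set_mset_mset_set set_mset_mset)
    then show "placement A x ` {..<n} = {..<n}" by (simp add: lessThan_atLeast0)
  qed
  have inj: "inj_on (placement A x) {..<n}" for x
    using dist[of x] by (simp add: distinct_map lessThan_atLeast0)
  show A: "online_algorithm n A"
    unfolding online_algorithm_def
  proof (intro conjI allI impI)
    fix x t assume t: "t < n"
    show "placement A x t \<in> {..<n} - placement A x ` {..<t}"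
    proof
      show "placement A x t \<in> {..<n}" using set[of x] t by blast
      show "placement A x t \<notin> placement A x ` {..<t}"
      proof
        assume "placement A x t \<in> placement A x ` {..<t}"
        then obtain s where s: "s < t" "placement A x t = placement A x s" by auto
        from inj_onD[OF inj s(2)] s(1) t show False by simp
      qed
    qed
  next
    fix t assume "t < n"
    then have "grid_word M (Suc t) \<in> uniform_input n \<rightarrow>\<^sub>M count_space UNIV"
      by (intro grid_word_measurable) simp
    then have "(\<lambda>x. projr (D (grid_word M (Suc t) x))) \<in> uniform_input n \<rightarrow>\<^sub>M count_space UNIV"
      by (rule measurable_compose) simp
    then show "(\<lambda>x. placement A x t) \<in> uniform_input n \<rightarrow>\<^sub>M count_space UNIV"
      by (simp add: placement_def[abs_def] A_def grid_word_def[abs_def] comp_def del: upt_Suc)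
  qed
  have cost: "cost n A x \<le> run_cost 1 M n (trace D (?w x)) + 1" if x: "\<forall>t<n. x t \<in> {0..1}" for x
  proof -
    have close: "\<bar>cell n A x i - content (1 * M) (trace D (?w x)) i\<bar> \<le> 1 / real M" if i: "i < n" for i
    proof -
      obtain t where t: "t < n" "placement A x t = i" using set[of x] i by (metis imageE lessThan_iff)
      have "cell n A x i = x t"
        unfolding cell_def using the_inv_into_f_f[OF inj[of x], of t] t by simp
      moreover have "content (1 * M) (trace D (?w x)) i = real (grid M (x t)) / real M"
      proof -
        have "content (1 * M) (trace D (?w x)) i =
          (\<Sum>s<n. if D (take (Suc s) (?w x)) = Inr i then real (?w x ! s) / real M else 0)"
          unfolding content_def sum_trace by (simp add: grid_word_def cong: if_cong)
        also have "\<dots> = (\<Sum>s<n. if s = t then real (grid M (x t)) / real M else 0)"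
        proof (intro sum.cong refl)
          fix s assume "s \<in> {..<n}"
          then have s: "s < n" by simp
          have "placement A x s = i \<longleftrightarrow> s = t" using inj[of x] s t by (auto simp: inj_on_def)
          then show "(if D (take (Suc s) (?w x)) = Inr i then real (?w x ! s) / real M else 0) =
             (if s = t then real (grid M (x t)) / real M else 0)"
            unfolding place[OF s] using s by (auto simp: grid_word_def)
        qed
        finally show ?thesis using t by simp
      qed
      ultimately show ?thesis using grid_close[OF M(1)] x t by simp
    qed
    have "cost n A x = variation (map (cell n A x) [0..<n])"
      by (simp add: cost_def variation_map_upt)
    also have "\<dots> \<le> variation (map (content (1 * M) (trace D (?w x))) [0..<n]) +
        2 * (\<Sum>i\<leftarrow>[0..<n]. \<bar>cell n A x i - content (1 * M) (trace D (?w x)) i\<bar>)"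
      by (rule variation_perturb)
    also have "(\<Sum>i\<leftarrow>[0..<n]. \<bar>cell n A x i - content (1 * M) (trace D (?w x)) i\<bar>) =
        (\<Sum>i<n. \<bar>cell n A x i - content (1 * M) (trace D (?w x)) i\<bar>)"
      by (simp add: interv_sum_list_conv_sum_set_nat lessThan_atLeast0)
    also have "\<dots> \<le> (\<Sum>i<n. 1 / real M)" using close by (intro sum_mono) auto
    also have "2 * \<dots> \<le> 1"
    proof -
      have "2 * n \<le> M" using M by (simp add: dvd_imp_le)
      then have "2 * real n \<le> real M" by linarith
      then show ?thesis using M(1) by simp
    qed
    also have "variation (map (content (1 * M) (trace D (?w x))) [0..<n]) = run_cost 1 M n (trace D (?w x))"
      using no_bins_trace[of "trace D (?w x)" 1 n] slots[of x] by (simp add: run_cost_def slots_def)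
    finally show ?thesis by simp
  qed
  interpret prob_space "uniform_input n" by (rule prob_space_uniform_input)
  have "expected_cost n A \<le> (\<integral>x. run_cost 1 M n (trace D (?w x)) + 1 \<partial>uniform_input n)"
    unfolding expected_cost_def
  proof (rule integral_mono_AE)
    show "integrable (uniform_input n) (cost n A)" by (rule integrable_cost[OF A])
    show "integrable (uniform_input n) (\<lambda>x. run_cost 1 M n (trace D (?w x)) + 1)"
      using integral_grid_word(1)[OF M(1), of n "\<lambda>w. run_cost 1 M n (trace D w)"] by simp
    show "AE x in uniform_input n. cost n A x \<le> run_cost 1 M n (trace D (?w x)) + 1"
      using AE_uniform_input[of n] by (rule eventually_mono) (rule cost)
  qed
  also have "\<dots> = (\<integral>x. run_cost 1 M n (trace D (?w x)) \<partial>uniform_input n) + 1"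
    using integral_grid_word(1)[OF M(1), of n "\<lambda>w. run_cost 1 M n (trace D w)"] prob_space by simp
  also have "\<dots> = avg M n (\<lambda>w. run_cost 1 M n (trace D w)) + 1"
    using integral_grid_word(2)[OF M(1), of n "\<lambda>w. run_cost 1 M n (trace D w)"] by simp
  also have "\<dots> \<le> c + 1" using D by (simp add: solver_def)
  finally show "expected_cost n A \<le> c + 1" .
qed

lemma solvable_online:
  assumes "solvable 1 (\<lambda>_. 0) n c" "0 < n"
  shows "\<exists>A. online_algorithm n A \<and> expected_cost n A \<le> c + 1"
proof -
  obtain M0 where M0: "0 < M0" "\<And>M. 0 < M \<Longrightarrow> M0 dvd M \<Longrightarrow> \<exists>D. solver 1 M (\<lambda>_. 0) n c D"
    using assms(1) unfolding solvable_def by blast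
  define M where "M = M0 * (2 * n)"
  have M: "0 < M" "M0 dvd M" "2 * n dvd M" using M0(1) assms(2) by (auto simp: M_def)
  obtain D where "solver 1 M (\<lambda>_. 0) n c D" using M0(2)[OF M(1,2)] by blast
  from solver_online[OF this M(1,3) assms(2)] show ?thesis by blast
qed

theorem theorem1:
  "\<exists>C::real. C > 0 \<and>
     (\<forall>n::nat. n \<ge> 2 \<longrightarrow>
        (\<exists>A. online_algorithm n A \<and>
             expected_cost n A \<le> log 2 (real n) * 2 powr (C * real (log_star (real n)))))"
proof (intro exI[of _ 69] conjI allI impI)
  fix n :: nat assume n: "2 \<le> n"
  let ?s = "log_star (real n)" and ?L = "log 2 (real n)"
  have L: "1 \<le> ?L" using n by (simp add: le_log_iff)
  have s: "1 \<le> ?s" using n by (intro log_star_pos) simp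
  obtain A where A: "online_algorithm n A" "expected_cost n A \<le> 1024 ^ 6 * 200 ^ ?s * ?L + 1"
    using solvable_online[OF solvable_log_star[OF n]] n by auto
  have "(1 :: real) * 1 \<le> 200 ^ ?s * ?L" using L by (intro mult_mono) auto
  then have "1024 ^ 6 * 200 ^ ?s * ?L + 1 \<le> (1024 ^ 6 + 1) * (200 ^ ?s * ?L)" by (simp add: algebra_simps)
  \<comment> \<open>As \<open>?s \<ge> 1\<close>, the constant
    \<open>1024 ^ 6 + 1 \<le> 2 ^ 61\<close> can move into the base of the power. With
    \<open>200 \<le> 2 ^ 8\<close> the exponent becomes \<open>61 + 8 = 69\<close>.\<close>
  also have "\<dots> \<le> (2 ^ 61) ^ ?s * ((2 ^ 8) ^ ?s * ?L)"
  proof (intro mult_mono power_mono)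
    have "(1024 ^ 6 + 1 :: real) \<le> 2 ^ 61" by simp
    also have "\<dots> \<le> (2 ^ 61) ^ ?s" using s by (intro self_le_power) auto
    finally show "(1024 ^ 6 + 1 :: real) \<le> (2 ^ 61) ^ ?s" .
  qed (use L in auto)
  also have "\<dots> = 2 ^ (61 * ?s + 8 * ?s) * ?L"
    unfolding power_add power_mult by (rule mult.assoc[symmetric])
  also have "\<dots> = ?L * 2 ^ (69 * ?s)" by (simp add: mult.commute)
  also have "\<dots> = ?L * 2 powr (69 * real ?s)" by (simp flip: powr_realpow)
  finally show "\<exists>A. online_algorithm n A \<and> expected_cost n A \<le> ?L * 2 powr (69 * real ?s)"
    using A by (intro exI[of _ A]) auto
qed simp

end
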